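(* Let $\ell\ge0$ and $0<|q|<1$. Consider the Baxter operator acting on functions $f$ on the set of partitions $\lambda=(\lambda_1\ge\dots\ge\lambda_{\ell+1}\ge0)$ (with values in formal power series in $z$) by $$(\mathbf Q_z f)(\lambda)=\sum_{\mu\in\mathbb Z^{\ell+1}}\Delta_q(\mu)\,\mathbf Q_{\ell+1,\ell+1}(\mu,\lambda|z)\,f(\mu),$$ $$\mathbf Q_{\ell+1,\ell+1}(\mu,\lambda|z)=z^{|\mu|-|\lambda|}\,\frac{\Theta(\mu_1-\lambda_1)}{(\mu_1-\lambda_1)_q!}\prod_{i=1}^{\ell}\frac{\Theta(\lambda_i-\mu_{i+1})}{(\lambda_i-\mu_{i+1})_q!}\,\frac{\Theta(\mu_{i+1}-\lambda_{i+1})}{(\mu_{i+1}-\lambda_{i+1})_q!}.$$ (i) The $q$-Whittaker polynomials $P^{qW}_\lambda(x)$, $x=(x_1,\dots,x_{\ell+1})$, regarded as functions of $\lambda$, satisfy $$\mathbf Q_z\cdot P^{qW}_\lambda(x)=\mathbf L_z(x)\,P^{qW}_\lambda(x),\qquad \mathbf L_z(x)=\prod_{i=1}^{\ell+1}\Gamma_q(zx_i).$$ (ii) The operators $\mathbf Q_z$ and $D_{\ell+1}(X)=\sum_{r=0}^{\ell+1}X^rH_r$ satisfy $$D_{\ell+1}(-z)\circ\mathbf Q_z=\mathbf Q_{qz}.$$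
   Context: Notation: $\Gamma_q(x)=\prod_{j\ge0}\frac1{1-xq^j}$ (expanded as a power series in $z$ in $\Gamma_q(zx_i)$); $(n)_q!=\prod_{i=1}^n(1-q^i)$ for $n\ge0$; $\Theta(n)=1$ for integers $n\ge0$ and $0$ for $n<0$ (a term $\Theta(n)/(n)_q!$ with $n<0$ is $0$); $|\lambda|=\sum_i\lambda_i$; $\Delta_q(\lambda)=\prod_{i=1}^{\ell}(\lambda_i-\lambda_{i+1})_q!$. $q$-Whittaker polynomials: $P^{qW}_\lambda(x)=\Delta_q(\lambda)^{-1}P_\lambda(x;q,t=0)$, where $P_\lambda(x;q,t)$ are the Macdonald polynomials in $x_1,\dots,x_{\ell+1}$, i.e. $P_\lambda=m_\lambda+\sum_{\mu<\lambda}u_{\lambda\mu}m_\mu$ ($m_\mu$ monomial symmetric functions, $<$ dominance order), orthogonal (as symmetric functions in infinitely many variables, before setting $x_i=0$ for $i>\ell+1$) for $\langle p_\lambda,p_\mu\rangle_{q,t}=\delta_{\lambda\mu}z_\lambda\prod_{i:\lambda_i>0}\frac{1-q^{\lambda_i}}{1-t^{\lambda_i}}$, $z_\lambda=\prod_{n\ge1}n^{m_n}m_n!$, $m_n=|\{k:\lambda_k=n\}|$. $q$-Toda Hamiltonians: $H_0=1$ and, for $1\le r\le\ell+1$, $$(H_rf)(\lambda)=\sum_{I=\{i_1<\dots<i_r\}\subset\{1,\dots,\ell+1\}}\ \prod_{k=1}^r\bigl(1-q^{\lambda_{i_k}-\lambda_{i_k+1}+1}\bigr)^{1-\delta_{i_{k+1}-i_k,\,1}}\,f(\lambda+e_I),\qquad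 i_{r+1}:=\ell+2,$$ where $\lambda+e_I$ is obtained by adding $1$ to $\lambda_i$ for $i\in I$, and by convention $f(\nu)=0$ when $\nu\in\mathbb Z^{\ell+1}$ is not weakly decreasing. (For $i_k=\ell+1$ the exponent is $0$ and the factor is $1$.) *)

theory Defs
  imports "HOL-Complex_Analysis.Complex_Analysis" "HOL-Library.Multiset"
begin

section \<open>Formal power series in infinitely many variables\<close>

text \<open>
  A monomial in the variables \<open>x\<^sub>0, x\<^sub>1, x\<^sub>2, \<dots>\<close> is the multiset of the indices of its factors:
  \<open>x\<^sub>0\<^sup>2 x\<^sub>3\<close> is \<open>{#0, 0, 3#}\<close>, and the exponent of \<open>x\<^sub>i\<close> in \<open>M\<close> is \<open>count M i\<close>.
  All indices start at 0: the variables \<open>x\<^sub>1, \<dots>, x\<^bsub>l+1\<^esub>\<close> are \<open>x 0, \<dots>, x l\<close>, and likewise for parts of partitions.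
\<close>

typedef 'a mfps = "UNIV :: (nat multiset \<Rightarrow> 'a) set"
  morphisms mcoeff Abs_mfps ..

lemma mcoeff_Abs_mfps [simp]: "mcoeff (Abs_mfps f) = f"
  by (simp add: Abs_mfps_inverse)

lemma mfps_eqI: "(\<And>M. mcoeff f M = mcoeff g M) \<Longrightarrow> f = g"
  by (metis ext mcoeff_inject)

lemma finite_mset_splits: "finite {(A, B). A + B = (M :: 'b multiset)}"
proof -
  have "finite {A. A \<subseteq># M}"
  proof (induction M)
    case (add x M)
    have "{A. A \<subseteq># add_mset x M} \<subseteq> {A. A \<subseteq># M} \<union> add_mset x ` {A. A \<subseteq># M}"
    proof
      fix A assume "A \<in> {A. A \<subseteq># add_mset x M}"
      hence A: "A \<subseteq># add_mset x M" by simp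
      show "A \<in> {A. A \<subseteq># M} \<union> add_mset x ` {A. A \<subseteq># M}"
      proof (cases "x \<in># A")
        case True
        then obtain B where "A = add_mset x B" by (meson multi_member_split)
        thus ?thesis using A by auto
      next
        case False
        hence "A \<subseteq># M" using A
          by (metis add_mset_remove_trivial diff_single_trivial subset_eq_diff_conv
              union_mset_add_mset_right add.right_neutral)
        thus ?thesis by simp
      qed
    qed
    thus ?case using add by (meson finite_UnI finite_imageI finite_subset)
  qed simp
  hence "finite ((\<lambda>A. (A, M - A)) ` {A. A \<subseteq># M})" by simp
  moreover have "{(A, B). A + B = M} \<subseteq> (\<lambda>A. (A, M - A)) ` {A. A \<subseteq># M}" by auto
  ultimately show ?thesis by (rule finite_subset[rotated])
qed

instantiation mfps :: (comm_ring_1) comm_ring_1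
begin

definition "0 = Abs_mfps (\<lambda>_. 0 :: 'a)"
definition "1 = Abs_mfps (\<lambda>M. if M = {#} then 1 :: 'a else 0)"
definition "f + g = Abs_mfps (\<lambda>M. mcoeff f M + mcoeff g M :: 'a)"
definition "f - g = Abs_mfps (\<lambda>M. mcoeff f M - mcoeff g M :: 'a)"
definition "- f = Abs_mfps (\<lambda>M. - mcoeff f M :: 'a)"
definition "f * g = Abs_mfps (\<lambda>M. \<Sum>(A, B) | A + B = M. mcoeff f A * mcoeff g B :: 'a)"

instance
proof
  fix a b c :: "'a mfps"
  show "a * b * c = a * (b * c)"
  proof (rule mfps_eqI)
    fix M
    have "mcoeff (a * b * c) M =
        (\<Sum>(A, B) | A + B = M. \<Sum>(C, D) | C + D = A. mcoeff a C * mcoeff b D * mcoeff c B)"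
      by (auto simp: times_mfps_def sum_distrib_right split_def intro!: sum.cong)
    also have "\<dots> = (\<Sum>((A, B), (C, D)) \<in> Sigma {(A, B). A + B = M} (\<lambda>(A, B). {(C, D). C + D = A}).
        mcoeff a C * mcoeff b D * mcoeff c B)"
      by (subst sum.Sigma[symmetric]) (auto simp: split_def finite_mset_splits[unfolded split_def])
    also have "\<dots> = (\<Sum>((A, B), (C, D)) \<in> Sigma {(A, B). A + B = M} (\<lambda>(A, B). {(C, D). C + D = B}).
        mcoeff a A * (mcoeff b C * mcoeff c D))"
      by (rule sum.reindex_bij_witness[where
            j = "\<lambda>((A, B), (C, D)). ((C, D + B), (D, B))" and
            i = "\<lambda>((A, B), (C, D)). ((A + C, D), (A, C))"]) (auto simp: algebra_simps)
    also have "\<dots> = (\<Sum>(A, B) | A + B = M. \<Sum>(C, D) | C + D = B. mcoeff a A * (mcoeff b C * mcoeff c D))"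
      by (subst sum.Sigma[symmetric]) (auto simp: split_def finite_mset_splits[unfolded split_def])
    also have "\<dots> = mcoeff (a * (b * c)) M"
      by (auto simp: times_mfps_def sum_distrib_left split_def intro!: sum.cong)
    finally show "mcoeff (a * b * c) M = mcoeff (a * (b * c)) M" .
  qed
  show "a * b = b * a"
    unfolding times_mfps_def
    by (intro arg_cong[where f = Abs_mfps] ext sum.reindex_bij_witness[where i = prod.swap and j = prod.swap])
       (auto simp: mult.commute add.commute)
  show "1 * a = a"
  proof (rule mfps_eqI)
    fix M
    have "mcoeff (1 * a) M = (\<Sum>(A, B) | A + B = M. if (A, B) = ({#}, M) then mcoeff a M else 0)"
      by (auto simp: times_mfps_def one_mfps_def intro!: sum.cong)
    also have "\<dots> = mcoeff a M"
      by (subst sum.mono_neutral_right[where S = "{({#}, M)}"]) (auto simp: finite_mset_splits split: if_splits)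
    finally show "mcoeff (1 * a) M = mcoeff a M" .
  qed
  show "(a + b) * c = a * c + b * c"
    by (rule mfps_eqI)
       (simp add: times_mfps_def plus_mfps_def algebra_simps sum.distrib split_def)
  show "(0 :: 'a mfps) \<noteq> 1"
  proof
    assume "(0 :: 'a mfps) = 1"
    hence "mcoeff (0 :: 'a mfps) {#} = mcoeff 1 {#}" by simp
    thus False by (simp add: zero_mfps_def one_mfps_def)
  qed
qed (rule mfps_eqI, simp add: plus_mfps_def zero_mfps_def uminus_mfps_def minus_mfps_def
       algebra_simps)+

end

definition mscale :: "'a::comm_ring_1 \<Rightarrow> 'a mfps \<Rightarrow> 'a mfps" where
  "mscale c f = Abs_mfps (\<lambda>M. c * mcoeff f M)"

text \<open>The value of \<open>f\<close> at \<open>x\<^sub>0, \<dots>, x\<^sub>l\<close> and \<open>x\<^sub>i = 0\<close> for \<open>i > l\<close>, for \<open>f\<close> of bounded degree.\<close>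

definition meval :: "nat \<Rightarrow> 'a::comm_ring_1 mfps \<Rightarrow> (nat \<Rightarrow> 'a) \<Rightarrow> 'a" where
  "meval l f x = (\<Sum>M | set_mset M \<subseteq> {..l} \<and> mcoeff f M \<noteq> 0. mcoeff f M * (\<Prod>i\<in>#M. x i))"


section \<open>Partitions and Macdonald symmetric functions\<close>

text \<open>A partition is an infinite weakly decreasing sequence of finitely many nonzero parts.\<close>

definition is_partition :: "(nat \<Rightarrow> nat) \<Rightarrow> bool" where
  "is_partition lam \<longleftrightarrow> antimono lam \<and> finite {i. lam i \<noteq> 0}"

definition psize :: "(nat \<Rightarrow> nat) \<Rightarrow> nat" where
  "psize lam = (\<Sum>i | lam i \<noteq> 0. lam i)"

definition dominated :: "(nat \<Rightarrow> nat) \<Rightarrow> (nat \<Rightarrow> nat) \<Rightarrow> bool" where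
  "dominated \<mu> lam \<longleftrightarrow> is_partition \<mu> \<and> is_partition lam \<and> psize \<mu> = psize lam \<and>
     (\<forall>k. (\<Sum>i<k. \<mu> i) \<le> (\<Sum>i<k. lam i))"

text \<open>The coefficient is 1 on the monomials whose exponent sequence is a rearrangement of \<open>\<lambda>\<close>.\<close>

definition monomial_sym :: "(nat \<Rightarrow> nat) \<Rightarrow> complex mfps" where
  "monomial_sym lam = Abs_mfps (\<lambda>M. if \<exists>\<pi>. bij \<pi> \<and> count M = lam \<circ> \<pi> then 1 else 0)"

definition power_sum :: "nat \<Rightarrow> complex mfps" where
  "power_sum n = Abs_mfps (\<lambda>M. if \<exists>i. M = replicate_mset n i then 1 else 0)"

definition power_sum_part :: "(nat \<Rightarrow> nat) \<Rightarrow> complex mfps" where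
  "power_sum_part lam = (\<Prod>i | lam i \<noteq> 0. power_sum (lam i))"

definition mult_part :: "(nat \<Rightarrow> nat) \<Rightarrow> nat \<Rightarrow> nat" where
  "mult_part lam n = card {k. lam k = n}"

definition z_part :: "(nat \<Rightarrow> nat) \<Rightarrow> nat" where
  "z_part lam = (\<Prod>n \<in> range lam - {0}. n ^ mult_part lam n * fact (mult_part lam n))"

definition power_sum_coeffs :: "complex mfps \<Rightarrow> (nat \<Rightarrow> nat) \<Rightarrow> complex" where
  "power_sum_coeffs f = (THE c. finite {lam. c lam \<noteq> 0} \<and> (\<forall>lam. c lam \<noteq> 0 \<longrightarrow> is_partition lam) \<and>
     f = (\<Sum>lam | c lam \<noteq> 0. mscale (c lam) (power_sum_part lam)))"

text \<open>
  The bilinear form on symmetric functions with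
  \<open>\<langle>p\<^sub>\<lambda>, p\<^sub>\<mu>\<rangle> = \<delta>\<^sub>\<lambda>\<^sub>\<mu> z\<^sub>\<lambda> \<Prod>\<^sub>i (1 - q\<^bsup>\<lambda>\<^sub>i\<^esup>) / (1 - t\<^bsup>\<lambda>\<^sub>i\<^esup>)\<close>. It is complex bilinear, not sesquilinear.
\<close>

definition macdonald_form :: "complex \<Rightarrow> complex \<Rightarrow> complex mfps \<Rightarrow> complex mfps \<Rightarrow> complex" where
  "macdonald_form q t f g =
     (\<Sum>lam | power_sum_coeffs f lam \<noteq> 0. power_sum_coeffs f lam * power_sum_coeffs g lam *
        of_nat (z_part lam) * (\<Prod>i | lam i \<noteq> 0. (1 - q ^ lam i) / (1 - t ^ lam i)))"

text \<open>The family is set to 0 off the partitions in order to make it unique. At \<open>t = 0\<close>, \<open>\<bar>q\<bar> < 1\<close>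
  the form is regular and \<open>\<langle>P\<^sub>\<lambda>, P\<^sub>\<lambda>\<rangle> \<noteq> 0\<close>, so the conditions determine the family there directly.\<close>

definition is_macdonald_family ::
    "complex \<Rightarrow> complex \<Rightarrow> ((nat \<Rightarrow> nat) \<Rightarrow> complex mfps) \<Rightarrow> bool" where
  "is_macdonald_family q t P \<longleftrightarrow>
     (\<forall>lam. \<not> is_partition lam \<longrightarrow> P lam = 0) \<and>
     (\<forall>lam. is_partition lam \<longrightarrow> (\<exists>u. P lam = monomial_sym lam +
        (\<Sum>\<mu> | dominated \<mu> lam \<and> \<mu> \<noteq> lam. mscale (u \<mu>) (monomial_sym \<mu>)))) \<and>
     (\<forall>lam \<mu>. is_partition lam \<longrightarrow> is_partition \<mu> \<longrightarrow> lam \<noteq> \<mu> \<longrightarrow> macdonald_form q t (P lam) (P \<mu>) = 0)"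

definition macdonald_P :: "complex \<Rightarrow> complex \<Rightarrow> (nat \<Rightarrow> nat) \<Rightarrow> complex mfps" where
  "macdonald_P q t = (THE P. is_macdonald_family q t P)"


section \<open>$q$-Whittaker polynomials, Baxter operator and $q$-Toda Hamiltonians\<close>

text \<open>The elements of \<open>\<int>\<^bsup>l+1\<^esup>\<close> are the integer sequences \<open>\<mu>\<^sub>0, \<dots>, \<mu>\<^sub>l\<close>, extended by 0.\<close>

definition tuples :: "nat \<Rightarrow> (nat \<Rightarrow> int) set" where
  "tuples l = {\<mu>. \<forall>i>l. \<mu> i = 0}"

definition weakly_decreasing :: "nat \<Rightarrow> (nat \<Rightarrow> int) \<Rightarrow> bool" where
  "weakly_decreasing l \<mu> \<longleftrightarrow> (\<forall>i<l. \<mu> (Suc i) \<le> \<mu> i)"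

definition partition_tuples :: "nat \<Rightarrow> (nat \<Rightarrow> int) set" where
  "partition_tuples l = {lam \<in> tuples l. weakly_decreasing l lam \<and> 0 \<le> lam l}"

definition tsize :: "nat \<Rightarrow> (nat \<Rightarrow> int) \<Rightarrow> int" where
  "tsize l \<mu> = (\<Sum>i\<le>l. \<mu> i)"

definition qfac :: "complex \<Rightarrow> int \<Rightarrow> complex" where
  "qfac q n = (\<Prod>i=1..nat n. 1 - q ^ i)"

definition Theta :: "int \<Rightarrow> complex" where
  "Theta n = (if n \<ge> 0 then 1 else 0)"

definition Delta_q :: "complex \<Rightarrow> nat \<Rightarrow> (nat \<Rightarrow> int) \<Rightarrow> complex" where
  "Delta_q q l lam = (\<Prod>i<l. qfac q (lam i - lam (Suc i)))"

definition qWhittaker :: "complex \<Rightarrow> nat \<Rightarrow> (nat \<Rightarrow> int) \<Rightarrow> (nat \<Rightarrow> complex) \<Rightarrow> complex" where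
  "qWhittaker q l lam x = inverse (Delta_q q l lam) * meval l (macdonald_P q 0 (\<lambda>i. nat (lam i))) x"

definition Gamma_q :: "complex \<Rightarrow> complex \<Rightarrow> complex" where
  "Gamma_q q x = (\<Prod>j. 1 / (1 - x * q ^ j))"

text \<open>\<open>L\<^sub>z(x)\<close> as a formal power series in \<open>z\<close>: each factor is the Taylor series at \<open>z = 0\<close>.\<close>

definition L_eigenvalue :: "complex \<Rightarrow> nat \<Rightarrow> (nat \<Rightarrow> complex) \<Rightarrow> complex fps" where
  "L_eigenvalue q l x = (\<Prod>i\<le>l. fps_expansion (\<lambda>z. Gamma_q q (z * x i)) 0)"

text \<open>
  The spectral parameter \<open>z\<close> is an element of the power series ring, so that it can be
  the variable \<open>fps_X\<close> as well as \<open>q\<close> times the variable. If all \<open>\<Theta>\<close>-factors are nonzero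
  then \<open>\<bar>\<mu>\<bar> - \<bar>\<lambda>\<bar> \<ge> 0\<close>, so the truncation by \<^const>\<open>nat\<close> only affects terms that vanish.
\<close>

definition Q_kernel ::
    "complex \<Rightarrow> nat \<Rightarrow> complex fps \<Rightarrow> (nat \<Rightarrow> int) \<Rightarrow> (nat \<Rightarrow> int) \<Rightarrow> complex fps" where
  "Q_kernel q l z \<mu> lam = z ^ nat (tsize l \<mu> - tsize l lam) *
     fps_const (Theta (\<mu> 0 - lam 0) / qfac q (\<mu> 0 - lam 0) *
       (\<Prod>i<l. Theta (lam i - \<mu> (Suc i)) / qfac q (lam i - \<mu> (Suc i)) *
              (Theta (\<mu> (Suc i) - lam (Suc i)) / qfac q (\<mu> (Suc i) - lam (Suc i)))))"

text \<open>
  Functions on partitions are total functions whose values off \<^term>\<open>partition_tuples l\<close> are irrelevant: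
  for \<open>\<lambda>\<close> a partition the kernel vanishes unless \<open>\<mu>\<close> is one.
  The infinite sum converges in the standard (adic) topology of formal power series
  when \<open>z\<close> has zero constant coefficient.
\<close>

definition Baxter_Q :: "complex \<Rightarrow> nat \<Rightarrow> complex fps \<Rightarrow>
    ((nat \<Rightarrow> int) \<Rightarrow> complex fps) \<Rightarrow> (nat \<Rightarrow> int) \<Rightarrow> complex fps" where
  "Baxter_Q q l z f lam = (\<Sum>\<^sub>\<infinity>\<mu>\<in>tuples l. fps_const (Delta_q q l \<mu>) * Q_kernel q l z \<mu> lam * f \<mu>)"

definition add_ind :: "(nat \<Rightarrow> int) \<Rightarrow> nat set \<Rightarrow> nat \<Rightarrow> int" where
  "add_ind lam I = (\<lambda>i. lam i + (if i \<in> I then 1 else 0))"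

text \<open>
  The list \<open>js\<close> is \<open>i\<^sub>1 < \<dots> < i\<^sub>r\<close> followed by \<open>i\<^bsub>r+1\<^esub>\<close>,
  which is \<open>Suc l\<close> because the indices are \<open>0, \<dots>, l\<close>.
\<close>

definition Toda_coeff :: "complex \<Rightarrow> nat \<Rightarrow> nat set \<Rightarrow> (nat \<Rightarrow> int) \<Rightarrow> complex" where
  "Toda_coeff q l I lam =
     (let js = sorted_list_of_set I @ [Suc l]
      in \<Prod>k<card I. (1 - q powi (lam (js ! k) - lam (Suc (js ! k)) + 1)) ^
           (if js ! Suc k - js ! k = 1 then 0 else 1))"

definition Toda_H :: "complex \<Rightarrow> nat \<Rightarrow> nat \<Rightarrow>
    ((nat \<Rightarrow> int) \<Rightarrow> complex fps) \<Rightarrow> (nat \<Rightarrow> int) \<Rightarrow> complex fps" where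
  "Toda_H q l r f lam =
     (if r = 0 then f lam
      else \<Sum>I | I \<subseteq> {..l} \<and> card I = r. fps_const (Toda_coeff q l I lam) *
        (if weakly_decreasing l (add_ind lam I) then f (add_ind lam I) else 0))"

definition Toda_D :: "complex \<Rightarrow> nat \<Rightarrow> complex fps \<Rightarrow>
    ((nat \<Rightarrow> int) \<Rightarrow> complex fps) \<Rightarrow> (nat \<Rightarrow> int) \<Rightarrow> complex fps" where
  "Toda_D q l X f lam = (\<Sum>r\<le>Suc l. X ^ r * Toda_H q l r f lam)"

end

theory Submission
  imports Defs "HOL-Combinatorics.Permutations"
begin

text \<open>
  Write \<open>W_lam\<close> (\<open>qWhit\<close>) for the Macdonald polynomial \<open>P_lam(q, 0)\<close> in infinitely many variables, so that
  the \<open>q\<close>-Whittaker polynomial is \<open>W_lam / Delta_q(lam)\<close>, and let \<open>g_n\<close> (\<open>cplt\<close>) be the coefficients of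
  \<open>\<Prod>\<^sub>i 1 / (z x\<^sub>i; q)\<^sub>\<infinity> = \<Sum>\<^sub>n g_n z\<^sup>n\<close>. Two kinds of weights govern everything. The horizontal strip
  weight \<open>K(lam, mu)\<close> (\<open>strip_wt\<close>) is a product of inverse \<open>q\<close>-factorials that vanishes unless \<open>lam\<close> and \<open>mu\<close>
  interlace; \<open>c(lam)\<close> (\<open>norm_wt\<close>) is a product of \<open>q\<close>-factorials of the differences of the parts. Restricted
  to \<open>l + 1\<close> rows, \<open>c(lam) K(lam, mu)\<close> is \<open>Delta_q(lam)\<close> times the kernel of the Baxter operator. The
  eigenvalue equation (i) is therefore the Pieri rule
  \<open>g_n W_lam = c(lam) \<Sum> K(lam, mu) W_mu\<close>, summed over \<open>mu\<close> with \<open>n\<close> more boxes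
  and evaluated at \<open>l + 1\<close> variables, where \<open>W_mu\<close> with more than
  \<open>l + 1\<close> rows disappears; the \<open>q\<close>-binomial theorem identifies the generating function of the \<open>g_n\<close> with
  \<open>L_z(x)\<close>.

  Part (ii) is an identity between kernels for each fixed pair \<open>lam\<close>, \<open>mu\<close>: a sum over subsets \<open>I\<close> of the rows
  whose summands are products of local factors, the factor at row \<open>i\<close> depending only on whether
  \<open>i \<in> I\<close> and whether \<open>i + 1 \<in> I\<close>. Such a sum is a product of \<open>2 \<times> 2\<close> transfer matrices, and a
  linear relation between the two components of the transfer vector survives every step and gives the value
  (\<open>sum_toda_local\<close>, \<open>Toda_kern_sum\<close>).

  Macdonald polynomials are only given by triangularity and orthogonality, so the Pieri rule is proved for an
  explicit family which is identified afterwards. The family is defined by the branching rule: the coefficient of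
  \<open>y\<^sup>k\<close> in \<open>W_mu(y, x\<^sub>0, x\<^sub>1, \<dots>)\<close> is \<open>c(mu) \<Sum> K(lam, mu) W_lam\<close> over \<open>lam\<close> with \<open>k\<close> boxes
  less. Call the passage from \<open>f\<close> to such a coefficient peeling (\<open>peel\<close>). A family of formal series that is stable under
  peeling and has no constant terms is zero (\<open>peel_family_eq_0\<close>), so an identity may be checked after
  peeling. In this way multiplication by elementary symmetric functions \<open>e_r\<close> (\<open>elem\<close>) is computed: the Pieri rule
  \<open>elem_Pieri\<close> reduces to an exchange rule between adding a vertical strip and removing a horizontal one, again a
  comparison of two transfer matrices (\<open>sum_up_down\<close>). The rule for \<open>g_n\<close> follows from it: with
  \<open>G(z) = \<Sum> g_n z\<^sup>n\<close> and \<open>E(z) = \<Sum> e_r z\<^sup>r\<close> one has \<open>G(q z) = E(-z) G(z)\<close>, and by the infinite-row form of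
  (ii) the right-hand side of the Pieri rule satisfies the same \<open>q\<close>-difference equation; since \<open>q\<^sup>n \<noteq> 1\<close>,
  comparing coefficients of \<open>z\<^sup>n\<close> gives \<open>cplt_Pieri\<close> by induction on \<open>n\<close>.

  The identification uses the Pieri rule once more. It expresses every \<open>W_mu\<close> as a polynomial in the \<open>g_n\<close>,
  which are polynomials in the power sums; hence \<open>W_mu\<close> is symmetric. Peeling \<open>n\<close> is the adjoint of multiplication
  by \<open>g_n\<close> for the Macdonald form (\<open>form_cplt_mult\<close>), and the Pieri and branching coefficients are
  transposes of each other up to the factors \<open>c\<close>, so the \<open>W_mu\<close> are orthogonal with norms \<open>c(mu) \<noteq> 0\<close>.
  Triangularity with respect to monomial symmetric functions holds because \<open>k\<close> horizontal strips remove at most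
  the boxes of the \<open>k\<close> largest rows. Triangularity and orthogonality with nonzero norms determine the family, by
  induction on the dominance order (\<open>macdonald_P_eq\<close>).
\<close>

section \<open>Transfer matrices for sums over subsets\<close>

text \<open>
  The \<open>True\<close> and \<open>False\<close> components at \<open>n\<close> form the transfer vector of a sum over subsets of \<open>{..<n}\<close>, where
  the local factor \<open>w i s s'\<close> sees the membership of \<open>i\<close> and of \<open>Suc i\<close>; the argument of \<open>transfer\<close> prescribes
  the membership of \<open>n\<close>.
\<close>

primrec transfer :: "(nat \<Rightarrow> bool \<Rightarrow> bool \<Rightarrow> 'a::comm_ring_1) \<Rightarrow> nat \<Rightarrow> bool \<Rightarrow> 'a" where
  "transfer w 0 s = 1"
| "transfer w (Suc k) s = transfer w k False * w k False s + transfer w k True * w k True s"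

lemma transfer_eq_sum_subsets_aux:
  "transfer w n s = (\<Sum>I\<in>Pow {..<n}. \<Prod>i<n. w i (i \<in> I) (if Suc i < n then Suc i \<in> I else s))"
proof (induction n arbitrary: s)
  case (Suc n)
  have split: "Pow {..<Suc n} = Pow {..<n} \<union> insert n ` Pow {..<n}"
    by (simp add: lessThan_Suc Pow_insert)
  have inj: "inj_on (insert n) (Pow {..<n})"
    by (auto simp: inj_on_def)
  have last: "(\<Prod>i<Suc n. w i (i \<in> J) (if Suc i < Suc n then Suc i \<in> J else s)) =
      (\<Prod>i<n. w i (i \<in> I) (if Suc i < n then Suc i \<in> I else t)) * w n t s"
    if "J = I \<or> J = insert n I" and "(n \<in> J) = t" for I J t
  proof -
    have "(\<Prod>i<n. w i (i \<in> J) (if Suc i < Suc n then Suc i \<in> J else s)) =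
        (\<Prod>i<n. w i (i \<in> I) (if Suc i < n then Suc i \<in> I else t))"
    proof (rule prod.cong)
      fix i assume "i \<in> {..<n}"
      then have "Suc i < n \<or> Suc i = n" by auto
      then show "w i (i \<in> J) (if Suc i < Suc n then Suc i \<in> J else s) =
          w i (i \<in> I) (if Suc i < n then Suc i \<in> I else t)"
        using that by auto
    qed simp
    then show ?thesis using that by simp
  qed
  have "(\<Sum>I\<in>Pow {..<Suc n}. \<Prod>i<Suc n. w i (i \<in> I) (if Suc i < Suc n then Suc i \<in> I else s)) =
      (\<Sum>I\<in>Pow {..<n}. \<Prod>i<Suc n. w i (i \<in> I) (if Suc i < Suc n then Suc i \<in> I else s)) +
      (\<Sum>I\<in>Pow {..<n}. \<Prod>i<Suc n. w i (i \<in> insert n I) (if Suc i < Suc n then Suc i \<in> insert n I else s))"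
    unfolding split
    by (subst sum.union_disjoint) (auto simp: sum.reindex[OF inj])
  also have "\<dots> = transfer w n False * w n False s + transfer w n True * w n True s"
  proof -
    have "(\<Sum>I\<in>Pow {..<n}. \<Prod>i<Suc n. w i (i \<in> I) (if Suc i < Suc n then Suc i \<in> I else s)) =
        (\<Sum>I\<in>Pow {..<n}. (\<Prod>i<n. w i (i \<in> I) (if Suc i < n then Suc i \<in> I else False)) * w n False s)"
    proof (rule sum.cong)
      fix I assume I: "I \<in> Pow {..<n}"
      then have "n \<notin> I" by auto
      then show "(\<Prod>i<Suc n. w i (i \<in> I) (if Suc i < Suc n then Suc i \<in> I else s)) =
        (\<Prod>i<n. w i (i \<in> I) (if Suc i < n then Suc i \<in> I else False)) * w n False s"
        using last[of I I False] by (simp del: prod.lessThan_Suc)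
    qed simp
    moreover have "(\<Sum>I\<in>Pow {..<n}. \<Prod>i<Suc n. w i (i \<in> insert n I) (if Suc i < Suc n then Suc i \<in> insert n I else s)) =
        (\<Sum>I\<in>Pow {..<n}. (\<Prod>i<n. w i (i \<in> I) (if Suc i < n then Suc i \<in> I else True)) * w n True s)"
      by (intro sum.cong refl last) auto
    ultimately show ?thesis
      by (simp only: Suc.IH sum_distrib_right)
  qed
  finally show ?case by simp
qed simp

lemma transfer_eq_sum_subsets:
  "transfer w n False = (\<Sum>I\<in>Pow {..<n}. \<Prod>i<n. w i (i \<in> I) (Suc i \<in> I))"
proof -
  have "(\<Prod>i<n. w i (i \<in> I) (if Suc i < n then Suc i \<in> I else False)) = (\<Prod>i<n. w i (i \<in> I) (Suc i \<in> I))"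
    if "I \<in> Pow {..<n}" for I
  proof -
    have "(if Suc i < n then Suc i \<in> I else False) = (Suc i \<in> I)" for i
      using that by auto
    then show ?thesis by (simp only:)
  qed
  then show ?thesis
    unfolding transfer_eq_sum_subsets_aux[of w n False] by (rule sum.cong[OF refl])
qed

text \<open>
  With \<open>B i = q\<^sup>b\<close> for \<open>b = mu i - lam i\<close> and \<open>A i = q\<^sup>a\<^sup>+\<^sup>1\<close> for \<open>a = lam i - mu (Suc i)\<close>, this is what
  adding a box to row \<open>i\<close> of \<open>lam\<close> does to the factors of the horizontal strip weight and of the Hamiltonian,
  after the common factor \<open>1 / ((q)\<^sub>b (q)\<^sub>a\<^sub>+\<^sub>1)\<close> has been taken out.
\<close>

definition toda_local :: "(nat \<Rightarrow> 'a) \<Rightarrow> (nat \<Rightarrow> 'a) \<Rightarrow> nat \<Rightarrow> bool \<Rightarrow> bool \<Rightarrow> 'a::comm_ring_1" where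
  "toda_local A B i s s' = (if s then - (1 - B i) else 1 - A i) * (if s \<and> \<not> s' then 1 - A i * B (Suc i) else 1)"

text \<open>
  At a row with \<open>B k = 1\<close> the unwanted component drops out. The relation is found by computing the first
  steps: the vector stays on a line through the closed product, and this is all that is needed.
\<close>

lemma transfer_toda_invariant:
  "transfer (toda_local A B) k False =
     B k * (\<Prod>i<k. (1 - A i) * B i) + (1 - B k) * transfer (toda_local A B) k True"
proof (induction k)
  case (Suc k)
  then show ?case by (simp add: toda_local_def) (simp add: algebra_simps)
qed simp

lemma sum_toda_local:
  assumes "B n = 1"
  shows "(\<Sum>I\<in>Pow {..<n}. \<Prod>i<n. toda_local A B i (i \<in> I) (Suc i \<in> I)) = (\<Prod>i<n. (1 - A i) * B i)"
  unfolding transfer_eq_sum_subsets[of "toda_local A B", symmetric]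
  using transfer_toda_invariant[of A B n] assms by simp

text \<open>
  The two orders of adding a vertical strip (with weight \<open>x\<close> for each box) and removing a horizontal strip, row by
  row, where \<open>A i = q\<^sup>a\<close> with \<open>a = nu i - lam (Suc i)\<close> and \<open>B i = q\<^sup>b\<^sup>+\<^sup>1\<close> with \<open>b = lam i - nu i\<close> for the
  initial shape \<open>lam\<close> and the final shape \<open>nu\<close>. In \<open>up_down\<close> the subset consists of the rows of \<open>lam\<close> that get a
  box first; in \<open>down_up\<close> it consists of the rows of \<open>nu\<close> that got their box last.
\<close>

definition up_down :: "(nat \<Rightarrow> 'a) \<Rightarrow> (nat \<Rightarrow> 'a) \<Rightarrow> 'a \<Rightarrow> nat \<Rightarrow> bool \<Rightarrow> bool \<Rightarrow> 'a::comm_ring_1" where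
  "up_down A B x i s s' = (if s then x else 1 - B i) * (if s' then 1 - A i else 1) *
     (if s \<and> \<not> s' then 1 - A i * B i else 1)"

definition down_up :: "(nat \<Rightarrow> 'a) \<Rightarrow> (nat \<Rightarrow> 'a) \<Rightarrow> 'a \<Rightarrow> nat \<Rightarrow> bool \<Rightarrow> bool \<Rightarrow> 'a::comm_ring_1" where
  "down_up A B x i s s' = (if s then x * (1 - A i) else 1 - B i) * (if \<not> s \<and> s' then 1 - A i * B (Suc i) else 1)"

text \<open>
  The two transfer vectors differ at every step, but these two linear relations between them are reproduced. The
  first alone is not: its induction step needs the second, and conversely.
\<close>

lemma transfer_up_down_invariants:
  fixes A B :: "nat \<Rightarrow> 'a::comm_ring_1" and x :: 'a
  defines "U \<equiv> transfer (up_down A B x)" and "V \<equiv> transfer (down_up A B x)"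
  shows "x * V k True + (1 - B k) * V k False = x * U k True + (1 - B k) * U k False
    \<and> V k True - B k * U k True = (1 - B k) * V k False"
proof (induction k)
  case (Suc k)
  let ?B = "B k" and ?B' = "B (Suc k)" and ?A = "A k"
  have a: "x * V k True + (1 - ?B) * V k False = x * U k True + (1 - ?B) * U k False"
    and b: "V k True = ?B * U k True + (1 - ?B) * V k False" using Suc by (auto simp: algebra_simps)
  have VT: "V (Suc k) True = x * (1 - ?A) * V k True + (1 - ?B) * (1 - ?A * ?B') * V k False"
    and VF: "V (Suc k) False = x * (1 - ?A) * V k True + (1 - ?B) * V k False"
    and UT: "U (Suc k) True = (1 - ?A) * (x * V k True + (1 - ?B) * V k False)"
    and UF: "U (Suc k) False = x * (1 - ?A * ?B) * U k True + (1 - ?B) * U k False"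
    unfolding a unfolding U_def V_def by (simp_all add: up_down_def down_up_def algebra_simps)
  have d1: "V (Suc k) True - U (Suc k) True = (1 - ?B) * ?A * (1 - ?B') * V k False"
    unfolding VT UT by (simp add: algebra_simps)
  have "U (Suc k) False - V (Suc k) False =
      (x * U k True + (1 - ?B) * U k False) - (x * V k True + (1 - ?B) * V k False)
      + x * ?A * (V k True - ?B * U k True)"
    unfolding UF VF by (simp add: algebra_simps)
  also have "\<dots> = x * ?A * ((1 - ?B) * V k False)" using a b by simp
  finally have d2: "U (Suc k) False - V (Suc k) False = x * ?A * ((1 - ?B) * V k False)" .
  have "x * (V (Suc k) True - U (Suc k) True) = (1 - ?B') * (U (Suc k) False - V (Suc k) False)"
    unfolding d1 d2 by (simp add: algebra_simps)
  then have 1: "x * V (Suc k) True + (1 - ?B') * V (Suc k) False =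
      x * U (Suc k) True + (1 - ?B') * U (Suc k) False"
    by (simp add: algebra_simps)
  have 2: "V (Suc k) True - ?B' * U (Suc k) True = (1 - ?B') * V (Suc k) False"
    unfolding VT VF UT by (simp add: algebra_simps)
  from 1 2 show ?case by blast
qed (simp add: U_def V_def)

text \<open>
  Beyond the last nonzero row one has \<open>A = 1\<close>, which kills the component \<open>True\<close> on the left-hand side, and
  \<open>B = q\<close>, which makes the factor \<open>1 - B\<close> in the invariants cancellable. One such extra row accounts for the factor
  \<open>1 + x\<close>.
\<close>

lemma sum_up_down:
  fixes x :: "'a::idom"
  assumes "A n = 1" and "B (Suc n) \<noteq> 1"
  shows "(\<Sum>I\<in>Pow {..<Suc n}. \<Prod>i<Suc n. up_down A B x i (i \<in> I) (Suc i \<in> I)) =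
    (1 + x) * (\<Sum>I\<in>Pow {..<Suc n}. \<Prod>i<Suc n. down_up A B x i (i \<in> I) (Suc i \<in> I))"
proof -
  let ?U = "transfer (up_down A B x)" and ?V = "transfer (down_up A B x)"
  have *: "u = (1 + x) * v"
    if "x * v' + (1 - b) * v = x * 0 + (1 - b) * u" "v' = (1 - b) * v" "b \<noteq> 1" for u v v' b :: 'a
  proof -
    have "(1 - b) * u = (1 - b) * ((1 + x) * v)"
      using that(1,2) by (simp add: algebra_simps)
    then show ?thesis using that(3) by simp
  qed
  have UT: "?U (Suc n) True = 0" and VT: "?V (Suc n) True = (1 - B (Suc n)) * ?V (Suc n) False"
    using assms(1) by (simp_all add: up_down_def down_up_def algebra_simps)
  have "x * ?V (Suc n) True + (1 - B (Suc n)) * ?V (Suc n) False = x * 0 + (1 - B (Suc n)) * ?U (Suc n) False"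
    using transfer_up_down_invariants[of x A B "Suc n"] unfolding UT by blast
  from *[OF this VT assms(2)] show ?thesis
    by (simp only: transfer_eq_sum_subsets)
qed

section \<open>\<open>q\<close>-factorials and local factors\<close>

text \<open>
  The value 0 at negative arguments makes \<open>iqf q (n - 1) = (1 - q\<^sup>n) iqf q n\<close> true for all integers, so that
  interlacing conditions never have to be treated separately from the weights.
\<close>

definition iqf :: "complex \<Rightarrow> int \<Rightarrow> complex" where
  "iqf q n = Theta n / qfac q n"

locale nome =
  fixes q :: complex
  assumes q_nonzero: "q \<noteq> 0" and norm_q: "norm q < 1"
begin

lemma one_minus_power_nonzero: "0 < n \<Longrightarrow> 1 - q ^ n \<noteq> 0"
proof
  assume "0 < n" "1 - q ^ n = 0"
  then have "norm (q ^ n) = 1" by simp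
  moreover have "norm (q ^ n) < 1"
    using norm_q \<open>0 < n\<close> by (simp add: norm_power power_less_one_iff)
  ultimately show False by simp
qed

lemma qfac_add_one: "0 \<le> n \<Longrightarrow> qfac q (n + 1) = qfac q n * (1 - q powi (n + 1))"
  by (simp add: qfac_def nat_add_distrib power_int_def del: One_nat_def)

lemma qfac_nonzero: "qfac q n \<noteq> 0"
  using one_minus_power_nonzero by (auto simp: qfac_def)

lemma iqf_0 [simp]: "iqf q 0 = 1"
  by (simp add: iqf_def Theta_def qfac_def)

lemma iqf_eq_0_iff: "iqf q n = 0 \<longleftrightarrow> n < 0"
  by (simp add: iqf_def Theta_def qfac_nonzero)

lemma iqf_neg: "n < 0 \<Longrightarrow> iqf q n = 0"
  by (simp add: iqf_eq_0_iff)

lemma qfac_iqf: "0 \<le> n \<Longrightarrow> qfac q n * iqf q n = 1"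
  by (simp add: iqf_def Theta_def qfac_nonzero)

lemma iqf_add_one: "iqf q n = (1 - q powi (n + 1)) * iqf q (n + 1)"
proof (cases "n < 0")
  case True
  then show ?thesis by (cases "n = -1") (simp_all add: iqf_neg)
next
  case False
  then have "1 - q powi (n + 1) \<noteq> 0"
    using qfac_nonzero[of "n + 1"] by (simp add: qfac_add_one)
  moreover have "iqf q (n + 1) = 1 / (qfac q n * (1 - q powi (n + 1)))"
    using False by (simp only: iqf_def Theta_def qfac_add_one) simp
  ultimately show ?thesis
    using False by (simp add: iqf_def Theta_def)
qed

lemma iqf_diff_one: "iqf q (n - 1) = (1 - q powi n) * iqf q n"
  using iqf_add_one[of "n - 1"] by simp

text \<open>
  The next four lemmas translate the factors of the strip weights that belong to one row into the local factors
  of the transfer matrices; \<open>s\<close> and \<open>s'\<close> tell whether this row and the next one receive a box. The common factor is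
  taken at the largest arguments of \<open>iqf\<close> that occur, so that the other values are multiples of it.
\<close>

lemma local_up_down:
  assumes "0 \<le> a + b" "A i = q powi a" "B i = q powi (b + 1)"
  shows "(if \<not> s \<and> s' then 1 - q powi (a + b) else 1) * qfac q (a + b + of_bool s - of_bool s') *
      (iqf q (b + of_bool s) * iqf q (a - of_bool s')) * (if s then x else 1)
    = qfac q (a + b) * (iqf q (b + 1) * iqf q a) * up_down A B x i s s'"
proof -
  have AB: "A i * B i = q powi (a + b + 1)"
    using assms q_nonzero by (simp add: power_int_add)
  consider "s = s'" | "s \<and> \<not> s'" | "\<not> s \<and> s'" by blast
  then show ?thesis
  proof cases
    case 3
    show ?thesis
    proof (cases "a + b = 0")
      case True
      then have "a = - b" by simp
      then have "iqf q b * iqf q (a - 1) = 0"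
        by (cases "b < 0") (auto simp: iqf_neg)
      then have "(1 - B i) * iqf q (b + 1) * ((1 - A i) * iqf q a) = 0"
        using assms by (simp flip: iqf_add_one iqf_diff_one)
      then show ?thesis using 3 True by (auto simp: up_down_def)
    next
      case False
      then have "(1 - q powi (a + b)) * qfac q (a + b - 1) = qfac q (a + b)"
        using qfac_add_one[of "a + b - 1"] assms by simp
      then show ?thesis using 3 assms iqf_add_one[of b] iqf_diff_one[of a]
        by (simp add: up_down_def of_bool_def)
    qed
  qed (use assms AB iqf_add_one[of b] iqf_diff_one[of a] in
        \<open>auto simp: up_down_def of_bool_def qfac_add_one\<close>)
qed

lemma local_down_up:
  assumes "A i = q powi a" "B i = q powi (b + 1)" "B (Suc i) = q powi (b' + 1)"
  shows "(iqf q (b + of_bool s) * iqf q (a - of_bool s)) * (if \<not> s \<and> s' then 1 - q powi (a + b' + 1) else 1) *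
      (if s then x else 1)
    = (iqf q (b + 1) * iqf q a) * down_up A B x i s s'"
proof -
  have AB: "A i * B (Suc i) = q powi (a + b' + 1)"
    using assms q_nonzero by (simp add: power_int_add)
  show ?thesis
    using AB assms iqf_add_one[of b] iqf_diff_one[of a] by (auto simp: down_up_def of_bool_def)
qed

lemma local_toda:
  assumes "A i = q powi (a + 1)" "B i = q powi b" "B (Suc i) = q powi b'"
  shows "(if s \<and> \<not> s' then 1 - q powi (a + b' + 1) else 1) *
      (iqf q (b - of_bool s) * iqf q (a + of_bool s)) * (if s then -1 else 1)
    = (iqf q b * iqf q (a + 1)) * toda_local A B i s s'"
proof -
  have AB: "A i * B (Suc i) = q powi (a + b' + 1)"
    using assms q_nonzero by (simp add: power_int_add)
  have "iqf q a = (1 - A i) * iqf q (a + 1)" "iqf q (b - 1) = (1 - B i) * iqf q b"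
    using assms iqf_add_one[of a] iqf_diff_one[of b] by simp_all
  then show ?thesis unfolding AB[symmetric]
    by (cases s; cases s'; simp add: toda_local_def of_bool_def; simp add: algebra_simps)
qed

text \<open>
  Unlike \<open>local_toda\<close>, this version carries the \<open>q\<close>-factorials of \<open>norm_wt\<close> and the vertical strip weight in
  place of the factor of the Hamiltonian. It fails when the next row cannot take a box (\<open>b' \<le> 0\<close>), a case in
  which both global products vanish for another reason.
\<close>

lemma local_toda_normalized:
  assumes "0 \<le> a + b'" "A i = q powi (a + 1)" "B i = q powi b" "B (Suc i) = q powi b'" "s' \<Longrightarrow> 1 \<le> b'"
  shows "(if \<not> s \<and> s' then 1 - q powi (a + b') else 1) * qfac q (a + b' + of_bool s - of_bool s') *
      (iqf q (b - of_bool s) * iqf q (a + of_bool s)) * (if s then -1 else 1)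
    = qfac q (a + b') * (iqf q b * iqf q (a + 1)) * toda_local A B i s s'"
proof -
  have AB: "A i * B (Suc i) = q powi (a + b' + 1)"
    using assms q_nonzero by (simp add: power_int_add)
  consider "s = s'" | "s \<and> \<not> s'" | "\<not> s \<and> s'" by blast
  then show ?thesis
  proof cases
    case 3
    show ?thesis
    proof (cases "a + b' = 0")
      case True
      then have "iqf q a = 0" using assms(5) 3 by (simp add: iqf_neg)
      then show ?thesis using 3 True assms iqf_add_one[of a] by (auto simp: toda_local_def)
    next
      case False
      then have "(1 - q powi (a + b')) * qfac q (a + b' - 1) = qfac q (a + b')"
        using qfac_add_one[of "a + b' - 1"] assms by simp
      then show ?thesis using 3 assms iqf_add_one[of a]
        by (simp add: toda_local_def of_bool_def)
    qed
  next
    case 1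
    have "iqf q a = (1 - A i) * iqf q (a + 1)" "iqf q (b - 1) = (1 - B i) * iqf q b"
      using assms iqf_add_one[of a] iqf_diff_one[of b] by simp_all
    then show ?thesis using 1
      by (cases s'; simp add: toda_local_def of_bool_def; simp add: algebra_simps)
  next
    case 2
    have "iqf q (b - 1) = (1 - B i) * iqf q b"
      "qfac q (a + b' + 1) = qfac q (a + b') * (1 - A i * B (Suc i))"
      using assms AB iqf_diff_one[of b] by (simp_all only: qfac_add_one)
    then show ?thesis using 2
      by (simp add: toda_local_def of_bool_def; simp add: algebra_simps)
  qed
qed

end

section \<open>Partitions and strip weights\<close>

text \<open>
  Partitions with integer entries, because \<open>lam - e_I\<close> and differences of parts leave the natural numbers. Being
  eventually 0 and weakly decreasing, they are automatically nonnegative.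
\<close>

definition parts :: "(nat \<Rightarrow> int) set" where
  "parts = {lam. antimono lam \<and> finite {i. lam i \<noteq> 0}}"

definition weight :: "(nat \<Rightarrow> int) \<Rightarrow> int" where
  "weight lam = (\<Sum>i | lam i \<noteq> 0. lam i)"

definition parts_of :: "int \<Rightarrow> (nat \<Rightarrow> int) set" where
  "parts_of n = {lam \<in> parts. weight lam = n}"

definition vanishes_from :: "nat \<Rightarrow> (nat \<Rightarrow> int) \<Rightarrow> bool" where
  "vanishes_from n lam \<longleftrightarrow> (\<forall>i\<ge>n. lam i = 0)"

lemma vanishes_from_mono: "vanishes_from m lam \<Longrightarrow> m \<le> n \<Longrightarrow> vanishes_from n lam"
  by (auto simp: vanishes_from_def)

lemma finite_support_vanishes:
  assumes "finite {i. lam i \<noteq> (0::int)}" obtains n where "vanishes_from n lam"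
proof -
  obtain n where "\<forall>i\<in>{i. lam i \<noteq> 0}. i < n"
    using assms finite_nat_set_iff_bounded by blast
  then have "vanishes_from n lam" by (force simp: vanishes_from_def not_le)
  then show ?thesis by (rule that)
qed

lemma partsE:
  assumes "lam \<in> parts" obtains n where "vanishes_from n lam"
  using assms finite_support_vanishes by (auto simp: parts_def)

lemma common_cutoff:
  assumes "lam \<in> parts" "mu \<in> parts"
  obtains n where "vanishes_from n lam" "vanishes_from n mu"
proof -
  from partsE assms obtain m n where "vanishes_from m lam" "vanishes_from n mu" by meson
  then show ?thesis
    using that vanishes_from_mono[OF _ max.cobounded1] vanishes_from_mono[OF _ max.cobounded2] by blast
qed

lemma vanishes_finite_support: "vanishes_from n lam \<Longrightarrow> finite {i. lam i \<noteq> 0}"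
  by (rule finite_subset[of _ "{..<n}"]) (auto simp: vanishes_from_def not_le[symmetric])

lemma partsI: "antimono lam \<Longrightarrow> vanishes_from n lam \<Longrightarrow> lam \<in> parts"
  by (simp add: parts_def vanishes_finite_support)

lemma antimono_parts: "lam \<in> parts \<Longrightarrow> i \<le> j \<Longrightarrow> lam j \<le> lam i"
  by (auto simp: parts_def dest: antimonoD)

lemma parts_nonneg:
  assumes "lam \<in> parts" shows "0 \<le> lam i"
proof -
  obtain n where "vanishes_from n lam" using assms partsE by blast
  then have "lam (max i n) = 0" by (simp add: vanishes_from_def)
  then show ?thesis using antimono_parts[OF assms, of i "max i n"] by simp
qed

lemma weight_eq: "vanishes_from n lam \<Longrightarrow> weight lam = (\<Sum>i<n. lam i)"
  unfolding weight_def
  by (rule sum.mono_neutral_left) (auto simp: vanishes_from_def not_le[symmetric])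

lemma weight_mono:
  assumes "lam \<in> parts" "mu \<in> parts" and le: "\<And>i. lam i \<le> mu i"
  shows "weight lam \<le> weight mu" and "weight lam = weight mu \<Longrightarrow> lam = mu"
proof -
  obtain n where n: "vanishes_from n lam" "vanishes_from n mu"
    using common_cutoff assms by blast
  show "weight lam \<le> weight mu"
    by (simp add: weight_eq[OF n(1)] weight_eq[OF n(2)] sum_mono le)
  assume "weight lam = weight mu"
  then have "(\<Sum>i<n. mu i - lam i) = 0"
    by (simp add: weight_eq[OF n(1)] weight_eq[OF n(2)] sum_subtractf)
  then have "\<forall>i\<in>{..<n}. mu i - lam i = 0"
    by (subst sum_nonneg_eq_0_iff[symmetric]) (auto simp: le)
  then have "lam i = mu i" for i
    using n by (cases "i < n") (auto simp: vanishes_from_def)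
  then show "lam = mu" by blast
qed

lemma parts_ofD: "lam \<in> parts_of n \<Longrightarrow> lam \<in> parts" "lam \<in> parts_of n \<Longrightarrow> weight lam = n"
  by (auto simp: parts_of_def)

lemma parts_of_weight: "lam \<in> parts \<Longrightarrow> lam \<in> parts_of (weight lam)"
  by (simp add: parts_of_def)

lemma weight_nonneg: "lam \<in> parts \<Longrightarrow> 0 \<le> weight lam"
  by (simp add: weight_def parts_nonneg sum_nonneg)

lemma parts_of_neg: "n < 0 \<Longrightarrow> parts_of n = {}"
  using weight_nonneg by (force simp: parts_of_def)

lemma part_le_weight:
  assumes "lam \<in> parts" shows "lam i \<le> weight lam"
proof (cases "lam i = 0")
  case False
  then show ?thesis
    unfolding weight_def using assms
    by (intro member_le_sum) (auto simp: parts_nonneg parts_def)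
qed (use assms weight_nonneg in simp)

lemma parts_vanish_weight:
  assumes "lam \<in> parts" shows "vanishes_from (nat (weight lam)) lam"
  unfolding vanishes_from_def
proof (intro allI impI, rule ccontr)
  fix i assume i: "nat (weight lam) \<le> i" "lam i \<noteq> 0"
  obtain n where n: "vanishes_from n lam" using assms partsE by blast
  have "int (Suc i) \<le> (\<Sum>j<Suc i. lam j)"
  proof -
    have "(\<Sum>j<Suc i. 1) \<le> (\<Sum>j<Suc i. lam j)"
    proof (rule sum_mono)
      fix j assume "j \<in> {..<Suc i}"
      then have "lam i \<le> lam j" using antimono_parts[OF assms] by simp
      then show "1 \<le> lam j" using parts_nonneg[OF assms, of i] i(2) by linarith
    qed
    then show ?thesis by simp
  qed
  also have "\<dots> \<le> (\<Sum>j<max (Suc i) n. lam j)"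
    by (rule sum_mono2) (auto simp: parts_nonneg[OF assms])
  also have "\<dots> = weight lam"
    by (rule weight_eq[symmetric], rule vanishes_from_mono[OF n]) simp
  finally show False using i(1) by linarith
qed

lemma finite_parts_of: "finite (parts_of n)"
proof -
  have "parts_of n \<subseteq> {f. \<forall>i. (i \<in> {..<nat n} \<longrightarrow> f i \<in> {0..n}) \<and> (i \<notin> {..<nat n} \<longrightarrow> f i = 0)}"
  proof
    fix lam assume lam: "lam \<in> parts_of n"
    then have p: "lam \<in> parts" "weight lam = n" by (auto simp: parts_of_def)
    have "lam i = 0" if "nat n \<le> i" for i
      using parts_vanish_weight[OF p(1)] that p(2) by (simp add: vanishes_from_def)
    then show "lam \<in> {f. \<forall>i. (i \<in> {..<nat n} \<longrightarrow> f i \<in> {0..n}) \<and> (i \<notin> {..<nat n} \<longrightarrow> f i = 0)}"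
      using parts_nonneg[OF p(1)] part_le_weight[OF p(1)] p(2) by simp
  qed
  then show ?thesis
    by (rule finite_subset) (intro finite_set_of_finite_funs finite_lessThan finite_atLeastAtMost_int)
qed

lemma zero_in_parts: "(\<lambda>_. 0) \<in> parts"
  by (simp add: parts_def antimono_def)

lemma weight_eq_0_iff: "lam \<in> parts \<Longrightarrow> weight lam = 0 \<longleftrightarrow> lam = (\<lambda>_. 0)"
  by (auto simp: fun_eq_iff weight_def intro!: order_antisym parts_nonneg) (metis part_le_weight weight_def)

lemma parts_of_0: "parts_of 0 = {\<lambda>_. 0}"
  using weight_eq_0_iff zero_in_parts by (auto simp: parts_of_def weight_def)

text \<open>
  \<open>strip_wt\<close> is nonzero exactly if \<open>mu / lam\<close> is a horizontal strip. With \<open>norm_wt\<close>, the squared norm of \<open>W_lam\<close>,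
  it yields the Pieri coefficients \<open>norm_wt lam * strip_wt lam mu\<close> and the branching coefficients
  \<open>norm_wt mu * strip_wt lam mu\<close>, which are products of \<open>q\<close>-binomial coefficients. The index sets are
  chosen such that all omitted factors are 1 for arbitrary finitely supported sequences, not only for partitions.
\<close>

definition strip_wt :: "complex \<Rightarrow> (nat \<Rightarrow> int) \<Rightarrow> (nat \<Rightarrow> int) \<Rightarrow> complex" where
  "strip_wt q lam mu = (\<Prod>i | lam i \<noteq> 0 \<or> mu i \<noteq> 0 \<or> mu (Suc i) \<noteq> 0.
     iqf q (mu i - lam i) * iqf q (lam i - mu (Suc i)))"

definition norm_wt :: "complex \<Rightarrow> (nat \<Rightarrow> int) \<Rightarrow> complex" where
  "norm_wt q lam = (\<Prod>i | lam i \<noteq> 0 \<or> lam (Suc i) \<noteq> 0. qfac q (lam i - lam (Suc i)))"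

text \<open>
  The coefficient of \<open>W_mu\<close> in \<open>e_r W_lam\<close>. It vanishes by itself if adding the boxes to \<open>lam\<close> does not give a
  partition, since then \<open>lam i = lam (Suc i)\<close> for a row that contributes a factor.
\<close>

definition vstrip_wt :: "complex \<Rightarrow> (nat \<Rightarrow> int) \<Rightarrow> (nat \<Rightarrow> int) \<Rightarrow> complex" where
  "vstrip_wt q lam mu = (if \<forall>i. mu i - lam i \<in> {0, 1}
     then \<Prod>i | mu i = lam i \<and> mu (Suc i) \<noteq> lam (Suc i). 1 - q powi (lam i - lam (Suc i)) else 0)"

definition sub_ind :: "(nat \<Rightarrow> int) \<Rightarrow> nat set \<Rightarrow> nat \<Rightarrow> int" where
  "sub_ind lam I = (\<lambda>i. lam i - (if i \<in> I then 1 else 0))"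

lemma vanishes_add_ind: "vanishes_from n lam \<Longrightarrow> I \<subseteq> {..<n} \<Longrightarrow> vanishes_from n (add_ind lam I)"
  by (auto simp: vanishes_from_def add_ind_def not_le[symmetric])

lemma vanishes_sub_ind: "vanishes_from n lam \<Longrightarrow> I \<subseteq> {..<n} \<Longrightarrow> vanishes_from n (sub_ind lam I)"
  by (auto simp: vanishes_from_def sub_ind_def not_le[symmetric])

lemma weight_add_ind:
  assumes "vanishes_from n lam" "I \<subseteq> {..<n}" shows "weight (add_ind lam I) = weight lam + int (card I)"
proof -
  have "{..<n} \<inter> I = I" using assms(2) by auto
  then have "(\<Sum>i<n. if i \<in> I then 1 else (0::int)) = int (card I)"
    by (simp add: sum.If_cases)
  then show ?thesis
    using assms weight_eq[of n lam] weight_eq[OF vanishes_add_ind[OF assms]]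
    by (simp add: add_ind_def sum.distrib)
qed

lemma add_sub_ind [simp]: "add_ind (sub_ind lam I) I = lam"
  by (simp add: add_ind_def sub_ind_def)

lemma weight_sub_ind:
  assumes "vanishes_from n lam" "I \<subseteq> {..<n}" shows "weight (sub_ind lam I) = weight lam - int (card I)"
  using weight_add_ind[OF vanishes_sub_ind[OF assms] assms(2)] by simp

lemma norm_wt_eq: "vanishes_from n lam \<Longrightarrow> norm_wt q lam = (\<Prod>i<n. qfac q (lam i - lam (Suc i)))"
  unfolding norm_wt_def
  by (rule prod.mono_neutral_left) (auto simp: vanishes_from_def not_le[symmetric] qfac_def)

lemma prod_if_power_card:
  "I \<subseteq> {..<n::nat} \<Longrightarrow> (\<Prod>i<n. if i \<in> I then x else 1) = (x::'a::comm_monoid_mult) ^ card I"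
  using prod.inter_restrict[where A = "{..<n}" and B = I and g = "\<lambda>_. x"] by (simp add: Int_absorb1)

context nome
begin

lemma strip_wt_eq:
  "vanishes_from n lam \<Longrightarrow> vanishes_from n mu \<Longrightarrow>
    strip_wt q lam mu = (\<Prod>i<n. iqf q (mu i - lam i) * iqf q (lam i - mu (Suc i)))"
  unfolding strip_wt_def
  by (rule prod.mono_neutral_left) (auto simp: vanishes_from_def not_le[symmetric])

lemma norm_wt_nonzero: "norm_wt q lam \<noteq> 0"
  unfolding norm_wt_def
  by (cases "finite {i. lam i \<noteq> 0 \<or> lam (Suc i) \<noteq> 0}") (simp_all add: qfac_nonzero)

lemma vstrip_wt_add_ind:
  assumes "I \<subseteq> {..<n}"
  shows "vstrip_wt q lam (add_ind lam I) =
    (\<Prod>i<n. if i \<notin> I \<and> Suc i \<in> I then 1 - q powi (lam i - lam (Suc i)) else 1)"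
proof -
  have "{i. add_ind lam I i = lam i \<and> add_ind lam I (Suc i) \<noteq> lam (Suc i)} = {i\<in>{..<n}. i \<notin> I \<and> Suc i \<in> I}"
    using assms by (force simp: add_ind_def)
  then show ?thesis
    by (simp add: vstrip_wt_def prod.inter_filter[symmetric]) (auto simp: add_ind_def)
qed

lemma vstrip_wt_not_parts:
  assumes "lam \<in> parts" "I \<subseteq> {..<n}" "add_ind lam I \<notin> parts"
  shows "vstrip_wt q lam (add_ind lam I) = 0"
proof -
  obtain m where "vanishes_from m lam" using assms(1) partsE by blast
  then have "vanishes_from (max m n) (add_ind lam I)"
    using assms(2) by (intro vanishes_add_ind) (auto elim: vanishes_from_mono)
  then have "\<not> antimono (add_ind lam I)" using assms(3) partsI by blast
  then obtain i where i: "add_ind lam I i < add_ind lam I (Suc i)"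
    by (auto simp: antimono_iff_le_Suc not_le)
  moreover have "lam (Suc i) \<le> lam i" using antimono_parts[OF assms(1)] by simp
  ultimately have "i \<notin> I" "Suc i \<in> I" "lam i = lam (Suc i)"
    by (auto simp: add_ind_def split: if_splits)
  then show ?thesis
    using assms(2) by (subst vstrip_wt_add_ind[of _ n]) (force intro!: prod_zero bexI[of _ i])+
qed

lemma vstrip_wt_nonzeroD: "vstrip_wt q lam mu \<noteq> 0 \<Longrightarrow> mu i = lam i \<or> mu i = lam i + 1"
  by (auto simp: vstrip_wt_def split: if_splits)

lemma strip_wt_nonzeroD:
  assumes "strip_wt q lam mu \<noteq> 0" "finite {i. lam i \<noteq> 0}" "finite {i. mu i \<noteq> 0}"
  shows "lam i \<le> mu i" "mu (Suc i) \<le> lam i"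
proof -
  obtain m where "vanishes_from m lam" using assms(2) by (rule finite_support_vanishes)
  moreover obtain k where "vanishes_from k mu" using assms(3) by (rule finite_support_vanishes)
  ultimately have "vanishes_from (m + k + Suc i) lam" "vanishes_from (m + k + Suc i) mu"
    by (auto elim: vanishes_from_mono)
  then have "(\<Prod>i<m + k + Suc i. iqf q (mu i - lam i) * iqf q (lam i - mu (Suc i))) \<noteq> 0"
    using assms(1) strip_wt_eq by metis
  then have "\<forall>j\<in>{..<m + k + Suc i}. iqf q (mu j - lam j) * iqf q (lam j - mu (Suc j)) \<noteq> 0"
    unfolding prod_zero_iff[OF finite_lessThan] by blast
  then have "iqf q (mu i - lam i) * iqf q (lam i - mu (Suc i)) \<noteq> 0"
    by simp
  then show "lam i \<le> mu i" "mu (Suc i) \<le> lam i"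
    by (auto simp: iqf_eq_0_iff)
qed

text \<open>
  Passage from sums over partitions to sums over all subsets of rows, which transfer matrices can evaluate: the
  subsets that do not lead to partitions have weight 0.
\<close>

lemma sum_vstrip_up:
  assumes lam: "lam \<in> parts" "vanishes_from n lam"
    and h: "\<And>mu. mu \<in> parts \<Longrightarrow> h mu \<noteq> 0 \<Longrightarrow> vanishes_from n mu"
  shows "(\<Sum>mu\<in>parts_of (weight lam + int r). vstrip_wt q lam mu * h mu) =
    (\<Sum>I | I \<in> Pow {..<n} \<and> card I = r. vstrip_wt q lam (add_ind lam I) * h (add_ind lam I))"
proof -
  let ?S = "{I \<in> Pow {..<n}. card I = r \<and> add_ind lam I \<in> parts}"
  have inj: "inj_on (add_ind lam) ?S"
  proof (rule inj_onI)
    fix I J assume "add_ind lam I = add_ind lam J"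
    then have "(if i \<in> I then 1 else 0::int) = (if i \<in> J then 1 else 0)" for i
      by (auto simp: add_ind_def fun_eq_iff dest: spec[of _ i])
    then show "I = J" by (auto split: if_splits) (metis zero_neq_one)+
  qed
  have sub: "add_ind lam ` ?S \<subseteq> parts_of (weight lam + int r)"
    using lam by (auto simp: parts_of_def weight_add_ind)
  have "(\<Sum>mu\<in>parts_of (weight lam + int r). vstrip_wt q lam mu * h mu) =
      (\<Sum>mu\<in>add_ind lam ` ?S. vstrip_wt q lam mu * h mu)"
  proof (rule sum.mono_neutral_right[OF finite_parts_of sub], intro ballI, rule ccontr)
    fix mu assume mu: "mu \<in> parts_of (weight lam + int r) - add_ind lam ` ?S"
      and nz: "vstrip_wt q lam mu * h mu \<noteq> 0"
    have van: "vanishes_from n mu" using h mu nz by (auto simp: parts_of_def)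
    define I where "I = {i. mu i \<noteq> lam i}"
    have I: "I \<subseteq> {..<n}"
      using van lam(2) by (auto simp: I_def vanishes_from_def not_le[symmetric])
    have eq: "add_ind lam I = mu"
    proof
      fix i show "add_ind lam I i = mu i"
        using vstrip_wt_nonzeroD[of lam mu i] nz by (auto simp: add_ind_def I_def)
    qed
    then have "card I = r" using weight_add_ind[OF lam(2) I] mu by (auto simp: parts_of_def)
    then show False using mu I eq by (auto simp: parts_of_def)
  qed
  also have "\<dots> = (\<Sum>I\<in>?S. vstrip_wt q lam (add_ind lam I) * h (add_ind lam I))"
    unfolding sum.reindex[OF inj] o_def ..
  also have "\<dots> = (\<Sum>I | I \<in> Pow {..<n} \<and> card I = r. vstrip_wt q lam (add_ind lam I) * h (add_ind lam I))"
  proof (rule sum.mono_neutral_left)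
    show "\<forall>I\<in>{I. I \<in> Pow {..<n} \<and> card I = r} - ?S.
        vstrip_wt q lam (add_ind lam I) * h (add_ind lam I) = 0"
    proof
      fix I assume "I \<in> {I. I \<in> Pow {..<n} \<and> card I = r} - ?S"
      then have "I \<subseteq> {..<n}" "add_ind lam I \<notin> parts" by auto
      then show "vstrip_wt q lam (add_ind lam I) * h (add_ind lam I) = 0"
        by (simp add: vstrip_wt_not_parts[OF lam(1)])
    qed
  qed auto
  finally show ?thesis .
qed

lemma sum_vstrip_down:
  assumes nu: "nu \<in> parts" "vanishes_from n nu"
    and h: "\<And>I. I \<subseteq> {..<n} \<Longrightarrow> sub_ind nu I \<notin> parts \<Longrightarrow> h (sub_ind nu I) = 0"
  shows "(\<Sum>kap\<in>parts_of (weight nu - int r). h kap * vstrip_wt q kap nu) =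
    (\<Sum>I | I \<in> Pow {..<n} \<and> card I = r. h (sub_ind nu I) * vstrip_wt q (sub_ind nu I) nu)"
proof -
  let ?S = "{I \<in> Pow {..<n}. card I = r \<and> sub_ind nu I \<in> parts}"
  have inj: "inj_on (sub_ind nu) ?S"
  proof (rule inj_onI)
    fix I J assume "sub_ind nu I = sub_ind nu J"
    then have "(if i \<in> I then 1 else 0::int) = (if i \<in> J then 1 else 0)" for i
      by (auto simp: sub_ind_def fun_eq_iff dest: spec[of _ i])
    then show "I = J" by (auto split: if_splits) (metis zero_neq_one)+
  qed
  have sub: "sub_ind nu ` ?S \<subseteq> parts_of (weight nu - int r)"
    using nu by (auto simp: parts_of_def weight_sub_ind)
  have "(\<Sum>kap\<in>parts_of (weight nu - int r). h kap * vstrip_wt q kap nu) =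
      (\<Sum>kap\<in>sub_ind nu ` ?S. h kap * vstrip_wt q kap nu)"
  proof (rule sum.mono_neutral_right[OF finite_parts_of sub], intro ballI, rule ccontr)
    fix kap assume kap: "kap \<in> parts_of (weight nu - int r) - sub_ind nu ` ?S"
      and nz: "h kap * vstrip_wt q kap nu \<noteq> 0"
    then have kp: "kap \<in> parts" by (auto simp: parts_of_def)
    have cases: "nu i = kap i \<or> nu i = kap i + 1" for i
      using vstrip_wt_nonzeroD[of kap nu i] nz by auto
    define I where "I = {i. nu i \<noteq> kap i}"
    have I: "I \<subseteq> {..<n}"
    proof
      fix i assume "i \<in> I"
      then have "nu i = kap i + 1" using cases[of i] by (auto simp: I_def)
      then have "nu i \<noteq> 0" using parts_nonneg[OF kp, of i] by simp
      then show "i \<in> {..<n}" using nu(2) by (auto simp: vanishes_from_def not_le[symmetric])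
    qed
    have eq: "sub_ind nu I = kap"
    proof
      fix i show "sub_ind nu I i = kap i"
        using cases[of i] by (auto simp: sub_ind_def I_def)
    qed
    then have "card I = r" using weight_sub_ind[OF nu(2) I] kap by (auto simp: parts_of_def)
    then show False using kap I eq by (auto simp: parts_of_def)
  qed
  also have "\<dots> = (\<Sum>I\<in>?S. h (sub_ind nu I) * vstrip_wt q (sub_ind nu I) nu)"
    unfolding sum.reindex[OF inj] o_def ..
  also have "\<dots> = (\<Sum>I | I \<in> Pow {..<n} \<and> card I = r. h (sub_ind nu I) * vstrip_wt q (sub_ind nu I) nu)"
    by (rule sum.mono_neutral_left) (auto simp: h)
  finally show ?thesis .
qed

lemma power_int_sum: "finite S \<Longrightarrow> q powi (\<Sum>i\<in>S. f i) = (\<Prod>i\<in>S. q powi f i)"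
  by (induction S rule: finite_induct) (auto simp: power_int_add q_nonzero)

end

lemma coeff_comparison:
  fixes s t :: "'b \<Rightarrow> complex"
  assumes "finite S" and "\<And>x. (\<Sum>I\<in>S. x ^ d I * s I) = (1 + x) * (\<Sum>I\<in>S. x ^ d I * t I)"
  shows "(\<Sum>I | I \<in> S \<and> d I = r. s I) = (\<Sum>I | I \<in> S \<and> d I = r. t I) +
    (if r = 0 then 0 else (\<Sum>I | I \<in> S \<and> d I = r - 1. t I))"
proof -
  define P where "P f = (\<Sum>I\<in>S. monom (f I) (d I))" for f :: "'b \<Rightarrow> complex"
  have "poly (P s) = poly ([:1, 1:] * P t)"
    using assms(2) by (auto simp: P_def fun_eq_iff poly_sum poly_monom mult.commute distrib_right)
  then have "P s = [:1, 1:] * P t" by (simp only: poly_eq_poly_eq_iff)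
  then have "coeff (P s) r = coeff (P t) r + (if r = 0 then 0 else coeff (P t) (r - 1))"
    by (cases r) (simp_all add: mult_pCons_left coeff_pCons)
  moreover have "coeff (P f) r = (\<Sum>I | I \<in> S \<and> d I = r. f I)" for f r
    using assms(1) by (auto simp: P_def coeff_sum coeff_monom sum.inter_filter intro!: sum.cong)
  ultimately show ?thesis by simp
qed

context nome
begin

section \<open>Exchange of vertical and horizontal strips\<close>

text \<open>
  With \<open>x\<close> marking the boxes of the vertical strip, both orders are sums over subsets of rows with the common
  factor \<open>C\<close>, and \<open>sum_up_down\<close> compares them; the two terms on the right come from \<open>1 + x\<close>. This is the
  shadow of the rule \<open>peel\<close> obeys on a product with \<open>e_r\<close>, where a variable can occur at most once.
\<close>

lemma vstrip_strip_exchange: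
  assumes lam: "lam \<in> parts" and nu: "nu \<in> parts"
  shows "(\<Sum>mu\<in>parts_of (weight lam + int r). vstrip_wt q lam mu * (norm_wt q mu * strip_wt q nu mu)) =
    (\<Sum>kap\<in>parts_of (weight nu - int r). norm_wt q lam * strip_wt q kap lam * vstrip_wt q kap nu) +
    (if r = 0 then 0
     else \<Sum>kap\<in>parts_of (weight nu - int (r - 1)). norm_wt q lam * strip_wt q kap lam * vstrip_wt q kap nu)"
proof -
  obtain m where m: "vanishes_from m lam" "vanishes_from m nu"
    using common_cutoff assms by blast
  \<comment> \<open>One empty row is kept at the bottom; \<open>sum_up_down\<close> needs it, and boxes may be added there.\<close>
  define n where "n = Suc m"
  have n: "vanishes_from n lam" "vanishes_from n nu"
    using m by (auto simp: n_def elim: vanishes_from_mono)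
  define a where "a i = nu i - lam (Suc i)" for i
  define b where "b i = lam i - nu i" for i
  define A where "A i = q powi a i" for i
  define B where "B i = q powi (b i + 1)" for i
  define C where "C = (\<Prod>i<n. qfac q (a i + b i) * (iqf q (b i + 1) * iqf q (a i)))"
  have C: "norm_wt q lam * (\<Prod>i<n. iqf q (b i + 1) * iqf q (a i)) = C"
    unfolding C_def norm_wt_eq[OF n(1)] by (simp add: a_def b_def prod.distrib)
  have up: "x ^ card I * (vstrip_wt q lam (add_ind lam I) * (norm_wt q (add_ind lam I) * strip_wt q nu (add_ind lam I)))
      = C * (\<Prod>i<n. up_down A B x i (i \<in> I) (Suc i \<in> I))" if I: "I \<in> Pow {..<n}" for I x
  proof -
    have I': "I \<subseteq> {..<n}" using I by simp
    have "(\<Prod>i<n. (if \<not> i \<in> I \<and> Suc i \<in> I then 1 - q powi (a i + b i) else 1) *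
        qfac q (a i + b i + of_bool (i \<in> I) - of_bool (Suc i \<in> I)) *
        (iqf q (b i + of_bool (i \<in> I)) * iqf q (a i - of_bool (Suc i \<in> I))) * (if i \<in> I then x else 1)) =
        (\<Prod>i<n. qfac q (a i + b i) * (iqf q (b i + 1) * iqf q (a i)) * up_down A B x i (i \<in> I) (Suc i \<in> I))"
      by (intro prod.cong refl local_up_down)
         (auto simp: A_def B_def a_def b_def intro: antimono_parts[OF lam])
    also have "\<dots> = C * (\<Prod>i<n. up_down A B x i (i \<in> I) (Suc i \<in> I))"
      by (simp add: C_def prod.distrib)
    finally show ?thesis
      unfolding prod.distrib prod_if_power_card[OF I'] vstrip_wt_add_ind[OF I']
        norm_wt_eq[OF vanishes_add_ind[OF n(1) I']] strip_wt_eq[OF n(2) vanishes_add_ind[OF n(1) I']]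
      by (simp add: a_def b_def add_ind_def of_bool_def algebra_simps cong: if_cong)
  qed
  have down: "x ^ card I * (norm_wt q lam * strip_wt q (sub_ind nu I) lam * vstrip_wt q (sub_ind nu I) nu)
      = C * (\<Prod>i<n. down_up A B x i (i \<in> I) (Suc i \<in> I))" if I: "I \<in> Pow {..<n}" for I x
  proof -
    have I': "I \<subseteq> {..<n}" using I by simp
    have v: "vstrip_wt q (sub_ind nu I) nu =
      (\<Prod>i<n. if i \<notin> I \<and> Suc i \<in> I then 1 - q powi (sub_ind nu I i - sub_ind nu I (Suc i)) else 1)"
      using vstrip_wt_add_ind[OF I', of "sub_ind nu I"] by simp
    have "(\<Prod>i<n. (iqf q (b i + of_bool (i \<in> I)) * iqf q (a i - of_bool (i \<in> I))) *
         (if \<not> i \<in> I \<and> Suc i \<in> I then 1 - q powi (a i + b (Suc i) + 1) else 1) * (if i \<in> I then x else 1)) =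
        (\<Prod>i<n. (iqf q (b i + 1) * iqf q (a i)) * down_up A B x i (i \<in> I) (Suc i \<in> I))"
      by (intro prod.cong refl local_down_up) (auto simp: A_def B_def)
    also have "\<dots> = (\<Prod>i<n. iqf q (b i + 1) * iqf q (a i)) * (\<Prod>i<n. down_up A B x i (i \<in> I) (Suc i \<in> I))"
      by (simp add: prod.distrib)
    finally have 1: "(\<Prod>i<n. iqf q (b i + of_bool (i \<in> I)) * iqf q (a i - of_bool (i \<in> I))) *
         (\<Prod>i<n. if \<not> i \<in> I \<and> Suc i \<in> I then 1 - q powi (a i + b (Suc i) + 1) else 1) * x ^ card I =
        (\<Prod>i<n. iqf q (b i + 1) * iqf q (a i)) * (\<Prod>i<n. down_up A B x i (i \<in> I) (Suc i \<in> I))"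
      by (simp only: prod.distrib prod_if_power_card[OF I'])
    have s: "strip_wt q (sub_ind nu I) lam = (\<Prod>i<n. iqf q (b i + of_bool (i \<in> I)) * iqf q (a i - of_bool (i \<in> I)))"
      unfolding strip_wt_eq[OF vanishes_sub_ind[OF n(2) I'] n(1)]
      by (simp add: a_def b_def sub_ind_def of_bool_def algebra_simps cong: if_cong)
    have v': "vstrip_wt q (sub_ind nu I) nu =
        (\<Prod>i<n. if \<not> i \<in> I \<and> Suc i \<in> I then 1 - q powi (a i + b (Suc i) + 1) else 1)"
      unfolding v by (intro prod.cong refl) (auto simp: a_def b_def sub_ind_def algebra_simps)
    show ?thesis
      unfolding s v' C[symmetric] using arg_cong[OF 1, of "\<lambda>t. norm_wt q lam * t"]
      by (simp only: ac_simps)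
  qed
  have abs: "(\<Sum>I\<in>Pow {..<n}. \<Prod>i<n. up_down A B x i (i \<in> I) (Suc i \<in> I)) =
      (1 + x) * (\<Sum>I\<in>Pow {..<n}. \<Prod>i<n. down_up A B x i (i \<in> I) (Suc i \<in> I))" for x
    unfolding n_def
  proof (rule sum_up_down)
    show "A m = 1" using m by (simp add: A_def a_def vanishes_from_def)
    have "lam (Suc m) = 0" "nu (Suc m) = 0" using m by (simp_all add: vanishes_from_def)
    then show "B (Suc m) \<noteq> 1" using norm_q by (auto simp: B_def b_def)
  qed
  have "(\<Sum>I | I \<in> Pow {..<n} \<and> card I = r. vstrip_wt q lam (add_ind lam I) *
          (norm_wt q (add_ind lam I) * strip_wt q nu (add_ind lam I))) =
      (\<Sum>I | I \<in> Pow {..<n} \<and> card I = r.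
          norm_wt q lam * strip_wt q (sub_ind nu I) lam * vstrip_wt q (sub_ind nu I) nu) +
      (if r = 0 then 0 else (\<Sum>I | I \<in> Pow {..<n} \<and> card I = r - 1.
          norm_wt q lam * strip_wt q (sub_ind nu I) lam * vstrip_wt q (sub_ind nu I) nu))"
  proof (rule coeff_comparison)
    fix x
    show "(\<Sum>I\<in>Pow {..<n}. x ^ card I * (vstrip_wt q lam (add_ind lam I) *
          (norm_wt q (add_ind lam I) * strip_wt q nu (add_ind lam I)))) =
        (1 + x) * (\<Sum>I\<in>Pow {..<n}. x ^ card I *
          (norm_wt q lam * strip_wt q (sub_ind nu I) lam * vstrip_wt q (sub_ind nu I) nu))"
      by (simp only: sum.cong[OF refl up] sum.cong[OF refl down] abs flip: sum_distrib_left)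
         (simp only: ac_simps)
  qed simp
  moreover have "(\<Sum>mu\<in>parts_of (weight lam + int r). vstrip_wt q lam mu * (norm_wt q mu * strip_wt q nu mu)) =
      (\<Sum>I | I \<in> Pow {..<n} \<and> card I = r. vstrip_wt q lam (add_ind lam I) *
          (norm_wt q (add_ind lam I) * strip_wt q nu (add_ind lam I)))"
  proof (rule sum_vstrip_up[OF lam n(1)])
    fix mu assume mu: "mu \<in> parts" "norm_wt q mu * strip_wt q nu mu \<noteq> 0"
    then have "mu (Suc i) \<le> nu i" for i
      using strip_wt_nonzeroD(2)[of nu mu i] nu by (auto simp: parts_def)
    then have "mu (Suc i) \<le> 0" if "m \<le> i" for i
      using m that by (metis vanishes_from_def)
    then have "mu (Suc i) = 0" if "m \<le> i" for i
      using that parts_nonneg[OF mu(1), of "Suc i"] by (simp add: order_antisym)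
    then show "vanishes_from n mu"
      unfolding vanishes_from_def n_def by (metis Suc_le_D Suc_le_mono)
  qed
  moreover have "(\<Sum>kap\<in>parts_of (weight nu - int r'). norm_wt q lam * strip_wt q kap lam * vstrip_wt q kap nu) =
      (\<Sum>I | I \<in> Pow {..<n} \<and> card I = r'.
          norm_wt q lam * strip_wt q (sub_ind nu I) lam * vstrip_wt q (sub_ind nu I) nu)" for r'
  proof (rule sum_vstrip_down[OF nu n(2)], rule ccontr)
    fix I assume I: "I \<subseteq> {..<n}" "sub_ind nu I \<notin> parts"
      and nz: "norm_wt q lam * strip_wt q (sub_ind nu I) lam \<noteq> 0"
    have van: "vanishes_from n (sub_ind nu I)" by (rule vanishes_sub_ind[OF n(2) I(1)])
    have "sub_ind nu I (Suc i) \<le> sub_ind nu I i" for i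
      using strip_wt_nonzeroD[of "sub_ind nu I" lam i] strip_wt_nonzeroD[of "sub_ind nu I" lam "Suc i"] nz
        vanishes_finite_support[OF van] vanishes_finite_support[OF n(1)] by force
    then have "sub_ind nu I \<in> parts"
      using van by (intro partsI) (auto simp: antimono_iff_le_Suc)
    then show False using I(2) by simp
  qed
  ultimately show ?thesis by (simp only:)
qed

text \<open>
  The infinite-row form of the relation between the Hamiltonians and the Baxter operator, in coefficients
  of \<open>z\<^sup>n\<close>. If a subset contains a row with \<open>mu i \<le> lam i\<close>, both the strip weight and the local factors vanish;
  otherwise \<open>local_toda_normalized\<close> applies in each row.
\<close>

lemma vstrip_strip_up:
  assumes lam: "lam \<in> parts" and mu: "mu \<in> parts" and size: "weight mu = weight lam + int n"
  shows "(\<Sum>r\<le>n. (-1) ^ r * (\<Sum>kap\<in>parts_of (weight lam + int r).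
      vstrip_wt q lam kap * (norm_wt q kap * strip_wt q kap mu))) = q ^ n * (norm_wt q lam * strip_wt q lam mu)"
proof -
  obtain m where m: "vanishes_from m lam" "vanishes_from m mu"
    using common_cutoff lam mu by blast
  define a where "a i = lam i - mu (Suc i)" for i
  define b where "b i = mu i - lam i" for i
  define A where "A i = q powi (a i + 1)" for i
  define B where "B i = q powi b i" for i
  define t where "t I = vstrip_wt q lam (add_ind lam I) * (norm_wt q (add_ind lam I) * strip_wt q (add_ind lam I) mu)" for I
  define C where "C = (\<Prod>i<m. qfac q (a i + b (Suc i)) * (iqf q (b i) * iqf q (a i + 1)))"
  have t: "(-1) ^ card I * t I = C * (\<Prod>i<m. toda_local A B i (i \<in> I) (Suc i \<in> I))" if I: "I \<subseteq> {..<m}" for I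
  proof -
    have str: "strip_wt q (add_ind lam I) mu =
        (\<Prod>i<m. iqf q (b i - of_bool (i \<in> I)) * iqf q (a i + of_bool (i \<in> I)))"
      unfolding strip_wt_eq[OF vanishes_add_ind[OF m(1) I] m(2)]
      by (simp add: a_def b_def add_ind_def of_bool_def algebra_simps cong: if_cong)
    show ?thesis
    proof (cases "\<forall>i\<in>I. 1 \<le> b i")
      case True
      have "(\<Prod>i<m. (if \<not> i \<in> I \<and> Suc i \<in> I then 1 - q powi (a i + b (Suc i)) else 1) *
          qfac q (a i + b (Suc i) + of_bool (i \<in> I) - of_bool (Suc i \<in> I)) *
          (iqf q (b i - of_bool (i \<in> I)) * iqf q (a i + of_bool (i \<in> I))) * (if i \<in> I then -1 else 1)) =
        (\<Prod>i<m. qfac q (a i + b (Suc i)) * (iqf q (b i) * iqf q (a i + 1)) * toda_local A B i (i \<in> I) (Suc i \<in> I))"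
        by (intro prod.cong refl local_toda_normalized)
           (use True in \<open>auto simp: A_def B_def a_def b_def intro: antimono_parts[OF lam]\<close>)
      also have "\<dots> = C * (\<Prod>i<m. toda_local A B i (i \<in> I) (Suc i \<in> I))"
        by (simp add: C_def prod.distrib)
      finally show ?thesis
        unfolding t_def prod.distrib prod_if_power_card[OF I] vstrip_wt_add_ind[OF I]
          norm_wt_eq[OF vanishes_add_ind[OF m(1) I]] str
        by (simp add: a_def b_def add_ind_def of_bool_def prod.distrib algebra_simps cong: if_cong)
    next
      case False
      then obtain i where i: "i \<in> I" "b i < 1" by force
      then have im: "i \<in> {..<m}" using I by auto
      have zero: "iqf q (b i - of_bool (i \<in> I)) = 0" using i by (simp add: iqf_neg of_bool_def)
      then have "strip_wt q (add_ind lam I) mu = 0"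
        unfolding str by (intro prod_zero bexI[OF _ im]) (simp_all only: zero mult_zero_left finite_lessThan)
      moreover have "C * (\<Prod>i<m. toda_local A B i (i \<in> I) (Suc i \<in> I)) = 0"
      proof (cases "b i = 0")
        case True
        then have "toda_local A B i (i \<in> I) (Suc i \<in> I) = 0" using i by (simp add: toda_local_def B_def)
        then have "(\<Prod>i<m. toda_local A B i (i \<in> I) (Suc i \<in> I)) = 0"
          using im by (intro prod_zero) auto
        then show ?thesis by simp
      next
        case False
        then have "iqf q (b i) = 0" using i by (simp add: iqf_neg)
        then have "C = 0" unfolding C_def using im by (intro prod_zero) auto
        then show ?thesis by simp
      qed
      ultimately show ?thesis by (simp add: t_def)
    qed
  qed
  have big: "t I = 0" if "I \<subseteq> {..<m}" "n < card I" for I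
  proof (rule ccontr)
    assume nz: "t I \<noteq> 0"
    have van: "vanishes_from m (add_ind lam I)" using vanishes_add_ind[OF m(1) that(1)] .
    have "add_ind lam I i \<le> mu i" for i
      using nz strip_wt_nonzeroD(1)[of "add_ind lam I" mu i]
      vanishes_finite_support[OF van] vanishes_finite_support[OF m(2)] by (auto simp: t_def)
    then have "weight (add_ind lam I) \<le> weight mu"
      by (simp add: weight_eq[OF van] weight_eq[OF m(2)] sum_mono)
    then show False using that size weight_add_ind[OF m(1) that(1)] by simp
  qed
  have "(\<Sum>kap\<in>parts_of (weight lam + int r). vstrip_wt q lam kap * (norm_wt q kap * strip_wt q kap mu)) =
      (\<Sum>I | I \<in> Pow {..<m} \<and> card I = r. t I)" for r
    unfolding t_def
  proof (rule sum_vstrip_up[OF lam m(1)])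
    fix kap assume k: "kap \<in> parts" "norm_wt q kap * strip_wt q kap mu \<noteq> 0"
    then have "kap i \<le> mu i" for i
      using strip_wt_nonzeroD(1)[of kap mu i] mu by (auto simp: parts_def)
    then show "vanishes_from m kap"
      using m(2) parts_nonneg[OF k(1)] unfolding vanishes_from_def by (metis order_antisym)
  qed
  then have "(\<Sum>r\<le>n. (-1) ^ r * (\<Sum>kap\<in>parts_of (weight lam + int r).
      vstrip_wt q lam kap * (norm_wt q kap * strip_wt q kap mu))) =
      (\<Sum>r\<le>n. \<Sum>I | I \<in> {I\<in>Pow {..<m}. card I \<le> n} \<and> card I = r. (-1) ^ card I * t I)"
    by (auto simp: sum_distrib_left intro!: sum.cong)
  also have "\<dots> = (\<Sum>I\<in>{I\<in>Pow {..<m}. card I \<le> n}. (-1) ^ card I * t I)"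
    by (rule sum.group) auto
  also have "\<dots> = (\<Sum>I\<in>Pow {..<m}. (-1) ^ card I * t I)"
  proof (rule sum.mono_neutral_left)
    show "\<forall>I\<in>Pow {..<m} - {I \<in> Pow {..<m}. card I \<le> n}. (-1) ^ card I * t I = 0"
    proof
      fix I assume "I \<in> Pow {..<m} - {I \<in> Pow {..<m}. card I \<le> n}"
      then have "I \<subseteq> {..<m}" "n < card I" by auto
      then show "(-1) ^ card I * t I = 0" by (simp add: big)
    qed
  qed auto
  also have "\<dots> = (\<Sum>I\<in>Pow {..<m}. C * (\<Prod>i<m. toda_local A B i (i \<in> I) (Suc i \<in> I)))"
    by (intro sum.cong refl t) simp
  also have "\<dots> = C * (\<Prod>i<m. (1 - A i) * B i)"
    using m by (subst sum_distrib_left[symmetric], subst sum_toda_local) (auto simp: B_def b_def vanishes_from_def)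
  also have "\<dots> = (\<Prod>i<m. q powi b i) * ((\<Prod>i<m. qfac q (a i + b (Suc i))) *
      (\<Prod>i<m. iqf q (b i) * ((1 - q powi (a i + 1)) * iqf q (a i + 1))))"
    by (simp add: C_def A_def B_def prod.distrib ac_simps)
  also have "(\<Prod>i<m. q powi b i) = q powi (\<Sum>i<m. b i)"
    by (simp add: power_int_sum)
  also have "(\<Sum>i<m. b i) = int n"
    using size by (simp add: b_def sum_subtractf weight_eq[OF m(1)] weight_eq[OF m(2)])
  also have "(\<Prod>i<m. qfac q (a i + b (Suc i))) = norm_wt q lam"
    by (simp add: norm_wt_eq[OF m(1)] a_def b_def)
  also have "(\<Prod>i<m. iqf q (b i) * ((1 - q powi (a i + 1)) * iqf q (a i + 1))) = strip_wt q lam mu"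
    by (simp add: strip_wt_eq[OF m] a_def b_def flip: iqf_add_one)
  finally show ?thesis by simp
qed

end

section \<open>Formal power series and peeling\<close>

definition mconst :: "'a::comm_ring_1 \<Rightarrow> 'a mfps" where
  "mconst c = mscale c 1"

lemma mcoeff_0 [simp]: "mcoeff 0 M = 0"
  and mcoeff_add [simp]: "mcoeff (f + g) M = mcoeff f M + mcoeff g M"
  and mcoeff_diff [simp]: "mcoeff (f - g) M = mcoeff f M - mcoeff g M"
  and mcoeff_uminus [simp]: "mcoeff (- f) M = - mcoeff f M"
  and mcoeff_mscale [simp]: "mcoeff (mscale c f) M = c * mcoeff f M"
  and mcoeff_1: "mcoeff 1 M = (if M = {#} then 1 else 0)"
  by (simp_all add: zero_mfps_def plus_mfps_def minus_mfps_def uminus_mfps_def mscale_def one_mfps_def)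

lemma mcoeff_mult: "mcoeff (f * g) M = (\<Sum>(A, B) | A + B = M. mcoeff f A * mcoeff g B)"
  by (simp add: times_mfps_def)

lemma mcoeff_mult_empty: "mcoeff (f * g) {#} = mcoeff f {#} * mcoeff g {#}"
proof -
  have "{(A, B). A + B = {#}} = {({#}, {#} :: nat multiset)}" by auto
  then show ?thesis by (simp add: mcoeff_mult)
qed

lemma mcoeff_sum [simp]: "mcoeff (\<Sum>i\<in>S. f i) M = (\<Sum>i\<in>S. mcoeff (f i) M)"
  by (induction S rule: infinite_finite_induct) simp_all

lemma mscale_mult_left: "mscale c f * g = mscale c (f * g)"
  by (rule mfps_eqI) (simp add: mcoeff_mult sum_distrib_left mult.assoc split_def)

lemma mscale_eq: "mscale c f = mconst c * f"
  by (simp add: mconst_def mscale_mult_left)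

lemma mcoeff_mconst_mult [simp]: "mcoeff (mconst c * f) M = c * mcoeff f M"
  by (simp flip: mscale_eq)

lemma mcoeff_mconst: "mcoeff (mconst c) M = (if M = {#} then c else 0)"
  by (simp add: mconst_def mcoeff_1)

lemma mconst_0 [simp]: "mconst 0 = 0"
  and mconst_1 [simp]: "mconst 1 = 1"
  and mconst_add: "mconst (a + b) = mconst a + mconst b"
  and mconst_diff: "mconst (a - b) = mconst a - mconst b"
  and mconst_uminus: "mconst (- a) = - mconst a"
  by (rule mfps_eqI; simp add: mcoeff_mconst mcoeff_1)+

lemma mconst_mult: "mconst (a * b) = mconst a * mconst b"
  by (rule mfps_eqI) (simp add: mcoeff_mconst)

lemma mconst_sum: "mconst (\<Sum>i\<in>S. f i) = (\<Sum>i\<in>S. mconst (f i))"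
  by (induction S rule: infinite_finite_induct) (simp_all add: mconst_add)

lemma mconst_mult_eq_0: "c \<noteq> 0 \<Longrightarrow> mconst c * f = 0 \<Longrightarrow> f = (0 :: 'a::idom mfps)"
  by (rule mfps_eqI) (metis mcoeff_0 mcoeff_mconst_mult mult_eq_0_iff)

text \<open>
  Exponents \<open>k, M\<^sub>0, M\<^sub>1, \<dots>\<close>: a new variable with exponent \<open>k\<close> is put in front of the others.
\<close>

definition cons_mset :: "nat \<Rightarrow> nat multiset \<Rightarrow> nat multiset" where
  "cons_mset k M = replicate_mset k 0 + image_mset Suc M"

definition tail_mset :: "nat multiset \<Rightarrow> nat multiset" where
  "tail_mset M = image_mset (\<lambda>i. i - 1) (filter_mset (\<lambda>i. i \<noteq> 0) M)"

lemma count_cons_mset_0 [simp]: "count (cons_mset k M) 0 = k"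
  and count_cons_mset_Suc [simp]: "count (cons_mset k M) (Suc i) = count M i"
  unfolding cons_mset_def by (induction M) auto

lemma size_cons_mset [simp]: "size (cons_mset k M) = k + size M"
  by (simp add: cons_mset_def)

lemma set_cons_mset: "set_mset (cons_mset k M) = (if k = 0 then {} else {0}) \<union> Suc ` set_mset M"
  by (simp add: cons_mset_def)

lemma tail_cons_mset [simp]: "tail_mset (cons_mset k M) = M"
proof -
  have "filter_mset (\<lambda>i. i \<noteq> 0) (cons_mset k M) = image_mset Suc M"
    by (simp add: cons_mset_def filter_mset_image_mset)
  then show ?thesis by (simp add: tail_mset_def image_mset.compositionality o_def)
qed

lemma cons_tail_mset: "cons_mset (count M 0) (tail_mset M) = M"
proof -
  have "image_mset Suc (tail_mset M) = image_mset (\<lambda>i. i) (filter_mset (\<lambda>i. i \<noteq> 0) M)"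
    unfolding tail_mset_def image_mset.compositionality by (intro image_mset_cong) simp
  moreover have "replicate_mset (count M 0) 0 = filter_mset (\<lambda>i. i = 0) M"
    by (simp add: filter_eq_replicate_mset)
  ultimately show ?thesis
    unfolding cons_mset_def using multiset_partition[of M "\<lambda>i. i = 0"] by simp
qed

lemma cons_mset_add: "cons_mset (i + j) (A + B) = cons_mset i A + cons_mset j B"
  by (induction i) (simp_all add: cons_mset_def replicate_mset_def)

lemma tail_mset_add: "tail_mset (A + B) = tail_mset A + tail_mset B"
  by (simp add: tail_mset_def)

lemma cons_mset_0_empty [simp]: "cons_mset 0 {#} = {#}"
  by (simp add: cons_mset_def)

lemma cons_mset_eq_empty_iff [simp]: "cons_mset k M = {#} \<longleftrightarrow> k = 0 \<and> M = {#}"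
  by (simp add: cons_mset_def)

lemma set_tail_mset: "set_mset M \<subseteq> {..<Suc n} \<Longrightarrow> set_mset (tail_mset M) \<subseteq> {..<n}"
  by (auto simp: tail_mset_def subset_iff)

text \<open>
  The coefficient of \<open>y\<^sup>k\<close> in \<open>f(y, x\<^sub>0, x\<^sub>1, \<dots>)\<close>. Since the variables are shifted, \<open>peel 0\<close> is the
  identity only on symmetric series.
\<close>

definition peel :: "nat \<Rightarrow> 'a mfps \<Rightarrow> 'a mfps" where
  "peel k f = Abs_mfps (\<lambda>M. mcoeff f (cons_mset k M))"

lemma mcoeff_peel [simp]: "mcoeff (peel k f) M = mcoeff f (cons_mset k M)"
  by (simp add: peel_def)

lemma peel_0 [simp]: "peel k (0 :: 'a::comm_ring_1 mfps) = 0"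
  and peel_1: "peel k (1 :: 'a::comm_ring_1 mfps) = (if k = 0 then 1 else 0)"
  and peel_add: "peel k (f + g) = peel k f + peel k (g :: 'a mfps)"
  and peel_diff: "peel k (f - g) = peel k f - peel k (g :: 'a mfps)"
  and peel_mconst_mult: "peel k (mconst c * f) = mconst c * peel k (f :: 'a mfps)"
  by (rule mfps_eqI; simp add: mcoeff_1)+

lemma peel_sum: "peel k (\<Sum>i\<in>S. f i) = (\<Sum>i\<in>S. peel k (f i :: 'a::comm_ring_1 mfps))"
  by (rule mfps_eqI) simp

lemma peel_mult:
  "peel n (f * g) = (\<Sum>i\<le>n. peel i f * peel (n - i) (g :: 'a::comm_ring_1 mfps))"
proof (rule mfps_eqI)
  fix M
  have "mcoeff (\<Sum>i\<le>n. peel i f * peel (n - i) g) M =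
      (\<Sum>i\<le>n. \<Sum>(A, B)\<in>{(A, B). A + B = M}. mcoeff f (cons_mset i A) * mcoeff g (cons_mset (n - i) B))"
    by (simp add: mcoeff_mult)
  also have "\<dots> = (\<Sum>(i, (A, B))\<in>Sigma {..n} (\<lambda>_. {(A, B). A + B = M}).
      mcoeff f (cons_mset i A) * mcoeff g (cons_mset (n - i) B))"
    by (subst sum.Sigma) (auto simp: finite_mset_splits split_def intro: finite_mset_splits[unfolded split_def])
  also have "\<dots> = (\<Sum>(A, B) | A + B = cons_mset n M. mcoeff f A * mcoeff g B)"
  proof (rule sum.reindex_bij_witness[where
      i = "\<lambda>(A, B). (count A 0, (tail_mset A, tail_mset B))" and
      j = "\<lambda>(i, (A, B)). (cons_mset i A, cons_mset (n - i) B)"])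
    fix p assume "p \<in> {(A, B). A + B = cons_mset n M}"
    then obtain A B where p: "p = (A, B)" "A + B = cons_mset n M" by auto
    have "count A 0 + count B 0 = n" "tail_mset A + tail_mset B = M"
      using arg_cong[OF p(2), of "\<lambda>M. count M 0"] arg_cong[OF p(2), of tail_mset]
      by (simp_all add: tail_mset_add)
    moreover from this have "n - count A 0 = count B 0" by simp
    ultimately show "(case case p of (A, B) \<Rightarrow> (count A 0, tail_mset A, tail_mset B) of
          (i, A, B) \<Rightarrow> (cons_mset i A, cons_mset (n - i) B)) = p"
      "(case p of (A, B) \<Rightarrow> (count A 0, tail_mset A, tail_mset B)) \<in> {..n} \<times> {(A, B). A + B = M}"
      using p by (auto simp: cons_tail_mset)
  qed (auto simp: cons_mset_add[symmetric])
  finally show "mcoeff (peel n (f * g)) M = mcoeff (\<Sum>i\<le>n. peel i f * peel (n - i) g) M"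
    by (simp add: mcoeff_mult)
qed

text \<open>
  Peeling off the variables one after the other turns any coefficient into a constant term. This replaces all
  computations with coefficients of products: it suffices to know how the factors peel.
\<close>

lemma peel_family_eq_0:
  assumes const: "\<And>i. i \<in> I \<Longrightarrow> mcoeff (X i) {#} = 0"
    and step: "\<And>i k M. i \<in> I \<Longrightarrow> (\<And>j. j \<in> I \<Longrightarrow> mcoeff (X j) M = 0) \<Longrightarrow> mcoeff (peel k (X i)) M = 0"
    and "i \<in> I"
  shows "X i = (0 :: 'a::comm_ring_1 mfps)"
proof -
  have "mcoeff (X i) M = 0" if "set_mset M \<subseteq> {..<n}" "i \<in> I" for n M i
    using that
  proof (induction n arbitrary: M i)
    case 0
    then show ?case by (simp add: const)
  next
    case (Suc n)
    have "mcoeff (peel (count M 0) (X i)) (tail_mset M) = 0"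
      using Suc by (intro step) (auto dest: set_tail_mset)
    then show ?case by (simp add: cons_tail_mset)
  qed
  moreover have "\<exists>n. set_mset M \<subseteq> {..<n}" for M :: "nat multiset"
    using finite_nat_set_iff_bounded[of "set_mset M"] by auto
  ultimately show ?thesis using \<open>i \<in> I\<close> by (intro mfps_eqI) (metis mcoeff_0)
qed

text \<open>
  The elementary symmetric functions \<open>e_r\<close> and the functions \<open>g_n\<close>. The integer index makes them 0 for negative
  indices, so that the peeling rules hold without case distinctions.
\<close>

definition elem :: "int \<Rightarrow> complex mfps" where
  "elem r = Abs_mfps (\<lambda>M. if int (size M) = r \<and> (\<forall>i. count M i \<le> 1) then 1 else 0)"

definition cplt :: "complex \<Rightarrow> int \<Rightarrow> complex mfps" where
  "cplt q n = Abs_mfps (\<lambda>M. if int (size M) = n then \<Prod>i\<in>set_mset M. iqf q (int (count M i)) else 0)"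

lemma all_nat_iff: "(\<forall>i. P i) \<longleftrightarrow> P 0 \<and> (\<forall>i. P (Suc i))"
  using not0_implies_Suc by metis

lemma peel_elem: "peel k (elem r) = (if k = 0 then elem r else if k = 1 then elem (r - 1) else 0)"
  by (rule mfps_eqI) (auto simp: elem_def all_nat_iff[of "\<lambda>i. count (cons_mset _ _) i \<le> _"])

lemma peel_elem_mult:
  "peel k (elem r * f) = elem r * peel k f + (if k = 0 then 0 else elem (r - 1) * peel (k - 1) f)"
proof (cases k)
  case (Suc m)
  have "peel k (elem r * f) = (\<Sum>i\<in>{0, 1}. peel i (elem r) * peel (k - i) f)"
    unfolding peel_mult by (rule sum.mono_neutral_right) (auto simp: peel_elem Suc)
  then show ?thesis by (simp add: peel_elem Suc)
qed (simp add: peel_mult peel_elem)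

lemma elem_0: "elem 0 = 1" and elem_neg: "r < 0 \<Longrightarrow> elem r = 0"
  by (rule mfps_eqI; simp add: elem_def mcoeff_1)+

lemma mcoeff_elem_empty: "mcoeff (elem r) {#} = (if r = 0 then 1 else 0)"
  by (simp add: elem_def)

context nome
begin

lemma cplt_0: "cplt q 0 = 1" and cplt_neg: "r < 0 \<Longrightarrow> cplt q r = 0"
  by (rule mfps_eqI; simp add: cplt_def mcoeff_1)+

lemma mcoeff_cplt_empty: "mcoeff (cplt q r) {#} = (if r = 0 then 1 else 0)"
  by (simp add: cplt_def)

lemma peel_cplt: "peel k (cplt q n) = mconst (iqf q (int k)) * cplt q (n - int k)"
proof (rule mfps_eqI)
  fix M
  have "(\<Prod>i\<in>set_mset (cons_mset k M). iqf q (int (count (cons_mset k M) i))) =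
      iqf q (int k) * (\<Prod>i\<in>set_mset M. iqf q (int (count M i)))"
  proof -
    have "(\<Prod>i\<in>Suc ` set_mset M. iqf q (int (count (cons_mset k M) i))) =
        (\<Prod>i\<in>set_mset M. iqf q (int (count M i)))"
      by (simp add: prod.reindex)
    then show ?thesis
      by (cases "k = 0") (simp_all add: set_cons_mset)
  qed
  then show "mcoeff (peel k (cplt q n)) M = mcoeff (mconst (iqf q (int k)) * cplt q (n - int k)) M"
    by (auto simp: cplt_def)
qed

end

lemma peel_power_sum:
  assumes "0 < n"
  shows "peel k (power_sum n) = (if k = 0 then power_sum n else if k = n then 1 else 0)"
proof (rule mfps_eqI)
  fix M
  have *: "(\<exists>i. cons_mset k M = replicate_mset n i) \<longleftrightarrow>
      (if k = 0 then \<exists>i. M = replicate_mset n i else k = n \<and> M = {#})"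
  proof
    assume "\<exists>i. cons_mset k M = replicate_mset n i"
    then obtain i where i: "cons_mset k M = replicate_mset n i" by blast
    show "if k = 0 then \<exists>i. M = replicate_mset n i else k = n \<and> M = {#}"
    proof (cases i)
      case 0
      then have "k = n" using arg_cong[OF i, of "\<lambda>M. count M 0"] by simp
      moreover have "size M = 0" using arg_cong[OF i, of size] \<open>k = n\<close> by simp
      ultimately show ?thesis using assms by simp
    next
      case (Suc j)
      then have "k = 0" using arg_cong[OF i, of "\<lambda>M. count M 0"] by simp
      moreover have "tail_mset (replicate_mset n (Suc j)) = replicate_mset n j"
        by (induction n) (simp_all add: tail_mset_def)
      then have "M = replicate_mset n j"
        using arg_cong[OF i, of tail_mset] Suc by simp
      ultimately show ?thesis by auto
    qed
  next
    assume "if k = 0 then \<exists>i. M = replicate_mset n i else k = n \<and> M = {#}"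
    then show "\<exists>i. cons_mset k M = replicate_mset n i"
      by (auto simp: cons_mset_def split: if_splits)
  qed
  show "mcoeff (peel k (power_sum n)) M = mcoeff (if k = 0 then power_sum n else if k = n then 1 else 0) M"
    unfolding mcoeff_peel power_sum_def mcoeff_Abs_mfps * by (auto simp: mcoeff_1)
qed

lemma mcoeff_power_sum_empty: "0 < n \<Longrightarrow> mcoeff (power_sum n) {#} = 0"
  by (simp add: power_sum_def)

lemma peel_power_sum_mult:
  assumes "0 < n"
  shows "peel k (power_sum n * f) = power_sum n * peel k f + (if n \<le> k then peel (k - n) f else 0)"
proof -
  have "peel k (power_sum n * f) = (\<Sum>i\<in>{0} \<union> (if n \<le> k then {n} else {}). peel i (power_sum n) * peel (k - i) f)"
    unfolding peel_mult
    by (rule sum.mono_neutral_right) (use assms in \<open>auto simp: peel_power_sum\<close>)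
  then show ?thesis using assms by (simp add: peel_power_sum)
qed

context nome
begin

text \<open>
  The coefficients of \<open>G(q z) = E(-z) G(z)\<close>. Both sides peel in the same way by
  \<open>(1 - q\<^sup>k) / (q)\<^sub>k = 1 / (q)\<^sub>k\<^sub>-\<^sub>1\<close>; an arbitrary upper limit \<open>N\<close> of summation is allowed so that the limit does
  not have to change with \<open>n\<close> under peeling.
\<close>

lemma elem_cplt_alternating:
  assumes "nat n \<le> N"
  shows "mconst (q powi n) * cplt q n = (\<Sum>r\<le>N. mconst ((-1) ^ r) * (elem (int r) * cplt q (n - int r)))"
proof -
  define S where "S n N = (\<Sum>r\<le>N. mconst ((-1) ^ r) * (elem (int r) * cplt q (n - int r)))" for n N
  have S_Suc: "S n (Suc N) = S n N" if "nat n \<le> N" for n N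
    using that by (simp add: S_def cplt_neg)
  have peel_S: "peel k (S n N) = mconst (iqf q (int k) * q ^ k) * S (n - int k) N" if "nat n \<le> N" for k n N
  proof (cases k)
    case 0
    then show ?thesis by (simp add: S_def peel_sum peel_mconst_mult peel_elem_mult peel_cplt)
  next
    case (Suc m)
    have "iqf q (int m) = (1 - q ^ k) * iqf q (int k)"
      using iqf_diff_one[of "int k", unfolded power_int_of_nat] by (simp add: Suc)
    then have iq: "iqf q (int k) * q ^ k = iqf q (int k) - iqf q (int m)"
      by (simp add: algebra_simps)
    have "peel k (S n N) = (\<Sum>r\<le>N. mconst ((-1) ^ r) * (elem (int r) * (mconst (iqf q (int k)) * cplt q (n - int r - int k)))) +
       (\<Sum>r\<le>N. mconst ((-1) ^ r) * (elem (int r - 1) * (mconst (iqf q (int m)) * cplt q (n - int r - int m))))"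
      by (simp add: S_def peel_sum peel_mconst_mult peel_elem_mult peel_cplt Suc distrib_left sum.distrib)
    also have "(\<Sum>r\<le>N. mconst ((-1) ^ r) * (elem (int r) * (mconst (iqf q (int k)) * cplt q (n - int r - int k)))) =
        mconst (iqf q (int k)) * S (n - int k) N"
      unfolding S_def sum_distrib_left by (intro sum.cong refl) (simp add: algebra_simps)
    also have "(\<Sum>r\<le>N. mconst ((-1) ^ r) * (elem (int r - 1) * (mconst (iqf q (int m)) * cplt q (n - int r - int m)))) =
        - mconst (iqf q (int m)) * S (n - int k) N"
    proof -
      have "(\<Sum>r\<le>N. mconst ((-1) ^ r) * (elem (int r - 1) * (mconst (iqf q (int m)) * cplt q (n - int r - int m)))) =
        (\<Sum>r\<le>Suc N. mconst ((-1) ^ r) * (elem (int r - 1) * (mconst (iqf q (int m)) * cplt q (n - int r - int m))))"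
        using that by (simp add: cplt_neg)
      also have "\<dots> = (\<Sum>r\<le>N. mconst ((-1) ^ Suc r) * (elem (int r) * (mconst (iqf q (int m)) * cplt q (n - int r - int k))))"
        by (subst sum.atMost_Suc_shift) (simp add: elem_neg Suc algebra_simps)
      also have "\<dots> = - mconst (iqf q (int m)) * S (n - int k) N"
        unfolding S_def sum_distrib_left by (intro sum.cong refl) (simp add: mconst_uminus algebra_simps)
      finally show ?thesis .
    qed
    finally show ?thesis unfolding iq by (simp add: mconst_diff algebra_simps)
  qed
  have const: "mcoeff (S n N) {#} = (if n = 0 then 1 else 0)" for n N
  proof -
    have "mcoeff (S n N) {#} = (\<Sum>r\<le>N. if r = 0 then if n = 0 then 1 else 0 else 0)"
      unfolding S_def mcoeff_sum mcoeff_mconst_mult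
      by (intro sum.cong refl) (simp add: mcoeff_mult_empty mcoeff_elem_empty mcoeff_cplt_empty)
    then show ?thesis by simp
  qed
  define X where "X = (\<lambda>n. mconst (q powi n) * cplt q n - S n N)"
  have "X n = 0"
  proof (rule peel_family_eq_0[where X = X and I = "{n. nat n \<le> N}"])
    fix n assume "n \<in> {n. nat n \<le> N}"
    then show "mcoeff (X n) {#} = 0" by (simp add: X_def const mcoeff_cplt_empty)
  next
    fix n and k :: nat and M assume n: "n \<in> {n. nat n \<le> N}" and IH: "\<And>j. j \<in> {n. nat n \<le> N} \<Longrightarrow> mcoeff (X j) M = 0"
    have e: "q powi n = q ^ k * q powi (n - int k)"
      using q_nonzero by (simp add: power_int_diff)
    have "peel k (X n) = mconst (q powi n) * peel k (cplt q n) - peel k (S n N)"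
      by (simp add: X_def peel_diff peel_mconst_mult)
    also have "\<dots> = mconst (iqf q (int k) * q ^ k) * X (n - int k)"
      using n by (simp add: peel_S peel_cplt e mconst_mult X_def algebra_simps)
    finally have "peel k (X n) = mconst (iqf q (int k) * q ^ k) * X (n - int k)" .
    moreover have "mcoeff (X (n - int k)) M = 0" using n by (intro IH) auto
    ultimately show "mcoeff (peel k (X n)) M = 0" by (simp only: mcoeff_mconst_mult) simp
  qed (use assms in simp)
  then show ?thesis by (simp add: X_def S_def)
qed

end

section \<open>Branching rule and Pieri rules\<close>

text \<open>
  The coefficient of the monomial with exponents \<open>k\<^sub>0, k\<^sub>1, \<dots>\<close> as a sum over Gelfand-Tsetlin patterns, that
  is, over chains of horizontal strips of these sizes from \<open>lam\<close> down to the empty partition.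
\<close>

primrec branch_coeff :: "complex \<Rightarrow> nat list \<Rightarrow> (nat \<Rightarrow> int) \<Rightarrow> complex" where
  "branch_coeff q [] lam = (if lam = (\<lambda>_. 0) then 1 else 0)"
| "branch_coeff q (k # ks) lam =
     (\<Sum>kap\<in>parts_of (weight lam - int k). norm_wt q lam * strip_wt q kap lam * branch_coeff q ks kap)"

text \<open>
  The list of exponents runs up to the largest variable that occurs; trailing zeros do not matter
  (\<open>branch_coeff_append_0\<close>). Symmetry in the variables is not evident from this definition; it follows
  from the Pieri rule below.
\<close>

definition qWhit :: "complex \<Rightarrow> (nat \<Rightarrow> int) \<Rightarrow> complex mfps" where
  "qWhit q lam = Abs_mfps (\<lambda>M. branch_coeff q (map (count M) [0..<Suc (Max (insert 0 (set_mset M)))]) lam)"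

context nome
begin

lemma norm_wt_0: "norm_wt q (\<lambda>_. 0) = 1" and strip_wt_0: "strip_wt q (\<lambda>_. 0) (\<lambda>_. 0) = 1"
  by (simp_all add: norm_wt_def strip_wt_def)

lemma branch_coeff_append_0:
  "lam \<in> parts \<Longrightarrow> branch_coeff q (ks @ replicate n 0) lam = branch_coeff q ks lam"
proof (induction ks arbitrary: lam)
  case Nil
  then show ?case
  proof (induction n)
    case (Suc n)
    show ?case
    proof (cases "lam = (\<lambda>_. 0)")
      case True
      then show ?thesis using Suc
        by (simp add: weight_def parts_of_0 norm_wt_0 strip_wt_0)
    next
      case False
      have "branch_coeff q (replicate n 0) kap = 0" if "kap \<in> parts_of (weight lam)" for kap
      proof -
        have "branch_coeff q ks kap = 0" if "kap \<in> parts" "kap \<noteq> (\<lambda>_. 0)" "ks = replicate n 0" for ks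
          using that
        proof (induction n arbitrary: ks kap)
          case (Suc n)
          have "branch_coeff q (replicate n 0) kap' = 0" if "kap' \<in> parts_of (weight kap)" for kap'
          proof (rule Suc.IH)
            have "weight kap \<noteq> 0" using Suc.prems weight_eq_0_iff by blast
            then show "kap' \<noteq> (\<lambda>_. 0)" using that by (auto simp: parts_of_def weight_def)
          qed (use that in \<open>auto simp: parts_of_def\<close>)
          then show ?case using Suc.prems by simp
        qed simp
        moreover have "weight lam \<noteq> 0" using Suc.prems False weight_eq_0_iff by blast
        then have "kap \<noteq> (\<lambda>_. 0)" using that by (auto simp: parts_of_def weight_def)
        ultimately show ?thesis using that by (auto simp: parts_of_def)
      qed
      then show ?thesis using False by simp
    qed
  qed simp
next
  case (Cons k ks)
  then show ?case by (auto simp: parts_of_def intro!: sum.cong)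
qed

lemma mcoeff_qWhit:
  assumes "lam \<in> parts" "set_mset M \<subseteq> {..<n}"
  shows "mcoeff (qWhit q lam) M = branch_coeff q (map (count M) [0..<n]) lam"
proof -
  have ext: "branch_coeff q (map (count M) [0..<m + d]) lam = branch_coeff q (map (count M) [0..<m]) lam"
    if "set_mset M \<subseteq> {..<m}" for m d
  proof -
    have "count M i = 0" if "m \<le> i" for i
      using \<open>set_mset M \<subseteq> {..<m}\<close> that by (auto simp: count_eq_zero_iff)
    then have "map (count M) [0..<m + d] = map (count M) [0..<m] @ replicate d 0"
      by (intro nth_equalityI) (auto simp: nth_append)
    then show ?thesis using assms(1) by (simp add: branch_coeff_append_0)
  qed
  define m where "m = Suc (Max (insert 0 (set_mset M)))"
  have m: "set_mset M \<subseteq> {..<m}" by (auto simp: m_def less_Suc_eq_le)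
  have "branch_coeff q (map (count M) [0..<m]) lam = branch_coeff q (map (count M) [0..<n]) lam"
    using ext[OF m, of n] ext[OF assms(2), of m] by (simp add: add.commute)
  then show ?thesis by (simp add: qWhit_def m_def)
qed

lemma peel_qWhit:
  assumes "lam \<in> parts"
  shows "peel k (qWhit q lam) =
    (\<Sum>kap\<in>parts_of (weight lam - int k). mconst (norm_wt q lam * strip_wt q kap lam) * qWhit q kap)"
proof (rule mfps_eqI)
  fix M :: "nat multiset"
  obtain n where n: "set_mset M \<subseteq> {..<n}"
    using finite_nat_set_iff_bounded[of "set_mset M"] by auto
  then have n': "set_mset (cons_mset k M) \<subseteq> {..<Suc n}"
    by (auto simp: set_cons_mset split: if_splits)
  have "map (count (cons_mset k M)) [0..<Suc n] = k # map (count M) [0..<n]"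
    by (simp add: upt_conv_Cons map_Suc_upt[symmetric] o_def del: upt_Suc)
  then show "mcoeff (peel k (qWhit q lam)) M =
      mcoeff (\<Sum>kap\<in>parts_of (weight lam - int k). mconst (norm_wt q lam * strip_wt q kap lam) * qWhit q kap) M"
    using mcoeff_qWhit[OF _ n] mcoeff_qWhit[OF assms n']
    by (auto simp: parts_of_def intro!: sum.cong)
qed

lemma mcoeff_qWhit_empty: "lam \<in> parts \<Longrightarrow> mcoeff (qWhit q lam) {#} = (if lam = (\<lambda>_. 0) then 1 else 0)"
  using mcoeff_qWhit[of lam "{#}" 0] by simp

lemma strip_wt_nonzero_weight:
  assumes "strip_wt q lam mu \<noteq> 0" "lam \<in> parts" "mu \<in> parts"
  shows "weight lam \<le> weight mu" and "weight lam = weight mu \<Longrightarrow> lam = mu"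
proof -
  have le: "lam i \<le> mu i" for i
    using strip_wt_nonzeroD(1)[OF assms(1)] assms(2,3) by (simp add: parts_def)
  show "weight lam \<le> weight mu" and "weight lam = weight mu \<Longrightarrow> lam = mu"
    using weight_mono[OF assms(2,3) le] by auto
qed

lemma strip_wt_self: "lam \<in> parts \<Longrightarrow> norm_wt q lam * strip_wt q lam lam = 1"
proof -
  assume lam: "lam \<in> parts"
  then obtain n where n: "vanishes_from n lam" by (rule partsE)
  have "qfac q (lam i - lam (Suc i)) * iqf q (lam i - lam (Suc i)) = 1" for i
    using antimono_parts[OF lam, of i "Suc i"] by (intro qfac_iqf) simp
  then show ?thesis
    by (simp add: norm_wt_eq[OF n] strip_wt_eq[OF n n] flip: prod.distrib)
qed

lemma vstrip_combination_same_weight: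
  assumes "lam \<in> parts"
  shows "(\<Sum>mu\<in>parts_of (weight lam). mconst (vstrip_wt q lam mu) * f mu) = f lam"
proof -
  have 0: "vstrip_wt q lam mu = 0" if mu: "mu \<in> parts_of (weight lam)" "mu \<noteq> lam" for mu
  proof (rule ccontr)
    assume nz: "vstrip_wt q lam mu \<noteq> 0"
    have "lam i \<le> mu i" for i using vstrip_wt_nonzeroD[OF nz, of i] by auto
    then show False using weight_mono(2)[OF assms parts_ofD(1)[OF mu(1)]] mu by (simp add: parts_of_def)
  qed
  have "(\<Sum>mu\<in>parts_of (weight lam). mconst (vstrip_wt q lam mu) * f mu) =
      (\<Sum>mu\<in>{lam}. mconst (vstrip_wt q lam mu) * f mu)"
    by (rule sum.mono_neutral_right) (auto simp: finite_parts_of parts_of_weight assms 0)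
  then show ?thesis by (simp add: vstrip_wt_def)
qed

lemma nested_combination:
  "(\<Sum>i\<in>S. mconst (a i) * (\<Sum>j\<in>T. mconst (b i j) * f j)) = (\<Sum>j\<in>T. mconst (\<Sum>i\<in>S. a i * b i j) * f j)"
proof -
  have "(\<Sum>i\<in>S. mconst (a i) * (\<Sum>j\<in>T. mconst (b i j) * f j)) =
      (\<Sum>i\<in>S. \<Sum>j\<in>T. mconst (a i * b i j) * f j)"
    by (simp add: sum_distrib_left mconst_mult mult.assoc)
  also have "\<dots> = (\<Sum>j\<in>T. \<Sum>i\<in>S. mconst (a i * b i j) * f j)" by (rule sum.swap)
  finally show ?thesis by (simp add: mconst_sum sum_distrib_right)
qed

text \<open>
  Peeling a product with \<open>e_r\<close> and peeling the right-hand side lead to combinations of the same differences,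
  for \<open>r\<close> and \<open>r - 1\<close>; the coefficients agree by \<open>vstrip_strip_exchange\<close>. The constant terms agree because only
  the empty partition contributes.
\<close>

theorem elem_Pieri:
  assumes "lam \<in> parts"
  shows "elem (int r) * qWhit q lam =
    (\<Sum>mu\<in>parts_of (weight lam + int r). mconst (vstrip_wt q lam mu) * qWhit q mu)"
proof -
  define R where "R r lam = (\<Sum>mu\<in>parts_of (weight lam + int r). mconst (vstrip_wt q lam mu) * qWhit q mu)" for r lam
  define X where "X = (\<lambda>(r, lam). elem (int r) * qWhit q lam - R r lam)"
  have "X (r, lam) = 0"
  proof (rule peel_family_eq_0[where X = X and I = "UNIV \<times> parts"])
    fix i :: "nat \<times> (nat \<Rightarrow> int)" assume "i \<in> UNIV \<times> parts"
    then obtain r lam where i: "i = (r, lam)" "lam \<in> parts" by auto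
    have l: "mcoeff (elem (int r) * qWhit q lam) {#} = (if r = 0 \<and> lam = (\<lambda>_. 0) then 1 else 0)"
      by (simp add: mcoeff_mult_empty mcoeff_elem_empty mcoeff_qWhit_empty i)
    have "mcoeff (R r lam) {#} = (\<Sum>mu\<in>parts_of (weight lam + int r). if mu = (\<lambda>_. 0) then vstrip_wt q lam mu else 0)"
      unfolding R_def mcoeff_sum
      by (intro sum.cong refl) (auto simp: mcoeff_qWhit_empty parts_of_def)
    also have "\<dots> = (if (\<lambda>_. 0) \<in> parts_of (weight lam + int r) then vstrip_wt q lam (\<lambda>_. 0) else 0)"
      by (simp add: sum.delta finite_parts_of)
    also have "(\<lambda>_. 0) \<in> parts_of (weight lam + int r) \<longleftrightarrow> weight lam + int r = 0"
      using zero_in_parts by (auto simp: parts_of_def weight_def)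
    also have "\<dots> \<longleftrightarrow> r = 0 \<and> lam = (\<lambda>_. 0)"
      using weight_nonneg[OF i(2)] weight_eq_0_iff[OF i(2)] by auto
    finally have "mcoeff (R r lam) {#} = (if r = 0 \<and> lam = (\<lambda>_. 0) then 1 else 0)"
      by (auto simp: vstrip_wt_def)
    then show "mcoeff (X i) {#} = 0" by (simp add: X_def i l)
  next
    fix i :: "nat \<times> (nat \<Rightarrow> int)" and k :: nat and M
    assume "i \<in> UNIV \<times> parts" and IH: "\<And>j. j \<in> UNIV \<times> parts \<Longrightarrow> mcoeff (X j) M = 0"
    then obtain r lam where i: "i = (r, lam)" and lam: "lam \<in> parts" by auto
    define t where "t kap = norm_wt q lam * strip_wt q kap lam" for kap
    have up: "(\<Sum>mu\<in>parts_of (weight lam + int r). vstrip_wt q lam mu * (norm_wt q mu * strip_wt q nu mu)) =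
      (\<Sum>kap\<in>parts_of (weight lam - int k). t kap * vstrip_wt q kap nu) +
      (if r = 0 \<or> k = 0 then 0 else \<Sum>kap\<in>parts_of (weight lam - int (k - 1)). t kap * vstrip_wt q kap nu)"
      if nu: "nu \<in> parts_of (weight lam + int r - int k)" for nu
    proof -
      have w: "weight nu - int r = weight lam - int k" using nu by (simp add: parts_of_def)
      \<comment> \<open>For \<open>k = 0\<close> a larger partition would have to be contained in \<open>lam\<close>.\<close>
      have "(\<Sum>kap\<in>parts_of (weight nu - int (r - 1)). t kap * vstrip_wt q kap nu) =
          (if k = 0 then 0 else \<Sum>kap\<in>parts_of (weight lam - int (k - 1)). t kap * vstrip_wt q kap nu)" if "r \<noteq> 0"
      proof (cases "k = 0")
        case True
        have "t kap = 0" if "kap \<in> parts_of (weight nu - int (r - 1))" for kap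
        proof -
          have "weight lam < weight kap" "kap \<in> parts"
            using that w True \<open>r \<noteq> 0\<close> by (auto simp: parts_of_def)
          then have "strip_wt q kap lam = 0"
            using strip_wt_nonzero_weight(1)[of kap lam] lam by linarith
          then show ?thesis by (simp add: t_def)
        qed
        then show ?thesis using True by simp
      next
        case False
        then have "weight nu - int (r - 1) = weight lam - int (k - 1)" using w that by simp
        then show ?thesis using False by simp
      qed
      then show ?thesis
        using vstrip_strip_exchange[OF lam parts_ofD(1)[OF nu], of r] unfolding w t_def by auto
    qed
    have peel_R: "peel k (R r lam) = (\<Sum>kap\<in>parts_of (weight lam - int k). mconst (t kap) * R r kap) +
        (if r = 0 \<or> k = 0 then 0 else \<Sum>kap\<in>parts_of (weight lam - int (k - 1)). mconst (t kap) * R (r - 1) kap)"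
    proof -
      have comm: "(\<Sum>kap\<in>parts_of m. mconst (t kap) * R r' kap) =
          (\<Sum>nu\<in>parts_of (m + int r'). mconst (\<Sum>kap\<in>parts_of m. t kap * vstrip_wt q kap nu) * qWhit q nu)" for m r'
      proof -
        have "R r' kap = (\<Sum>nu\<in>parts_of (m + int r'). mconst (vstrip_wt q kap nu) * qWhit q nu)"
          if "kap \<in> parts_of m" for kap using that by (simp add: R_def parts_of_def)
        then show ?thesis by (simp add: nested_combination)
      qed
      have "peel k (R r lam) = (\<Sum>mu\<in>parts_of (weight lam + int r). mconst (vstrip_wt q lam mu) *
          (\<Sum>nu\<in>parts_of (weight lam + int r - int k). mconst (norm_wt q mu * strip_wt q nu mu) * qWhit q nu))"
        unfolding R_def peel_sum by (intro sum.cong refl) (auto simp: peel_mconst_mult peel_qWhit parts_of_def)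
      also have "\<dots> = (\<Sum>nu\<in>parts_of (weight lam + int r - int k).
          mconst (\<Sum>mu\<in>parts_of (weight lam + int r). vstrip_wt q lam mu * (norm_wt q mu * strip_wt q nu mu)) * qWhit q nu)"
        by (rule nested_combination)
      also have "\<dots> = (\<Sum>nu\<in>parts_of (weight lam + int r - int k).
          mconst (\<Sum>kap\<in>parts_of (weight lam - int k). t kap * vstrip_wt q kap nu) * qWhit q nu) +
          (if r = 0 \<or> k = 0 then 0 else (\<Sum>nu\<in>parts_of (weight lam + int r - int k).
          mconst (\<Sum>kap\<in>parts_of (weight lam - int (k - 1)). t kap * vstrip_wt q kap nu) * qWhit q nu))"
        by (simp add: up mconst_add distrib_right sum.distrib)
      also have "parts_of (weight lam + int r - int k) = parts_of (weight lam - int k + int r)"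
        by (simp add: algebra_simps)
      finally have "peel k (R r lam) = (\<Sum>kap\<in>parts_of (weight lam - int k). mconst (t kap) * R r kap) +
          (if r = 0 \<or> k = 0 then 0 else (\<Sum>nu\<in>parts_of (weight lam - int k + int r).
          mconst (\<Sum>kap\<in>parts_of (weight lam - int (k - 1)). t kap * vstrip_wt q kap nu) * qWhit q nu))"
        by (simp only: comm)
      moreover have "(\<Sum>nu\<in>parts_of (weight lam - int k + int r).
          mconst (\<Sum>kap\<in>parts_of (weight lam - int (k - 1)). t kap * vstrip_wt q kap nu) * qWhit q nu) =
          (\<Sum>kap\<in>parts_of (weight lam - int (k - 1)). mconst (t kap) * R (r - 1) kap)" if "\<not> (r = 0 \<or> k = 0)"
      proof -
        have e: "weight lam - int k + int r = weight lam - int (k - 1) + int (r - 1)"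
          using that by auto
        show ?thesis unfolding e by (rule comm[symmetric])
      qed
      ultimately show ?thesis by (simp only: if_False if_True split: if_split) simp
    qed
    have peel_L: "peel k (elem (int r) * qWhit q lam) =
        (\<Sum>kap\<in>parts_of (weight lam - int k). mconst (t kap) * (elem (int r) * qWhit q kap)) +
        (if r = 0 \<or> k = 0 then 0 else \<Sum>kap\<in>parts_of (weight lam - int (k - 1)). mconst (t kap) * (elem (int (r - 1)) * qWhit q kap))"
      by (auto simp: peel_elem_mult peel_qWhit lam elem_neg t_def sum_distrib_left of_nat_diff ac_simps)
    have "peel k (X i) = (\<Sum>kap\<in>parts_of (weight lam - int k). mconst (t kap) * X (r, kap)) +
        (if r = 0 \<or> k = 0 then 0 else \<Sum>kap\<in>parts_of (weight lam - int (k - 1)). mconst (t kap) * X (r - 1, kap))"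
      unfolding X_def i prod.case peel_diff peel_R peel_L
      by (auto simp: right_diff_distrib sum_subtractf)
    moreover have "mcoeff (X (r', kap)) M = 0" if "kap \<in> parts_of m" for r' kap m
      using that by (intro IH) (auto simp: parts_of_def)
    ultimately show "mcoeff (peel k (X i)) M = 0"
      by (simp del: mcoeff_peel)
  qed (use assms in simp)
  then show ?thesis by (simp add: X_def R_def)
qed

text \<open>
  Multiplying by \<open>e_r\<close> and summing with signs multiplies either side by \<open>q\<^sup>n\<close>: on the left by
  \<open>elem_cplt_alternating\<close>, on the right by \<open>vstrip_strip_up\<close>. By induction the terms with \<open>r > 0\<close> agree, so the
  difference \<open>X\<close> of the two sides satisfies \<open>q\<^sup>n X = X\<close>.
\<close>

theorem cplt_Pieri:
  assumes "lam \<in> parts"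
  shows "cplt q (int n) * qWhit q lam =
    (\<Sum>mu\<in>parts_of (weight lam + int n). mconst (norm_wt q lam * strip_wt q lam mu) * qWhit q mu)"
  using assms
proof (induction n arbitrary: lam rule: less_induct)
  case (less n)
  define R where "R n lam = (\<Sum>mu\<in>parts_of (weight lam + int n). mconst (norm_wt q lam * strip_wt q lam mu) * qWhit q mu)" for n lam
  note lam = less.prems
  show ?case
  proof (cases "n = 0")
    case True
    have "(\<Sum>mu\<in>parts_of (weight lam). mconst (norm_wt q lam * strip_wt q lam mu) * qWhit q mu) =
        (\<Sum>mu\<in>{lam}. mconst (norm_wt q lam * strip_wt q lam mu) * qWhit q mu)"
    proof (rule sum.mono_neutral_right)
      show "\<forall>mu\<in>parts_of (weight lam) - {lam}. mconst (norm_wt q lam * strip_wt q lam mu) * qWhit q mu = 0"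
      proof
        fix mu assume "mu \<in> parts_of (weight lam) - {lam}"
        then have "strip_wt q lam mu = 0"
          using strip_wt_nonzero_weight(2)[of lam mu] lam by (auto simp: parts_of_def)
        then show "mconst (norm_wt q lam * strip_wt q lam mu) * qWhit q mu = 0" by simp
      qed
    qed (auto simp: finite_parts_of parts_of_weight lam)
    then show ?thesis using True by (simp add: cplt_0 strip_wt_self lam)
  next
    case False
    define T where "T r = (\<Sum>kap\<in>parts_of (weight lam + int r). mconst (vstrip_wt q lam kap) * (cplt q (int (n - r)) * qWhit q kap))" for r
    define U where "U r = (\<Sum>kap\<in>parts_of (weight lam + int r). mconst (vstrip_wt q lam kap) * R (n - r) kap)" for r
    have T: "(\<Sum>r\<le>n. mconst ((-1) ^ r) * T r) = mconst (q ^ n) * (cplt q (int n) * qWhit q lam)"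
    proof -
      have "T r = elem (int r) * cplt q (int n - int r) * qWhit q lam" if "r \<le> n" for r
      proof -
        have "T r = cplt q (int (n - r)) * (elem (int r) * qWhit q lam)"
          unfolding T_def elem_Pieri[OF lam] sum_distrib_left by (simp add: ac_simps)
        then show ?thesis using that by (simp add: of_nat_diff ac_simps)
      qed
      then have "(\<Sum>r\<le>n. mconst ((-1) ^ r) * T r) =
          (\<Sum>r\<le>n. mconst ((-1) ^ r) * (elem (int r) * cplt q (int n - int r))) * qWhit q lam"
        by (simp add: sum_distrib_right mult.assoc)
      also have "\<dots> = mconst (q ^ n) * cplt q (int n) * qWhit q lam"
        using elem_cplt_alternating[of "int n" n] by simp
      finally show ?thesis by (simp add: mult.assoc)
    qed
    have U: "(\<Sum>r\<le>n. mconst ((-1) ^ r) * U r) = mconst (q ^ n) * R n lam"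
    proof -
      define K where "K r mu = (\<Sum>kap\<in>parts_of (weight lam + int r).
          vstrip_wt q lam kap * (norm_wt q kap * strip_wt q kap mu))" for r mu
      have "U r = (\<Sum>mu\<in>parts_of (weight lam + int n). mconst (K r mu) * qWhit q mu)" if "r \<le> n" for r
      proof -
        have "R (n - r) kap = (\<Sum>mu\<in>parts_of (weight lam + int n). mconst (norm_wt q kap * strip_wt q kap mu) * qWhit q mu)"
          if "kap \<in> parts_of (weight lam + int r)" for kap
          using that \<open>r \<le> n\<close> by (simp add: R_def parts_of_def of_nat_diff)
        then show ?thesis by (simp add: U_def K_def nested_combination)
      qed
      then have "(\<Sum>r\<le>n. mconst ((-1) ^ r) * U r) =
          (\<Sum>r\<le>n. mconst ((-1) ^ r) * (\<Sum>mu\<in>parts_of (weight lam + int n). mconst (K r mu) * qWhit q mu))"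
        by simp
      also have "\<dots> = (\<Sum>mu\<in>parts_of (weight lam + int n). mconst (\<Sum>r\<le>n. (-1) ^ r * K r mu) * qWhit q mu)"
        by (rule nested_combination)
      also have "\<dots> = (\<Sum>mu\<in>parts_of (weight lam + int n).
          mconst (q ^ n * (norm_wt q lam * strip_wt q lam mu)) * qWhit q mu)"
        unfolding K_def by (intro sum.cong refl) (simp only: vstrip_strip_up[OF lam parts_ofD])
      finally show ?thesis by (simp add: R_def sum_distrib_left mconst_mult mult.assoc)
    qed
    have eq: "T r = U r" if "0 < r" for r
    proof -
      have "cplt q (int (n - r)) * qWhit q kap = R (n - r) kap" if "kap \<in> parts_of (weight lam + int r)" for kap
        unfolding R_def using that False \<open>0 < r\<close> by (intro less.IH) (auto simp: parts_of_def)
      then show ?thesis by (simp add: T_def U_def)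
    qed
    have "mconst (q ^ n) * (cplt q (int n) * qWhit q lam) - mconst (q ^ n) * R n lam =
        (\<Sum>r\<le>n. mconst ((-1) ^ r) * (T r - U r))"
      by (simp add: T[symmetric] U[symmetric] right_diff_distrib sum_subtractf)
    also have "\<dots> = (\<Sum>r\<in>{0}. mconst ((-1) ^ r) * (T r - U r))"
      by (rule sum.mono_neutral_right) (auto simp: eq)
    also have "\<dots> = cplt q (int n) * qWhit q lam - R n lam"
      by (simp add: T_def U_def vstrip_combination_same_weight[OF lam])
    finally have "mconst (q ^ n - 1) * (cplt q (int n) * qWhit q lam - R n lam) = 0"
      by (simp add: mconst_diff algebra_simps)
    moreover have "q ^ n - 1 \<noteq> 0" using one_minus_power_nonzero[of n] False by auto
    ultimately have "cplt q (int n) * qWhit q lam - R n lam = 0"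
      using mconst_mult_eq_0 by blast
    then show ?thesis by (simp add: R_def)
  qed
qed

end

section \<open>Power sums and their adjoints\<close>

definition psum_mset :: "nat multiset \<Rightarrow> complex mfps" where
  "psum_mset A = (\<Prod>n\<in>#A. power_sum n)"

lemma psum_mset_empty [simp]: "psum_mset {#} = 1"
  and psum_mset_add [simp]: "psum_mset (add_mset n A) = power_sum n * psum_mset A"
  by (simp_all add: psum_mset_def)

inductive_set lspan :: "complex mfps set \<Rightarrow> complex mfps set" for G where
  lspan_0: "0 \<in> lspan G"
| lspan_step: "g \<in> G \<Longrightarrow> f \<in> lspan G \<Longrightarrow> mconst c * g + f \<in> lspan G"

lemma lspan_add: "f \<in> lspan G \<Longrightarrow> h \<in> lspan G \<Longrightarrow> f + h \<in> lspan G"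
  by (induction f rule: lspan.induct) (auto simp: add.assoc intro: lspan.intros)

lemma lspan_mconst_mult: "f \<in> lspan G \<Longrightarrow> mconst c * f \<in> lspan G"
proof (induction f rule: lspan.induct)
  case (lspan_step g f d)
  then show ?case using lspan.lspan_step[of g G "mconst c * f" "c * d"]
    by (simp add: mconst_mult algebra_simps)
qed (simp add: lspan_0)

lemma lspan_base: "g \<in> G \<Longrightarrow> g \<in> lspan G"
  using lspan_step[OF _ lspan_0, of g G 1] by simp

lemma lspan_diff: "f \<in> lspan G \<Longrightarrow> h \<in> lspan G \<Longrightarrow> f - h \<in> lspan G"
  using lspan_add[of f G "mconst (-1) * h"] lspan_mconst_mult[of h G "-1"] by (simp add: mconst_uminus)

lemma lspan_sum: "(\<And>i. i \<in> S \<Longrightarrow> f i \<in> lspan G) \<Longrightarrow> (\<Sum>i\<in>S. f i) \<in> lspan G"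
  by (induction S rule: infinite_finite_induct) (auto intro: lspan_0 lspan_add)

abbreviation symspan :: "complex mfps set" where
  "symspan \<equiv> lspan (psum_mset ` {A. 0 \<notin># A})"

lemma symspan_induct [consumes 1, case_names zero step]:
  assumes "f \<in> symspan" and "Q 0"
    and "\<And>A f c. 0 \<notin># A \<Longrightarrow> f \<in> symspan \<Longrightarrow> Q f \<Longrightarrow> Q (mconst c * psum_mset A + f)"
  shows "Q f"
  using assms(1) by (induction f rule: lspan.induct) (use assms(2,3) in auto)

lemma symspan_psum: "0 \<notin># A \<Longrightarrow> psum_mset A \<in> symspan"
  by (intro lspan_base) simp

lemma symspan_1: "1 \<in> symspan"
  using symspan_psum[of "{#}"] by simp

lemma symspan_power_sum_mult:
  assumes "0 < n" shows "f \<in> symspan \<Longrightarrow> power_sum n * f \<in> symspan"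
proof (induction f rule: symspan_induct)
  case (step A f c)
  then have "mconst c * psum_mset (add_mset n A) + power_sum n * f \<in> symspan"
    using assms by (intro lspan_step imageI) auto
  then show ?case by (simp add: algebra_simps)
qed (simp add: lspan_0)

lemma symspan_psum_mult: "0 \<notin># A \<Longrightarrow> f \<in> symspan \<Longrightarrow> psum_mset A * f \<in> symspan"
  by (induction A) (auto simp: mult.assoc intro: symspan_power_sum_mult)

lemma symspan_mult: "f \<in> symspan \<Longrightarrow> g \<in> symspan \<Longrightarrow> f * g \<in> symspan"
proof (induction f rule: symspan_induct)
  case (step A f c)
  then show ?case
    by (auto simp: distrib_right mult.assoc intro!: lspan_add lspan_mconst_mult symspan_psum_mult)
qed (simp add: lspan_0)

lemma peel_psum_symspan: "0 \<notin># A \<Longrightarrow> peel k (psum_mset A) \<in> symspan"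
proof (induction A arbitrary: k)
  case empty
  then show ?case by (simp add: peel_1 lspan_0 symspan_1)
next
  case (add n A)
  then show ?case
    by (auto simp: peel_power_sum_mult intro!: lspan_add symspan_power_sum_mult lspan_0)
qed

lemma peel_symspan: "f \<in> symspan \<Longrightarrow> peel k f \<in> symspan"
  by (induction f rule: symspan_induct)
     (auto simp: peel_add peel_mconst_mult intro: lspan_0 lspan_add lspan_mconst_mult peel_psum_symspan)

text \<open>
  Peeling preserves the span of the power sums and is compatible with products, so it acts on power sums by
  \<open>p_n \<mapsto> p_n + y\<^sup>n\<close>.
\<close>

lemma peel_0_symspan: "f \<in> symspan \<Longrightarrow> peel 0 f = f"
proof (induction f rule: symspan_induct)
  case (step A f c)
  have "peel 0 (psum_mset A) = psum_mset A"
    using step(1) by (induction A) (auto simp: peel_1 peel_power_sum_mult)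
  then show ?case using step by (simp add: peel_add peel_mconst_mult)
qed simp

text \<open>
  The operator \<open>n \<partial>/\<partial>p_n\<close>. Since peeling is the Taylor shift \<open>exp(\<Sum>\<^sub>n y\<^sup>n \<partial>/\<partial>p_n)\<close>, the logarithmic
  derivative in \<open>y\<close> expresses \<open>n \<partial>/\<partial>p_n\<close> through peeling. Taking this as the definition makes the operator
  available on all series, before the power sums are known to be linearly independent.
\<close>

fun psum_deriv :: "nat \<Rightarrow> complex mfps \<Rightarrow> complex mfps" where
  "psum_deriv n f = mconst (of_nat n) * peel n f - (\<Sum>k\<in>{1..<n}. peel (n - k) (psum_deriv k f))"

declare psum_deriv.simps [simp del]

lemma psum_deriv_add: "psum_deriv n (f + g) = psum_deriv n f + psum_deriv n g"
  by (induction n rule: less_induct)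
     (subst (1 2 3) psum_deriv.simps, simp add: peel_add sum.distrib algebra_simps)

lemma psum_deriv_mconst_mult: "psum_deriv n (mconst c * f) = mconst c * psum_deriv n f"
  by (induction n rule: less_induct)
     (subst (1 2) psum_deriv.simps, simp add: peel_mconst_mult, simp add: sum_distrib_left algebra_simps)

lemma psum_deriv_0 [simp]: "psum_deriv n 0 = 0"
  using psum_deriv_mconst_mult[of n 0 0] by simp

lemma psum_deriv_1: "psum_deriv n 1 = 0"
  by (induction n rule: less_induct) (subst psum_deriv.simps, simp add: peel_1)

lemma psum_deriv_symspan: "f \<in> symspan \<Longrightarrow> psum_deriv n f \<in> symspan"
  by (induction n rule: less_induct)
     (subst psum_deriv.simps, auto intro!: lspan_diff lspan_mconst_mult lspan_sum peel_symspan)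

lemma sum_peel_psum_deriv:
  assumes "f \<in> symspan" "0 < n"
  shows "(\<Sum>k\<in>{1..n}. peel (n - k) (psum_deriv k f)) = mconst (of_nat n) * peel n f"
proof -
  have "{1..n} = insert n {1..<n}" using assms(2) by auto
  then have "(\<Sum>k\<in>{1..n}. peel (n - k) (psum_deriv k f)) =
      peel 0 (psum_deriv n f) + (\<Sum>k\<in>{1..<n}. peel (n - k) (psum_deriv k f))" by simp
  also have "peel 0 (psum_deriv n f) = psum_deriv n f"
    by (intro peel_0_symspan psum_deriv_symspan assms)
  finally show ?thesis by (subst (asm) psum_deriv.simps) simp
qed

text \<open>
  The Leibniz rule for multiplication by a power sum. In the sum defining \<open>psum_deriv n\<close> the product rule
  produces a second copy of the same kind of sum for \<open>n - m\<close>, which is evaluated by \<open>sum_peel_psum_deriv\<close>.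
\<close>

lemma psum_deriv_power_sum_mult:
  assumes f: "f \<in> symspan" and m: "0 < m"
  shows "0 < n \<Longrightarrow> psum_deriv n (power_sum m * f) =
    power_sum m * psum_deriv n f + (if n = m then mconst (of_nat n) * f else 0)"
proof (induction n rule: less_induct)
  case (less n)
  define Y where "Y = (\<Sum>k\<in>{1..<n}. peel (n - k) (psum_deriv k f))"
  define Z where "Z = (\<Sum>k\<in>{1..<n}. if m \<le> n - k then peel (n - k - m) (psum_deriv k f) else 0)"
  have "(\<Sum>k\<in>{1..<n}. peel (n - k) (psum_deriv k (power_sum m * f))) =
      (\<Sum>k\<in>{1..<n}. power_sum m * peel (n - k) (psum_deriv k f) +
        (if m \<le> n - k then peel (n - k - m) (psum_deriv k f) else 0) +
        (if k = m then mconst (of_nat m) * peel (n - m) f else 0))"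
  proof (intro sum.cong refl)
    fix k assume "k \<in> {1..<n}"
    then show "peel (n - k) (psum_deriv k (power_sum m * f)) =
      power_sum m * peel (n - k) (psum_deriv k f) +
        (if m \<le> n - k then peel (n - k - m) (psum_deriv k f) else 0) +
        (if k = m then mconst (of_nat m) * peel (n - m) f else 0)"
      using m by (auto simp: less.IH peel_add peel_power_sum_mult peel_mconst_mult)
  qed
  also have "\<dots> = power_sum m * Y + Z + (if m < n then mconst (of_nat m) * peel (n - m) f else 0)"
    using m by (simp add: sum.distrib Y_def Z_def sum_distrib_left)
  finally have S: "(\<Sum>k\<in>{1..<n}. peel (n - k) (psum_deriv k (power_sum m * f))) = \<dots>" .
  have Z: "Z = (if m < n then mconst (of_nat (n - m)) * peel (n - m) f else 0)"
  proof (cases "m < n")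
    case True
    have "Z = (\<Sum>k\<in>{1..n - m}. peel (n - m - k) (psum_deriv k f))"
      unfolding Z_def using m
      by (intro sum.mono_neutral_cong_right) (auto simp: add.commute)
    then show ?thesis using True sum_peel_psum_deriv[OF f, of "n - m"] by simp
  next
    case False
    then have "Z = 0" unfolding Z_def using m by (intro sum.neutral) auto
    then show ?thesis using False by simp
  qed
  have "psum_deriv n (power_sum m * f) = mconst (of_nat n) * peel n (power_sum m * f) -
      (power_sum m * Y + Z + (if m < n then mconst (of_nat m) * peel (n - m) f else 0))"
    by (subst psum_deriv.simps) (simp only: S)
  also have "\<dots> = power_sum m * (mconst (of_nat n) * peel n f - Y) +
      ((if m \<le> n then mconst (of_nat n) * peel (n - m) f else 0) -
       (Z + (if m < n then mconst (of_nat m) * peel (n - m) f else 0)))"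
    unfolding peel_power_sum_mult[OF m] by (simp add: algebra_simps)
  also have "mconst (of_nat n) * peel n f - Y = psum_deriv n f"
    by (simp add: psum_deriv.simps[of n] Y_def)
  also have "(if m \<le> n then mconst (of_nat n) * peel (n - m) f else 0) -
       (Z + (if m < n then mconst (of_nat m) * peel (n - m) f else 0)) =
      (if n = m then mconst (of_nat n) * f else 0)"
    by (auto simp: Z peel_0_symspan[OF f] of_nat_diff mconst_diff algebra_simps)
  finally show ?case .
qed

lemma psum_deriv_psum_mset:
  assumes "0 \<notin># A" "0 < n"
  shows "psum_deriv n (psum_mset A) = mconst (of_nat (n * count A n)) * psum_mset (A - {#n#})"
  using assms(1)
proof (induction A)
  case (add m A)
  then have "psum_deriv n (psum_mset (add_mset m A)) =
      power_sum m * psum_deriv n (psum_mset A) + (if n = m then mconst (of_nat n) * psum_mset A else 0)"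
    using psum_deriv_power_sum_mult[OF symspan_psum, of A m n] assms(2) by auto
  also have "\<dots> = mconst (of_nat (n * count A n)) * (power_sum m * psum_mset (A - {#n#})) +
      (if n = m then mconst (of_nat n) * psum_mset A else 0)"
    using add by (simp add: algebra_simps)
  also have "mconst (of_nat (n * count A n)) * (power_sum m * psum_mset (A - {#n#})) =
      mconst (of_nat (n * count A n)) * psum_mset (add_mset m A - {#n#})"
  proof (cases "n \<in># A")
    case True
    then have "add_mset m A - {#n#} = add_mset m (A - {#n#})"
      by (auto simp: diff_union_swap2 multi_drop_mem_not_eq)
    then show ?thesis by simp
  next
    case False
    then have "count A n = 0" by (simp add: not_in_iff)
    then show ?thesis by simp
  qed
  finally show ?case
    by (auto simp: mconst_add algebra_simps)
qed (simp add: psum_deriv_1)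

text \<open>
  These functionals pick out the coefficient of a product of power sums, up to the factor \<open>zfac\<close>. They prove
  linear independence of these products, and the Macdonald form is a combination of them.
\<close>

primrec apolar :: "nat list \<Rightarrow> complex mfps \<Rightarrow> complex" where
  "apolar [] f = mcoeff f {#}"
| "apolar (k # ks) f = apolar ks (psum_deriv k f)"

definition zfac :: "nat multiset \<Rightarrow> nat" where
  "zfac A = (\<Prod>n\<in>set_mset A. n ^ count A n * fact (count A n))"

lemma apolar_add: "apolar ks (f + g) = apolar ks f + apolar ks g"
  by (induction ks arbitrary: f g) (simp_all add: psum_deriv_add)

lemma apolar_mconst_mult: "apolar ks (mconst c * f) = c * apolar ks f"
  by (induction ks arbitrary: f) (simp_all add: psum_deriv_mconst_mult)

lemma apolar_0: "apolar ks 0 = 0"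
  by (induction ks) simp_all

lemma zfac_add: "zfac (add_mset k A) = k * Suc (count A k) * zfac A"
proof -
  let ?h = "\<lambda>A n. n ^ count A n * fact (count A n) :: nat"
  have "zfac A = (\<Prod>n\<in>insert k (set_mset A). ?h A n)" for A
    unfolding zfac_def by (rule prod.mono_neutral_left) (auto simp: not_in_iff)
  then have A: "zfac A = ?h A k * (\<Prod>n\<in>set_mset A - {k}. ?h A n)" for A
    by (simp add: prod.insert_remove)
  have "(\<Prod>n\<in>set_mset (add_mset k A) - {k}. ?h (add_mset k A) n) = (\<Prod>n\<in>set_mset A - {k}. ?h A n)"
    by (intro prod.cong) auto
  then show ?thesis by (simp add: A[of "add_mset k A"] A[of A] algebra_simps)
qed

lemma zfac_nonzero: "0 \<notin># A \<Longrightarrow> zfac A \<noteq> 0"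
  by (auto simp: zfac_def)

lemma mcoeff_psum_mset_empty: "0 \<notin># A \<Longrightarrow> mcoeff (psum_mset A) {#} = (if A = {#} then 1 else 0)"
  by (cases A) (auto simp: mcoeff_1 mcoeff_mult_empty mcoeff_power_sum_empty)

lemma apolar_psum_mset:
  assumes "0 \<notin># A" "0 \<notin> set ks"
  shows "apolar ks (psum_mset A) = (if mset ks = A then of_nat (zfac A) else 0)"
  using assms
proof (induction ks arbitrary: A)
  case Nil
  then show ?case by (auto simp: mcoeff_psum_mset_empty zfac_def)
next
  case (Cons k ks)
  have "apolar (k # ks) (psum_mset A) = of_nat (k * count A k) * apolar ks (psum_mset (A - {#k#}))"
    using Cons.prems by (simp add: psum_deriv_psum_mset apolar_mconst_mult)
  also have "apolar ks (psum_mset (A - {#k#})) = (if mset ks = A - {#k#} then of_nat (zfac (A - {#k#})) else 0)"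
    using Cons.prems by (intro Cons.IH) (auto dest: in_diffD)
  finally have *: "apolar (k # ks) (psum_mset A) =
      of_nat (k * count A k) * (if mset ks = A - {#k#} then of_nat (zfac (A - {#k#})) else 0)" .
  show ?case
  proof (cases "k \<in># A")
    case True
    then obtain B where B: "A = add_mset k B" by (meson multi_member_split)
    then show ?thesis using * by (simp add: zfac_add algebra_simps)
  next
    case False
    then have "count A k = 0" "mset (k # ks) \<noteq> A" by (auto simp: not_in_iff)
    then show ?thesis using * by simp
  qed
qed

lemma apolar_mset_cong:
  assumes "f \<in> symspan" "mset ks = mset ks'" "0 \<notin> set ks"
  shows "apolar ks f = apolar ks' f"
proof -
  have "0 \<notin> set ks'" using assms(2,3) by (metis set_mset_mset)
  with assms(1) show ?thesis
    by (induction f rule: symspan_induct)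
       (simp_all add: apolar_0 apolar_add apolar_mconst_mult apolar_psum_mset assms)
qed

context nome
begin

text \<open>
  Let \<open>c(w) = \<Sum> w\<^sup>n / (q)\<^sub>n\<close>. The identity states \<open>w c'(w) = c(w) \<Sum>\<^sub>k w\<^sup>k / (1 - q\<^sup>k)\<close>, the logarithmic
  derivative of \<open>c(w) = 1 / (w; q)\<^sub>\<infinity>\<close>. In coefficients it is an induction based on
  \<open>1 - q\<^sup>n = (1 - q\<^sup>n\<^sup>-\<^sup>k) + q\<^sup>n\<^sup>-\<^sup>k (1 - q\<^sup>k)\<close> and a telescoping sum.
\<close>

lemma iqf_log_deriv:
  "of_nat n * iqf q (int n) = (\<Sum>k\<in>{1..n}. 1 / (1 - q ^ k) * iqf q (int n - int k))"
proof (induction n)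
  case (Suc n)
  let ?N = "Suc n"
  have step: "(1 - q ^ m) * iqf q (int m) = iqf q (int m - 1)" for m
    using iqf_diff_one[of "int m"] by simp
  have tele: "(\<Sum>k\<in>{1..m}. q ^ (m - k) * iqf q (int m - int k)) = iqf q (int m - 1)" for m
  proof (induction m)
    case (Suc m)
    have "(\<Sum>k\<in>{1..Suc m}. q ^ (Suc m - k) * iqf q (int (Suc m) - int k)) =
        q ^ m * iqf q (int m) + (\<Sum>k\<in>{2..Suc m}. q ^ (Suc m - k) * iqf q (int (Suc m) - int k))"
    proof -
      have "{1..Suc m} = insert 1 {2..Suc m}" by auto
      then show ?thesis by simp
    qed
    also have "(\<Sum>k\<in>{2..Suc m}. q ^ (Suc m - k) * iqf q (int (Suc m) - int k)) =
        (\<Sum>k\<in>{1..m}. q ^ (m - k) * iqf q (int m - int k))"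
      by (rule sum.reindex_bij_witness[of _ Suc "\<lambda>k. k - 1"]) (auto simp: algebra_simps)
    finally show ?case using Suc step[of m] by (simp add: algebra_simps)
  qed (simp add: iqf_neg)
  have "(1 - q ^ ?N) * (\<Sum>k\<in>{1..?N}. 1 / (1 - q ^ k) * iqf q (int ?N - int k)) =
      (\<Sum>k\<in>{1..?N}. 1 / (1 - q ^ k) * iqf q (int n - int k) + q ^ (?N - k) * iqf q (int ?N - int k))"
    unfolding sum_distrib_left
  proof (intro sum.cong refl)
    fix k assume k: "k \<in> {1..?N}"
    have nz: "1 - q ^ k \<noteq> 0" using one_minus_power_nonzero k by simp
    have "1 - q ^ ?N = (1 - q ^ (?N - k)) + q ^ (?N - k) * (1 - q ^ k)"
      using k by (simp add: algebra_simps flip: power_add)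
    then have "(1 - q ^ ?N) * (1 / (1 - q ^ k) * iqf q (int ?N - int k)) =
        1 / (1 - q ^ k) * ((1 - q ^ (?N - k)) * iqf q (int ?N - int k)) + q ^ (?N - k) * iqf q (int ?N - int k)"
      using nz by (simp add: field_simps)
    also have "(1 - q ^ (?N - k)) * iqf q (int ?N - int k) = iqf q (int n - int k)"
      using step[of "?N - k"] k by (simp add: of_nat_diff algebra_simps)
    finally show "(1 - q ^ ?N) * (1 / (1 - q ^ k) * iqf q (int ?N - int k)) =
        1 / (1 - q ^ k) * iqf q (int n - int k) + q ^ (?N - k) * iqf q (int ?N - int k)" .
  qed
  also have "\<dots> = of_nat n * iqf q (int n) + iqf q (int n)"
    unfolding sum.distrib tele by (simp add: Suc.IH iqf_neg)
  also have "\<dots> = of_nat ?N * ((1 - q ^ ?N) * iqf q (int ?N))"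
    unfolding step by (simp add: algebra_simps)
  finally have "(1 - q ^ ?N) * (\<Sum>k\<in>{1..?N}. 1 / (1 - q ^ k) * iqf q (int ?N - int k)) =
      (1 - q ^ ?N) * (of_nat ?N * iqf q (int ?N))" by (simp add: algebra_simps)
  then show ?case using one_minus_power_nonzero[of ?N] by (metis mult_left_cancel zero_less_Suc)
qed simp

text \<open>
  Newton's identities for \<open>G(z) = exp(\<Sum>\<^sub>k p_k z\<^sup>k / (k (1 - q\<^sup>k)))\<close>. After peeling they reduce to the one-variable
  identity \<open>iqf_log_deriv\<close>.
\<close>

lemma cplt_Newton:
  "mconst (of_nat n) * cplt q (int n) =
    (\<Sum>k\<in>{1..n}. mconst (1 / (1 - q ^ k)) * (power_sum k * cplt q (int n - int k)))"
proof -
  define N where "N = n"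
  define S where "S n = (\<Sum>k\<in>{1..N}. mconst (1 / (1 - q ^ k)) * (power_sum k * cplt q (n - int k)))" for n
  define X where "X = (\<lambda>n. mconst (of_int n) * cplt q n - S n)"
  have peel_S: "peel j (S n) = mconst (iqf q (int j)) * S (n - int j) + mconst (of_nat j * iqf q (int j)) * cplt q (n - int j)"
    if "n \<le> int N" for n j
  proof -
    have "peel j (S n) = (\<Sum>k\<in>{1..N}. mconst (iqf q (int j)) * (mconst (1 / (1 - q ^ k)) * (power_sum k * cplt q (n - int j - int k))) +
        mconst (if k \<le> j then 1 / (1 - q ^ k) * iqf q (int j - int k) else 0) * cplt q (n - int j))"
      unfolding S_def peel_sum
    proof (intro sum.cong refl)
      fix k assume k: "k \<in> {1..N}"
      have "peel j (mconst (1 / (1 - q ^ k)) * (power_sum k * cplt q (n - int k))) =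
         mconst (1 / (1 - q ^ k)) * (power_sum k * peel j (cplt q (n - int k)) + (if k \<le> j then peel (j - k) (cplt q (n - int k)) else 0))"
        using k by (simp add: peel_mconst_mult peel_power_sum_mult)
      moreover have "n - int k - int (j - k) = n - int j" "int (j - k) = int j - int k" if "k \<le> j"
        using that by auto
      ultimately show "peel j (mconst (1 / (1 - q ^ k)) * (power_sum k * cplt q (n - int k))) =
        mconst (iqf q (int j)) * (mconst (1 / (1 - q ^ k)) * (power_sum k * cplt q (n - int j - int k))) +
        mconst (if k \<le> j then 1 / (1 - q ^ k) * iqf q (int j - int k) else 0) * cplt q (n - int j)"
        by (auto simp: peel_cplt mconst_mult divide_inverse algebra_simps)
    qed
    also have "\<dots> = mconst (iqf q (int j)) * S (n - int j) +
        mconst (\<Sum>k\<in>{1..N}. if k \<le> j then 1 / (1 - q ^ k) * iqf q (int j - int k) else 0) * cplt q (n - int j)"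
      unfolding S_def sum.distrib sum_distrib_left mconst_sum sum_distrib_right by simp
    also have "mconst (\<Sum>k\<in>{1..N}. if k \<le> j then 1 / (1 - q ^ k) * iqf q (int j - int k) else 0) * cplt q (n - int j) =
        mconst (of_nat j * iqf q (int j)) * cplt q (n - int j)"
    proof (cases "int j \<le> n")
      case True
      then have "j \<le> N" using that by simp
      then have "(\<Sum>k\<in>{1..N}. if k \<le> j then 1 / (1 - q ^ k) * iqf q (int j - int k) else 0) =
          (\<Sum>k\<in>{1..j}. 1 / (1 - q ^ k) * iqf q (int j - int k))"
        by (intro sum.mono_neutral_cong_right) auto
      then show ?thesis by (simp only: iqf_log_deriv)
    qed (simp add: cplt_neg)
    finally show ?thesis .
  qed
  have "X (int n) = 0"
  proof (rule peel_family_eq_0[where X = X and I = "{..int N}"])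
    fix n assume "n \<in> {..int N}"
    have "mcoeff (S n) {#} = 0"
      unfolding S_def mcoeff_sum by (intro sum.neutral) (simp add: mcoeff_mult_empty mcoeff_power_sum_empty)
    then show "mcoeff (X n) {#} = 0" by (simp add: X_def mcoeff_cplt_empty)
  next
    fix n and j :: nat and M assume n: "n \<in> {..int N}" and IH: "\<And>j. j \<in> {..int N} \<Longrightarrow> mcoeff (X j) M = 0"
    have "peel j (X n) = mconst (iqf q (int j)) * X (n - int j)"
      using n by (simp add: X_def peel_diff peel_mconst_mult peel_cplt peel_S)
         (simp add: mconst_diff mconst_mult algebra_simps)
    moreover have "mcoeff (X (n - int j)) M = 0" using n by (intro IH) auto
    ultimately show "mcoeff (peel j (X n)) M = 0" by (simp only: mcoeff_mconst_mult) simp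
  qed (simp add: N_def)
  then show ?thesis by (simp add: X_def S_def N_def)
qed

lemma cplt_symspan: "cplt q n \<in> symspan"
proof (cases "n < 0")
  case True
  then show ?thesis by (simp add: cplt_neg lspan_0)
next
  case False
  have "cplt q (int n) \<in> symspan" for n
  proof (induction n rule: less_induct)
    case (less n)
    show ?case
    proof (cases "n = 0")
      case True
      then show ?thesis by (simp add: cplt_0 symspan_1)
    next
      case False
      have "(\<Sum>k\<in>{1..n}. mconst (1 / (1 - q ^ k)) * (power_sum k * cplt q (int n - int k))) \<in> symspan"
      proof (intro lspan_sum lspan_mconst_mult symspan_power_sum_mult)
        fix k assume k: "k \<in> {1..n}"
        then have "cplt q (int (n - k)) \<in> symspan" by (intro less.IH) auto
        then show "cplt q (int n - int k) \<in> symspan" using k by (simp add: of_nat_diff)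
      qed auto
      then have "mconst (1 / of_nat n) * (mconst (of_nat n) * cplt q (int n)) \<in> symspan"
        unfolding cplt_Newton by (rule lspan_mconst_mult)
      then show ?thesis using False by (simp flip: mconst_mult mult.assoc)
    qed
  qed
  from this[of "nat n"] show ?thesis using False by simp
qed

end

section \<open>Exponent sequences and partitions\<close>

definition nonzero_values :: "(nat \<Rightarrow> nat) \<Rightarrow> nat multiset" where
  "nonzero_values f = image_mset f (mset_set {i. f i \<noteq> 0})"

lemma zero_notin_nonzero_values: "0 \<notin># nonzero_values f"
  by (cases "finite {i. f i \<noteq> 0}") (auto simp: nonzero_values_def)

lemma nonzero_values_comp_bij:
  assumes "bij \<pi>" shows "nonzero_values (f \<circ> \<pi>) = nonzero_values f"
proof -
  have inj: "inj \<pi>" using assms by (simp add: bij_def)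
  have "\<pi> ` {i. f (\<pi> i) \<noteq> 0} = {i. f i \<noteq> 0}"
    using assms by (auto simp: image_iff bij_def)
  then have "image_mset \<pi> (mset_set {i. f (\<pi> i) \<noteq> 0}) = mset_set {i. f i \<noteq> 0}"
    using image_mset_mset_set[of \<pi> "{i. f (\<pi> i) \<noteq> 0}"] inj_on_subset[OF inj] by simp
  then show ?thesis
    by (simp add: nonzero_values_def multiset.map_comp[symmetric])
qed

lemma size_filter_nonzero_values:
  assumes "finite {i. f i \<noteq> 0}" "0 < t"
  shows "size (filter_mset (\<lambda>x. t \<le> x) (nonzero_values f)) = card {i. t \<le> f i}"
proof -
  have "{i. f i \<noteq> 0 \<and> t \<le> f i} = {i. t \<le> f i}" using assms(2) by auto
  then show ?thesis
    using assms(1) by (simp add: nonzero_values_def filter_mset_image_mset filter_mset_mset_set)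
qed

text \<open>
  A partition is recovered from the multiset of its parts by counting the parts that are at least \<open>t\<close>: these are
  an initial segment of the rows.
\<close>

lemma partition_ge_iff:
  assumes "is_partition lam" "0 < t"
  shows "t \<le> lam i \<longleftrightarrow> i < size (filter_mset (\<lambda>x. t \<le> x) (nonzero_values lam))"
proof -
  let ?D = "{i. t \<le> lam i}"
  have fin: "finite {i. lam i \<noteq> 0}" and anti: "antimono lam"
    using assms(1) by (auto simp: is_partition_def)
  have finD: "finite ?D" using assms(2) by (intro finite_subset[OF _ fin]) auto
  define n where "n = (LEAST n. n \<notin> ?D)"
  have "\<exists>n. n \<notin> ?D" using finD by (metis ex_new_if_finite infinite_UNIV_nat)
  then have n: "n \<notin> ?D" unfolding n_def by (rule LeastI_ex)
  have "?D = {..<n}"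
  proof (intro set_eqI iffI)
    fix i assume "i \<in> ?D"
    then show "i \<in> {..<n}" using n antimonoD[OF anti, of n i] by (auto simp: not_less[symmetric])
  next
    fix i assume "i \<in> {..<n}"
    then show "i \<in> ?D" unfolding n_def using not_less_Least by blast
  qed
  then have "card ?D = n" by simp
  then show ?thesis
    using \<open>?D = {..<n}\<close> by (auto simp: size_filter_nonzero_values[OF fin assms(2)])
qed

lemma partition_eqI:
  assumes "is_partition lam" "is_partition mu" "nonzero_values lam = nonzero_values mu"
  shows "lam = mu"
proof
  fix i
  have "t \<le> lam i \<longleftrightarrow> t \<le> mu i" if "0 < t" for t
    using partition_ge_iff[OF assms(1) that] partition_ge_iff[OF assms(2) that] assms(3) by simp
  then show "lam i = mu i"
    by (metis le_antisym le_refl neq0_conv zero_le)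
qed

lemma nonzero_values_list:
  assumes "\<And>i. n \<le> i \<Longrightarrow> f i = 0"
  shows "nonzero_values f = filter_mset (\<lambda>x. x \<noteq> 0) (mset (map f [0..<n]))"
proof -
  have "i < n" if "f i \<noteq> 0" for i using assms[of i] that by (cases "n \<le> i") auto
  then have "{i. f i \<noteq> 0} = {i\<in>{0..<n}. f i \<noteq> 0}" by auto
  then have "mset_set {i. f i \<noteq> 0} = filter_mset (\<lambda>i. f i \<noteq> 0) (mset [0..<n])"
    by (simp add: filter_mset_mset_set)
  then show ?thesis by (simp add: nonzero_values_def filter_mset_image_mset)
qed

lemma ex_partition_nonzero_values:
  assumes "0 \<notin># A"
  obtains lam where "is_partition lam" "nonzero_values lam = A"
proof -
  define xs where "xs = rev (sorted_list_of_multiset A)"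
  define lam where "lam i = (if i < length xs then xs ! i else 0)" for i
  have anti: "antimono lam"
  proof (rule antimonoI)
    fix i j :: nat assume "i \<le> j"
    then show "lam j \<le> lam i"
      using sorted_rev_nth_mono[of xs i j] by (auto simp: lam_def xs_def sorted_sorted_list_of_multiset)
  qed
  have zero: "lam i = 0" if "length xs \<le> i" for i using that by (simp add: lam_def)
  have "finite {i. lam i \<noteq> 0}"
    by (rule finite_subset[of _ "{..<length xs}"]) (auto simp: lam_def)
  then have "is_partition lam" using anti by (simp add: is_partition_def)
  moreover have "nonzero_values lam = A"
  proof -
    have "map lam [0..<length xs] = xs" by (rule nth_equalityI) (auto simp: lam_def)
    then have "nonzero_values lam = filter_mset (\<lambda>x. x \<noteq> 0) (mset xs)"
      using nonzero_values_list[of "length xs" lam] zero by simp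
    also have "mset xs = A" by (simp add: xs_def)
    also have "filter_mset (\<lambda>x. x \<noteq> 0) A = A"
      using assms by (intro multiset_eqI) (auto simp: not_in_iff)
    finally show ?thesis .
  qed
  ultimately show ?thesis by (rule that)
qed

lemma split_zeros:
  "X = filter_mset (\<lambda>x. x \<noteq> 0) X + replicate_mset (size X - size (filter_mset (\<lambda>x. x \<noteq> 0) X)) (0::nat)"
proof (rule multiset_eqI)
  fix x
  have "size X = size (filter_mset (\<lambda>x. x \<noteq> 0) X) + count X 0"
    by (induction X) auto
  then show "count X x = count (filter_mset (\<lambda>x. x \<noteq> 0) X +
      replicate_mset (size X - size (filter_mset (\<lambda>x. x \<noteq> 0) X)) 0) x"
    by simp
qed

lemma rearrangement_bij:
  assumes "finite {i. f i \<noteq> 0}" "finite {i. g i \<noteq> 0}" "nonzero_values f = nonzero_values g"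
  obtains \<pi> where "bij \<pi>" "f = g \<circ> \<pi>"
proof -
  have "finite ({i. f i \<noteq> 0} \<union> {i. g i \<noteq> 0})" using assms(1,2) by simp
  then obtain n where n: "\<forall>i\<in>{i. f i \<noteq> 0} \<union> {i. g i \<noteq> 0}. i < n"
    unfolding finite_nat_set_iff_bounded by blast
  have f0: "f i = 0" if "n \<le> i" for i
  proof (rule ccontr)
    assume "f i \<noteq> 0"
    then have "i < n" using n by blast
    then show False using that by simp
  qed
  have g0: "g i = 0" if "n \<le> i" for i
  proof (rule ccontr)
    assume "g i \<noteq> 0"
    then have "i < n" using n by blast
    then show False using that by simp
  qed
  have split: "mset (map h [0..<n]) = nonzero_values h + replicate_mset (n - size (nonzero_values h)) 0"
    if "\<And>i. n \<le> i \<Longrightarrow> h i = 0" for h :: "nat \<Rightarrow> nat"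
    using split_zeros[of "mset (map h [0..<n])"]
    by (simp only: nonzero_values_list[of n h, OF that] size_mset length_map length_upt minus_nat.diff_0)
  have "mset (map f [0..<n]) = mset (map g [0..<n])"
    by (simp only: split[of f, OF f0] split[of g, OF g0] assms(3))
  then obtain p where p: "p permutes {..<length (map g [0..<n])}" "permute_list p (map g [0..<n]) = map f [0..<n]"
    by (rule mset_eq_permutation)
  have "f i = g (p i)" for i
  proof (cases "i < n")
    case True
    then have pi: "p i < n" using p(1) permutes_in_image[OF p(1), of i] by simp
    have "f i = permute_list p (map g [0..<n]) ! i" using True p(2) by simp
    also have "\<dots> = map g [0..<n] ! p i" using True by (intro permute_list_nth p(1)) simp
    also have "\<dots> = g (p i)" using pi by simp
    finally show ?thesis .
  next
    case False
    then have "p i = i" using p(1) by (simp add: permutes_not_in)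
    then show ?thesis using False f0 g0 by simp
  qed
  then show ?thesis using that[of p] permutes_bij[OF p(1)] by (auto simp: fun_eq_iff)
qed

section \<open>The Macdonald form at \<open>t = 0\<close>\<close>

lemma partition_finite: "is_partition lam \<Longrightarrow> finite {i. lam i \<noteq> 0}"
  by (simp add: is_partition_def)

lemma power_sum_part_eq:
  "is_partition lam \<Longrightarrow> power_sum_part lam = psum_mset (nonzero_values lam)"
  by (simp add: power_sum_part_def psum_mset_def nonzero_values_def partition_finite prod_unfold_prod_mset
      image_mset.compositionality o_def)

lemma count_nonzero_values:
  assumes "finite {i. f i \<noteq> 0}" "n \<noteq> 0"
  shows "count (nonzero_values f) n = card {i. f i = n}"
proof -
  have "count (nonzero_values f) n = size (filter_mset (\<lambda>x. x = n) (nonzero_values f))"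
    by (simp add: filter_eq_replicate_mset)
  also have "\<dots> = card {i. f i \<noteq> 0 \<and> f i = n}"
    using assms(1) by (simp add: nonzero_values_def filter_mset_image_mset filter_mset_mset_set)
  also have "{i. f i \<noteq> 0 \<and> f i = n} = {i. f i = n}" using assms(2) by auto
  finally show ?thesis .
qed

lemma z_part_eq:
  assumes "is_partition lam" shows "z_part lam = zfac (nonzero_values lam)"
proof -
  have "set_mset (nonzero_values lam) = range lam - {0}"
    using partition_finite[OF assms] by (auto simp: nonzero_values_def)
  then show ?thesis
    unfolding z_part_def zfac_def
    by (intro prod.cong)
       (auto simp: mult_part_def count_nonzero_values[OF partition_finite[OF assms]])
qed

definition psum_coord :: "complex mfps \<Rightarrow> (nat \<Rightarrow> nat) \<Rightarrow> complex" where
  "psum_coord f lam = (if is_partition lam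
     then apolar (sorted_list_of_multiset (nonzero_values lam)) f / of_nat (zfac (nonzero_values lam)) else 0)"

lemma psum_coord_add: "psum_coord (f + g) lam = psum_coord f lam + psum_coord g lam"
  by (simp add: psum_coord_def apolar_add add_divide_distrib)

lemma psum_coord_mconst_mult: "psum_coord (mconst c * f) lam = c * psum_coord f lam"
  by (simp add: psum_coord_def apolar_mconst_mult)

lemma psum_coord_0: "psum_coord 0 lam = 0"
  by (simp add: psum_coord_def apolar_0)

lemma psum_coord_psum:
  assumes "is_partition mu"
  shows "psum_coord (psum_mset (nonzero_values mu)) lam = (if lam = mu then 1 else 0)"
proof (cases "is_partition lam")
  case True
  have "0 \<notin> set (sorted_list_of_multiset (nonzero_values lam))"
    by (simp add: zero_notin_nonzero_values)
  then have "psum_coord (psum_mset (nonzero_values mu)) lam =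
      (if nonzero_values lam = nonzero_values mu then of_nat (zfac (nonzero_values mu)) else 0) /
      of_nat (zfac (nonzero_values lam))"
    using True by (simp add: psum_coord_def apolar_psum_mset zero_notin_nonzero_values)
  moreover have "nonzero_values lam = nonzero_values mu \<longleftrightarrow> lam = mu"
    using partition_eqI True assms by blast
  moreover have "zfac (nonzero_values mu) \<noteq> 0"
    by (simp add: zfac_nonzero zero_notin_nonzero_values)
  ultimately show ?thesis by simp
next
  case False
  then show ?thesis using assms by (auto simp: psum_coord_def)
qed

lemma psum_coord_expansion:
  assumes "f \<in> symspan"
  shows "finite {lam. psum_coord f lam \<noteq> 0} \<and>
    f = (\<Sum>lam | psum_coord f lam \<noteq> 0. mscale (psum_coord f lam) (power_sum_part lam))"
  using assms
proof (induction f rule: symspan_induct)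
  case zero
  then show ?case by (simp add: psum_coord_0)
next
  case (step A f c)
  obtain mu where mu: "is_partition mu" "nonzero_values mu = A"
    using ex_partition_nonzero_values[OF step(1)] by blast
  let ?g = "mconst c * psum_mset A + f"
  have coord: "psum_coord ?g lam = psum_coord f lam + (if lam = mu then c else 0)" for lam
    using psum_coord_psum[OF mu(1), of lam] mu(2)
    by (simp add: psum_coord_add psum_coord_mconst_mult)
  define T where "T = insert mu {lam. psum_coord f lam \<noteq> 0}"
  have fin: "finite T" using step by (simp add: T_def)
  have sub: "{lam. psum_coord ?g lam \<noteq> 0} \<subseteq> T" by (auto simp: coord T_def)
  have "(\<Sum>lam | psum_coord ?g lam \<noteq> 0. mscale (psum_coord ?g lam) (power_sum_part lam)) =
      (\<Sum>lam\<in>T. mscale (psum_coord ?g lam) (power_sum_part lam))"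
    by (rule sum.mono_neutral_left[OF fin sub]) (auto simp: mscale_eq)
  also have "\<dots> = (\<Sum>lam\<in>T. mscale (psum_coord f lam) (power_sum_part lam)) +
      (\<Sum>lam\<in>T. if lam = mu then mconst c * power_sum_part lam else 0)"
    unfolding sum.distrib[symmetric]
    by (intro sum.cong refl) (simp add: coord mscale_eq mconst_add distrib_right)
  also have "(\<Sum>lam\<in>T. mscale (psum_coord f lam) (power_sum_part lam)) =
      (\<Sum>lam | psum_coord f lam \<noteq> 0. mscale (psum_coord f lam) (power_sum_part lam))"
    by (rule sum.mono_neutral_right[OF fin]) (auto simp: T_def mscale_eq)
  also have "\<dots> = f" using step by simp
  also have "(\<Sum>lam\<in>T. if lam = mu then mconst c * power_sum_part lam else 0) = mconst c * psum_mset A"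
    using fin mu by (simp add: T_def power_sum_part_eq)
  finally have "?g = (\<Sum>lam | psum_coord ?g lam \<noteq> 0. mscale (psum_coord ?g lam) (power_sum_part lam))"
    by (simp add: add.commute)
  then show ?case using finite_subset[OF sub fin] by blast
qed

text \<open>
  Uniqueness of the expansion, hence the justification of the definite description, comes from applying the
  functionals \<open>apolar\<close> to an arbitrary expansion.
\<close>

lemma power_sum_coeffs_eq:
  assumes "f \<in> symspan" shows "power_sum_coeffs f = psum_coord f"
  unfolding power_sum_coeffs_def
proof (rule the_equality)
  show "finite {lam. psum_coord f lam \<noteq> 0} \<and> (\<forall>lam. psum_coord f lam \<noteq> 0 \<longrightarrow> is_partition lam) \<and>
      f = (\<Sum>lam | psum_coord f lam \<noteq> 0. mscale (psum_coord f lam) (power_sum_part lam))"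
    using psum_coord_expansion[OF assms] by (auto simp: psum_coord_def split: if_splits)
next
  fix c assume c: "finite {lam. c lam \<noteq> 0} \<and> (\<forall>lam. c lam \<noteq> 0 \<longrightarrow> is_partition lam) \<and>
      f = (\<Sum>lam | c lam \<noteq> 0. mscale (c lam) (power_sum_part lam))"
  show "c = psum_coord f"
  proof
    fix lam
    have sum: "psum_coord (\<Sum>i\<in>S. g i) lam = (\<Sum>i\<in>S. psum_coord (g i) lam)" for S and g :: "(nat \<Rightarrow> nat) \<Rightarrow> complex mfps"
      by (induction S rule: infinite_finite_induct) (simp_all add: psum_coord_0 psum_coord_add)
    have "psum_coord f lam = (\<Sum>mu | c mu \<noteq> 0. psum_coord (mscale (c mu) (power_sum_part mu)) lam)"
      using c sum by metis
    also have "\<dots> = (\<Sum>mu | c mu \<noteq> 0. if mu = lam then c mu else 0)"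
      using c by (intro sum.cong refl)
        (auto simp: mscale_eq psum_coord_mconst_mult power_sum_part_eq psum_coord_psum)
    also have "\<dots> = c lam" using c by (simp add: sum.delta)
    finally show "c lam = psum_coord f lam" by simp
  qed
qed

context nome
begin

abbreviation form :: "complex mfps \<Rightarrow> complex mfps \<Rightarrow> complex" where
  "form \<equiv> macdonald_form q 0"

definition psum_norm :: "(nat \<Rightarrow> nat) \<Rightarrow> complex" where
  "psum_norm lam = of_nat (zfac (nonzero_values lam)) * (\<Prod>n\<in>#nonzero_values lam. 1 - q ^ n)"

lemma form_eq:
  assumes "f \<in> symspan" "g \<in> symspan" "finite T" "{lam. psum_coord f lam \<noteq> 0} \<subseteq> T"
  shows "form f g = (\<Sum>lam\<in>T. psum_coord f lam * psum_coord g lam * psum_norm lam)"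
proof -
  have "form f g = (\<Sum>lam | psum_coord f lam \<noteq> 0. psum_coord f lam * psum_coord g lam * psum_norm lam)"
    unfolding macdonald_form_def power_sum_coeffs_eq[OF assms(1)] power_sum_coeffs_eq[OF assms(2)]
  proof (intro sum.cong refl)
    fix lam assume "lam \<in> {lam. psum_coord f lam \<noteq> 0}"
    then have lam: "is_partition lam" by (auto simp: psum_coord_def split: if_splits)
    have "(\<Prod>i | lam i \<noteq> 0. (1 - q ^ lam i) / (1 - 0 ^ lam i)) = (\<Prod>i | lam i \<noteq> 0. 1 - q ^ lam i)"
      by (intro prod.cong) (auto simp: power_0_left)
    then show "psum_coord f lam * psum_coord g lam * of_nat (z_part lam) *
        (\<Prod>i | lam i \<noteq> 0. (1 - q ^ lam i) / (1 - 0 ^ lam i)) = psum_coord f lam * psum_coord g lam * psum_norm lam"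
      using lam by (simp add: psum_norm_def z_part_eq nonzero_values_def partition_finite
          prod_unfold_prod_mset image_mset.compositionality o_def)
  qed
  also have "\<dots> = (\<Sum>lam\<in>T. psum_coord f lam * psum_coord g lam * psum_norm lam)"
    by (rule sum.mono_neutral_left) (use assms in auto)
  finally show ?thesis .
qed

lemma form_add_left:
  assumes "f \<in> symspan" "g \<in> symspan" "h \<in> symspan"
  shows "form (f + g) h = form f h + form g h"
proof -
  define T where "T = {lam. psum_coord f lam \<noteq> 0} \<union> {lam. psum_coord g lam \<noteq> 0}"
  have "finite T" using psum_coord_expansion assms by (simp add: T_def)
  moreover have "{lam. psum_coord (f + g) lam \<noteq> 0} \<subseteq> T" by (auto simp: T_def psum_coord_add)
  ultimately show ?thesis
    using assms by (subst (1 2 3) form_eq[where T = T])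
      (auto simp: T_def psum_coord_add lspan_add distrib_right sum.distrib)
qed

lemma form_add_right:
  assumes "f \<in> symspan" "g \<in> symspan" "h \<in> symspan"
  shows "form h (f + g) = form h f + form h g"
  using assms psum_coord_expansion[OF assms(3)]
  by (subst (1 2 3) form_eq[where T = "{lam. psum_coord h lam \<noteq> 0}"])
     (auto simp: psum_coord_add lspan_add distrib_right distrib_left sum.distrib)

lemma form_mconst_left:
  assumes "f \<in> symspan" "h \<in> symspan"
  shows "form (mconst c * f) h = c * form f h"
  using assms psum_coord_expansion[OF assms(1)]
  by (subst (1 2) form_eq[where T = "{lam. psum_coord f lam \<noteq> 0}"])
     (auto simp: psum_coord_mconst_mult lspan_mconst_mult sum_distrib_left mult.assoc)

lemma form_mconst_right:
  assumes "f \<in> symspan" "h \<in> symspan"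
  shows "form h (mconst c * f) = c * form h f"
  using assms psum_coord_expansion[OF assms(2)]
  by (subst (1 2) form_eq[where T = "{lam. psum_coord h lam \<noteq> 0}"])
     (auto simp: psum_coord_mconst_mult lspan_mconst_mult sum_distrib_left mult.assoc mult.left_commute)

lemma form_0_left: "h \<in> symspan \<Longrightarrow> form 0 h = 0"
  using form_mconst_left[of 0 h 0] lspan_0 by simp

lemma form_0_right: "h \<in> symspan \<Longrightarrow> form h 0 = 0"
  using form_mconst_right[of 0 h 0] lspan_0 by simp

lemma form_sum_left:
  assumes "\<And>i. i \<in> S \<Longrightarrow> f i \<in> symspan" "h \<in> symspan"
  shows "form (\<Sum>i\<in>S. f i) h = (\<Sum>i\<in>S. form (f i) h)"
  using assms(1)
  by (induction S rule: infinite_finite_induct)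
     (auto simp: form_0_left assms(2) form_add_left lspan_sum)

lemma form_sum_right:
  assumes "\<And>i. i \<in> S \<Longrightarrow> f i \<in> symspan" "h \<in> symspan"
  shows "form h (\<Sum>i\<in>S. f i) = (\<Sum>i\<in>S. form h (f i))"
  using assms(1)
  by (induction S rule: infinite_finite_induct)
     (auto simp: form_0_right assms(2) form_add_right lspan_sum)

lemma form_psum:
  assumes "0 \<notin># A" "h \<in> symspan"
  shows "form (psum_mset A) h = (\<Prod>n\<in>#A. 1 - q ^ n) * apolar (sorted_list_of_multiset A) h"
proof -
  obtain mu where mu: "is_partition mu" "nonzero_values mu = A"
    using ex_partition_nonzero_values[OF assms(1)] by blast
  have "form (psum_mset A) h = (\<Sum>lam\<in>{mu}. psum_coord (psum_mset A) lam * psum_coord h lam * psum_norm lam)"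
    using psum_coord_psum[OF mu(1)] mu(2) assms
    by (intro form_eq symspan_psum) (auto split: if_splits)
  also have "\<dots> = psum_coord h mu * psum_norm mu"
    using psum_coord_psum[OF mu(1), of mu] mu(2) by simp
  also have "\<dots> = (\<Prod>n\<in>#A. 1 - q ^ n) * apolar (sorted_list_of_multiset A) h"
    using mu zfac_nonzero[OF assms(1)] by (simp add: psum_coord_def psum_norm_def)
  finally show ?thesis .
qed

text \<open>
  On products of power sums the form is, up to the factors \<open>1 - q\<^sup>n\<close>, iterated differentiation followed by the
  constant term; so multiplication by \<open>p_k\<close> moves to the other side as a derivative.
\<close>

lemma form_power_sum_mult:
  assumes "0 < k" "f \<in> symspan" "h \<in> symspan"
  shows "form (power_sum k * f) h = (1 - q ^ k) * form f (psum_deriv k h)"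
  using assms(2)
proof (induction f rule: symspan_induct)
  case zero
  then show ?case by (simp add: form_0_left assms psum_deriv_symspan)
next
  case (step A f c)
  have A: "0 \<notin># add_mset k A" using assms(1) step(1) by simp
  have "form (psum_mset (add_mset k A)) h =
      (1 - q ^ k) * (\<Prod>n\<in>#A. 1 - q ^ n) * apolar (sorted_list_of_multiset (add_mset k A)) h"
    using form_psum[OF A assms(3)] by simp
  also have "apolar (sorted_list_of_multiset (add_mset k A)) h = apolar (k # sorted_list_of_multiset A) h"
    using A assms(3) by (intro apolar_mset_cong) (auto simp: set_insort_key)
  also have "(1 - q ^ k) * (\<Prod>n\<in>#A. 1 - q ^ n) * apolar (k # sorted_list_of_multiset A) h =
      (1 - q ^ k) * form (psum_mset A) (psum_deriv k h)"
    using form_psum[OF step(1) psum_deriv_symspan[OF assms(3)]] by simp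
  finally have *: "form (psum_mset (add_mset k A)) h = (1 - q ^ k) * form (psum_mset A) (psum_deriv k h)" .
  have "power_sum k * (mconst c * psum_mset A + f) = mconst c * psum_mset (add_mset k A) + power_sum k * f"
    by (simp add: algebra_simps)
  also have "form \<dots> h = c * form (psum_mset (add_mset k A)) h + form (power_sum k * f) h"
    using A step assms
    by (subst form_add_left) (auto simp del: psum_mset_add simp: form_mconst_left symspan_psum
      intro!: lspan_mconst_mult symspan_psum symspan_power_sum_mult)
  also have "\<dots> = (1 - q ^ k) * (c * form (psum_mset A) (psum_deriv k h) + form f (psum_deriv k h))"
    unfolding * step.IH by (simp add: algebra_simps)
  also have "c * form (psum_mset A) (psum_deriv k h) + form f (psum_deriv k h) =
      form (mconst c * psum_mset A + f) (psum_deriv k h)"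
    using step assms by (subst form_add_left)
      (auto simp: form_mconst_left symspan_psum psum_deriv_symspan intro!: lspan_mconst_mult symspan_psum)
  finally show ?case .
qed

text \<open>
  Multiplication by \<open>g_n\<close> and \<open>peel n\<close> obey the same recursion in terms of power sums and their adjoints:
  Newton's identities on one side, the definition of \<open>psum_deriv\<close> on the other. The factors \<open>1 - q\<^sup>k\<close> cancel.
\<close>

theorem form_cplt_mult:
  assumes "f \<in> symspan" "h \<in> symspan"
  shows "form (cplt q (int n) * f) h = form f (peel n h)"
  using assms(2)
proof (induction n arbitrary: h rule: less_induct)
  case (less n)
  show ?case
  proof (cases "n = 0")
    case True
    then show ?thesis using less.prems by (simp add: cplt_0 peel_0_symspan)
  next
    case False
    have gf: "cplt q m * f \<in> symspan" for m using cplt_symspan assms(1) by (rule symspan_mult)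
    have "of_nat n * form (cplt q (int n) * f) h = form (mconst (of_nat n) * cplt q (int n) * f) h"
      by (simp add: form_mconst_left gf less.prems mult.assoc)
    also have "mconst (of_nat n) * cplt q (int n) * f =
        (\<Sum>k\<in>{1..n}. mconst (1 / (1 - q ^ k)) * (power_sum k * (cplt q (int n - int k) * f)))"
      unfolding cplt_Newton sum_distrib_right by (simp add: mult.assoc)
    also have "form \<dots> h = (\<Sum>k\<in>{1..n}. form (mconst (1 / (1 - q ^ k)) * (power_sum k * (cplt q (int n - int k) * f))) h)"
      by (intro form_sum_left lspan_mconst_mult symspan_power_sum_mult gf less.prems) auto
    also have "\<dots> = (\<Sum>k\<in>{1..n}. form f (peel (n - k) (psum_deriv k h)))"
    proof (intro sum.cong refl)
      fix k assume k: "k \<in> {1..n}"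
      have "form (mconst (1 / (1 - q ^ k)) * (power_sum k * (cplt q (int n - int k) * f))) h =
          1 / (1 - q ^ k) * ((1 - q ^ k) * form (cplt q (int n - int k) * f) (psum_deriv k h))"
        using k by (simp add: form_mconst_left symspan_power_sum_mult gf less.prems form_power_sum_mult)
      also have "\<dots> = form (cplt q (int (n - k)) * f) (psum_deriv k h)"
        using one_minus_power_nonzero[of k] k by (simp add: of_nat_diff)
      also have "\<dots> = form f (peel (n - k) (psum_deriv k h))"
        using k by (intro less.IH psum_deriv_symspan less.prems) auto
      finally show "form (mconst (1 / (1 - q ^ k)) * (power_sum k * (cplt q (int n - int k) * f))) h =
        form f (peel (n - k) (psum_deriv k h))" .
    qed
    also have "\<dots> = form f (\<Sum>k\<in>{1..n}. peel (n - k) (psum_deriv k h))"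
      by (intro form_sum_right[symmetric] peel_symspan psum_deriv_symspan less.prems assms(1))
    also have "\<dots> = of_nat n * form f (peel n h)"
      using False sum_peel_psum_deriv[OF less.prems, of n]
      by (simp add: form_mconst_right peel_symspan less.prems assms(1))
    finally show ?thesis using False by simp
  qed
qed

end

context nome
begin

section \<open>Orthogonality of the branching family\<close>

lemma strip_wt_nonzeroI:
  assumes "\<And>i. lam i \<le> mu i" "\<And>i. mu (Suc i) \<le> lam i" "lam \<in> parts" "mu \<in> parts"
  shows "strip_wt q lam mu \<noteq> 0"
proof -
  obtain n where n: "vanishes_from n lam" "vanishes_from n mu"
    using common_cutoff assms by blast
  show ?thesis unfolding strip_wt_eq[OF n] using assms by (simp add: iqf_eq_0_iff not_less)
qed

definition row_tail :: "(nat \<Rightarrow> int) \<Rightarrow> nat \<Rightarrow> int" where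
  "row_tail mu = (\<lambda>i. mu (Suc i))"

lemma row_tail_parts: "mu \<in> parts \<Longrightarrow> row_tail mu \<in> parts"
proof -
  assume mu: "mu \<in> parts"
  then obtain n where "vanishes_from n mu" by (rule partsE)
  then have "vanishes_from n (row_tail mu)" by (auto simp: vanishes_from_def row_tail_def)
  moreover have "antimono (row_tail mu)"
    using antimono_parts[OF mu] by (auto simp: row_tail_def intro!: antimonoI)
  ultimately show ?thesis by (rule partsI[rotated])
qed

lemma weight_row_tail:
  assumes "mu \<in> parts" shows "weight mu = mu 0 + weight (row_tail mu)"
proof -
  obtain n where n: "vanishes_from n mu" using assms by (rule partsE)
  then have 1: "vanishes_from (Suc n) mu" "vanishes_from n (row_tail mu)"
    by (auto simp: vanishes_from_def row_tail_def)
  show ?thesis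
    unfolding weight_eq[OF 1(1)] weight_eq[OF 1(2)] unfolding row_tail_def by (rule sum.lessThan_Suc_shift)
qed

lemma strip_wt_row_tail:
  assumes "mu \<in> parts" shows "strip_wt q (row_tail mu) mu \<noteq> 0"
  by (rule strip_wt_nonzeroI) (use assms in \<open>auto simp: row_tail_parts, auto simp: row_tail_def intro: antimono_parts\<close>)

lemma strip_over_row_tail:
  assumes "mu \<in> parts" "mu' \<in> parts" "weight mu' = weight mu" "mu' \<noteq> mu"
    "strip_wt q (row_tail mu) mu' \<noteq> 0"
  shows "mu 0 < mu' 0"
proof -
  have le: "mu' (Suc i) \<le> mu (Suc i)" for i
    using strip_wt_nonzeroD(2)[OF assms(5), of i] row_tail_parts[OF assms(1)] assms(2)
    by (simp add: parts_def row_tail_def)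
  have tail: "row_tail mu' \<in> parts" "row_tail mu \<in> parts" using assms row_tail_parts by auto
  have le_tail: "row_tail mu' i \<le> row_tail mu i" for i using le by (simp add: row_tail_def)
  have w: "weight (row_tail mu') \<le> weight (row_tail mu)" by (rule weight_mono(1)[OF tail le_tail])
  have "mu' 0 \<noteq> mu 0"
  proof
    assume eq0: "mu' 0 = mu 0"
    then have "weight (row_tail mu') = weight (row_tail mu)"
      using weight_row_tail[OF assms(1)] weight_row_tail[OF assms(2)] assms(3) by simp
    then have "row_tail mu' = row_tail mu" by (rule weight_mono(2)[OF tail le_tail])
    then have "mu' (Suc i) = mu (Suc i)" for i by (simp add: row_tail_def fun_eq_iff)
    then have "mu' i = mu i" for i using eq0 by (cases i) auto
    then show False using assms(4) by blast
  qed
  moreover have "mu 0 \<le> mu' 0"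
    using w weight_row_tail[OF assms(1)] weight_row_tail[OF assms(2)] assms(3) by simp
  ultimately show ?thesis by simp
qed

text \<open>
  In \<open>g_n W_kap\<close> with \<open>kap\<close> the partition \<open>mu\<close> without its first row and \<open>n = mu 0\<close>, the partition \<open>mu\<close> is the one
  with the smallest first row. So every statement about \<open>W_mu\<close> that can be transported through the Pieri
  rule may be proved by induction on the size and, for equal size, downwards on the first row.
\<close>

lemma parts_strip_induct [consumes 1, case_names zero step]:
  assumes "mu \<in> parts" and zero: "Q (\<lambda>_. 0)"
    and step: "\<And>mu. mu \<in> parts \<Longrightarrow> Q (row_tail mu) \<Longrightarrow>
      (\<And>mu'. mu' \<in> parts_of (weight mu) \<Longrightarrow> mu' \<noteq> mu \<Longrightarrow> strip_wt q (row_tail mu) mu' \<noteq> 0 \<Longrightarrow> Q mu') \<Longrightarrow> Q mu"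
  shows "Q mu"
proof -
  \<comment> \<open>For fixed size the first row is bounded, so it can serve as a decreasing measure.\<close>
  define R where "R = measures [\<lambda>mu. nat (weight mu), \<lambda>mu. nat (weight mu - mu 0)]"
  have "wf R" by (simp add: R_def)
  then show ?thesis using assms(1)
  proof (induction mu rule: wf_induct_rule)
    case (less mu)
    show ?case
    proof (cases "mu = (\<lambda>_. 0)")
      case False
      have pos: "0 < weight mu"
        using weight_eq_0_iff[OF less.prems] weight_nonneg[OF less.prems] False by linarith
      have "0 < mu 0"
      proof (rule ccontr)
        assume "\<not> 0 < mu 0"
        then have "mu i = 0" for i
          using antimono_parts[OF less.prems, of 0 i] parts_nonneg[OF less.prems, of i] by simp
        then show False using False by blast
      qed
      then have "(row_tail mu, mu) \<in> R"
        using weight_row_tail[OF less.prems] pos by (simp add: R_def)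
      then have tail: "Q (row_tail mu)" using less.IH row_tail_parts[OF less.prems] by blast
      have larger: "Q mu'" if mu': "mu' \<in> parts_of (weight mu)" "mu' \<noteq> mu" "strip_wt q (row_tail mu) mu' \<noteq> 0" for mu'
      proof -
        have p: "mu' \<in> parts" "weight mu' = weight mu" using mu'(1) by (auto simp: parts_of_def)
        have "mu 0 < mu' 0" using strip_over_row_tail[OF less.prems p mu'(2,3)] .
        then have "(mu', mu) \<in> R"
          using part_le_weight[OF p(1), of 0] p(2) by (simp add: R_def)
        then show ?thesis using less.IH p(1) by blast
      qed
      show ?thesis by (rule step[OF less.prems tail larger])
    qed (simp add: zero)
  qed
qed

lemma branch_coeff_zero: "branch_coeff q ks (\<lambda>_. 0) = (if \<forall>k\<in>set ks. k = 0 then 1 else 0)"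
proof (induction ks)
  case (Cons k ks)
  have "weight (\<lambda>_. 0) = 0" by (simp add: weight_def)
  then show ?case
    using Cons by (cases "k = 0") (simp_all add: parts_of_0 parts_of_neg norm_wt_0 strip_wt_0)
qed simp

lemma qWhit_0: "qWhit q (\<lambda>_. 0) = 1"
proof (rule mfps_eqI)
  fix M :: "nat multiset"
  obtain n where n: "set_mset M \<subseteq> {..<n}"
    using finite_nat_set_iff_bounded[of "set_mset M"] by auto
  have "(\<forall>k\<in>set (map (count M) [0..<n]). k = 0) \<longleftrightarrow> M = {#}"
  proof
    assume *: "\<forall>k\<in>set (map (count M) [0..<n]). k = 0"
    have "count M i = 0" for i
    proof (cases "i < n")
      case False
      then have "i \<notin># M" using n by auto
      then show ?thesis by (simp add: not_in_iff)
    qed (use * in auto)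
    then show "M = {#}" by (simp add: multiset_eq_iff)
  qed simp
  then show "mcoeff (qWhit q (\<lambda>_. 0)) M = mcoeff 1 M"
    using mcoeff_qWhit[OF zero_in_parts n] by (simp add: branch_coeff_zero mcoeff_1)
qed

lemma qWhit_recursion:
  assumes "mu \<in> parts"
  defines "kap \<equiv> row_tail mu"
  shows "mconst (norm_wt q kap * strip_wt q kap mu) * qWhit q mu = cplt q (mu 0) * qWhit q kap -
    (\<Sum>mu'\<in>parts_of (weight mu) - {mu}. mconst (norm_wt q kap * strip_wt q kap mu') * qWhit q mu')"
proof -
  have "int (nat (mu 0)) = mu 0" using parts_nonneg[OF assms(1)] by simp
  then have "cplt q (mu 0) * qWhit q kap =
      (\<Sum>mu'\<in>parts_of (weight mu). mconst (norm_wt q kap * strip_wt q kap mu') * qWhit q mu')"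
    using cplt_Pieri[of kap "nat (mu 0)"] weight_row_tail[OF assms(1)] row_tail_parts[OF assms(1)]
    by (simp add: kap_def add.commute)
  also have "\<dots> = mconst (norm_wt q kap * strip_wt q kap mu) * qWhit q mu +
      (\<Sum>mu'\<in>parts_of (weight mu) - {mu}. mconst (norm_wt q kap * strip_wt q kap mu') * qWhit q mu')"
    by (rule sum.remove) (auto simp: finite_parts_of parts_of_weight assms)
  finally show ?thesis by simp
qed

lemma qWhit_symspan: "mu \<in> parts \<Longrightarrow> qWhit q mu \<in> symspan"
proof (induction rule: parts_strip_induct)
  case zero
  then show ?case by (simp add: qWhit_0 symspan_1)
next
  case (step mu)
  let ?a = "norm_wt q (row_tail mu) * strip_wt q (row_tail mu) mu"
  have "(\<Sum>mu'\<in>parts_of (weight mu) - {mu}.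
      mconst (norm_wt q (row_tail mu) * strip_wt q (row_tail mu) mu') * qWhit q mu') \<in> symspan"
  proof (rule lspan_sum)
    fix mu' assume mu': "mu' \<in> parts_of (weight mu) - {mu}"
    show "mconst (norm_wt q (row_tail mu) * strip_wt q (row_tail mu) mu') * qWhit q mu' \<in> symspan"
    proof (cases "strip_wt q (row_tail mu) mu' = 0")
      case False
      then show ?thesis using mu' by (intro lspan_mconst_mult step(3)) auto
    qed (simp add: lspan_0)
  qed
  then have "mconst ?a * qWhit q mu \<in> symspan"
    unfolding qWhit_recursion[OF step(1)] by (intro lspan_diff symspan_mult cplt_symspan step(2))
  then have "mconst (1 / ?a) * (mconst ?a * qWhit q mu) \<in> symspan" by (rule lspan_mconst_mult)
  moreover have "?a \<noteq> 0" using strip_wt_row_tail[OF step(1)] norm_wt_nonzero by simp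
  ultimately show ?case by (simp flip: mconst_mult mult.assoc)
qed

text \<open>
  By the induction rule, \<open>W_mu\<close> is a product \<open>g_n W_kap\<close> minus terms known to be orthogonal. Moving \<open>g_n\<close> to the
  other side turns it into peeling, and the branching coefficient \<open>norm_wt lam * strip_wt kap lam\<close> times the norm of
  \<open>W_kap\<close> equals the Pieri coefficient \<open>norm_wt kap * strip_wt kap lam\<close> times \<open>norm_wt lam\<close>.
\<close>

theorem qWhit_orthogonal:
  "mu \<in> parts \<Longrightarrow> lam \<in> parts \<Longrightarrow>
    form (qWhit q mu) (qWhit q lam) = (if mu = lam then norm_wt q lam else 0)"
proof (induction arbitrary: lam rule: parts_strip_induct)
  case zero
  have "form 1 (qWhit q lam) = mcoeff (qWhit q lam) {#}"
    using form_psum[of "{#}" "qWhit q lam"] qWhit_symspan zero by simp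
  then show ?case using zero by (auto simp: qWhit_0 mcoeff_qWhit_empty norm_wt_0)
next
  case (step mu)
  define kap where "kap = row_tail mu"
  define a where "a mu' = norm_wt q kap * strip_wt q kap mu'" for mu'
  note mu = step.hyps and lam = step.prems
  have kap: "kap \<in> parts" by (simp add: kap_def row_tail_parts mu)
  have a: "a mu \<noteq> 0" using strip_wt_row_tail[OF mu] norm_wt_nonzero by (simp add: a_def kap_def)
  have sp: "qWhit q nu \<in> symspan" if "nu \<in> parts_of m" for nu m
    using that by (auto simp: parts_of_def qWhit_symspan)
  have mu0: "int (nat (mu 0)) = mu 0" using parts_nonneg[OF mu] by simp
  have "form (cplt q (mu 0) * qWhit q kap) (qWhit q lam) = form (qWhit q kap) (peel (nat (mu 0)) (qWhit q lam))"
    using form_cplt_mult[of "qWhit q kap" "qWhit q lam" "nat (mu 0)"] qWhit_symspan kap lam mu0 by simp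
  also have "\<dots> = (\<Sum>nu\<in>parts_of (weight lam - mu 0). norm_wt q lam * strip_wt q nu lam * form (qWhit q kap) (qWhit q nu))"
    unfolding peel_qWhit[OF lam] mu0
    by (subst form_sum_right) (auto simp: form_mconst_right sp qWhit_symspan kap intro!: lspan_mconst_mult)
  also have "\<dots> = (\<Sum>nu\<in>parts_of (weight lam - mu 0). if nu = kap then norm_wt q lam * strip_wt q kap lam * norm_wt q kap else 0)"
    by (intro sum.cong refl) (auto simp: step.IH(1)[folded kap_def] parts_of_def)
  also have "\<dots> = (if weight lam = weight mu then a lam * norm_wt q lam else 0)"
  proof -
    have "kap \<in> parts_of (weight lam - mu 0) \<longleftrightarrow> weight lam = weight mu"
      using weight_row_tail[OF mu] kap by (auto simp: parts_of_def kap_def)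
    then show ?thesis by (simp add: sum.delta finite_parts_of a_def)
  qed
  finally have L: "form (cplt q (mu 0) * qWhit q kap) (qWhit q lam) =
    (if weight lam = weight mu then a lam * norm_wt q lam else 0)" .
  have terms: "mconst (a mu') * qWhit q mu' \<in> symspan" if "mu' \<in> parts_of (weight mu) - {mu}" for mu'
    using that sp by (intro lspan_mconst_mult) blast
  have "form (\<Sum>mu'\<in>parts_of (weight mu) - {mu}. mconst (a mu') * qWhit q mu') (qWhit q lam) =
      (\<Sum>mu'\<in>parts_of (weight mu) - {mu}. a mu' * form (qWhit q mu') (qWhit q lam))"
    by (subst form_sum_left[OF terms qWhit_symspan[OF lam]])
       (auto intro!: sum.cong form_mconst_left qWhit_symspan lam dest: parts_ofD)
  also have "\<dots> = (\<Sum>mu'\<in>parts_of (weight mu) - {mu}. if mu' = lam then a lam * norm_wt q lam else 0)"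
  proof (intro sum.cong refl)
    fix mu' assume mu': "mu' \<in> parts_of (weight mu) - {mu}"
    show "a mu' * form (qWhit q mu') (qWhit q lam) = (if mu' = lam then a lam * norm_wt q lam else 0)"
    proof (cases "strip_wt q kap mu' = 0")
      case True
      then show ?thesis by (auto simp: a_def)
    next
      case False
      then show ?thesis using step.IH(2)[of mu' lam] mu' lam by (auto simp: kap_def)
    qed
  qed
  also have "\<dots> = (if weight lam = weight mu \<and> lam \<noteq> mu then a lam * norm_wt q lam else 0)"
  proof -
    have "lam \<in> parts_of (weight mu) - {mu} \<longleftrightarrow> weight lam = weight mu \<and> lam \<noteq> mu"
      using lam by (auto simp: parts_of_def)
    then show ?thesis by (simp only: sum.delta finite_Diff finite_parts_of)
  qed
  finally have R: "form (\<Sum>mu'\<in>parts_of (weight mu) - {mu}. mconst (a mu') * qWhit q mu') (qWhit q lam) =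
      (if weight lam = weight mu \<and> lam \<noteq> mu then a lam * norm_wt q lam else 0)" .
  have tail_symspan: "(\<Sum>mu'\<in>parts_of (weight mu) - {mu}. mconst (a mu') * qWhit q mu') \<in> symspan"
    by (rule lspan_sum[OF terms])
  have "cplt q (mu 0) * qWhit q kap = mconst (a mu) * qWhit q mu +
      (\<Sum>mu'\<in>parts_of (weight mu) - {mu}. mconst (a mu') * qWhit q mu')"
    using qWhit_recursion[OF mu] by (simp add: a_def kap_def)
  then have "form (cplt q (mu 0) * qWhit q kap) (qWhit q lam) = a mu * form (qWhit q mu) (qWhit q lam) +
      form (\<Sum>mu'\<in>parts_of (weight mu) - {mu}. mconst (a mu') * qWhit q mu') (qWhit q lam)"
    using form_add_left[OF lspan_mconst_mult[OF qWhit_symspan[OF mu]] tail_symspan qWhit_symspan[OF lam], of "a mu"]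
      form_mconst_left[OF qWhit_symspan[OF mu] qWhit_symspan[OF lam], of "a mu"] by simp
  then have "a mu * form (qWhit q mu) (qWhit q lam) = (if mu = lam then a mu * norm_wt q lam else 0)"
    unfolding L R by (auto split: if_splits)
  then show ?case using a by (auto split: if_splits)
qed

lemma branch_coeff_weight:
  "lam \<in> parts \<Longrightarrow> branch_coeff q ks lam \<noteq> 0 \<Longrightarrow> weight lam = (\<Sum>k\<leftarrow>ks. int k)"
proof (induction ks arbitrary: lam)
  case (Cons k ks)
  then obtain kap where "kap \<in> parts_of (weight lam - int k)" "branch_coeff q ks kap \<noteq> 0"
    by (auto elim: sum.not_neutral_contains_not_neutral)
  then show ?case using Cons.IH[of kap] by (auto simp: parts_of_def)
qed (auto simp: weight_def split: if_splits)

lemma branch_coeff_vanishes: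
  "lam \<in> parts \<Longrightarrow> branch_coeff q ks lam \<noteq> 0 \<Longrightarrow> vanishes_from (length ks) lam"
proof (induction ks arbitrary: lam)
  case (Cons k ks)
  then obtain kap where kap: "kap \<in> parts_of (weight lam - int k)" "branch_coeff q ks kap \<noteq> 0" "strip_wt q kap lam \<noteq> 0"
    by (auto elim: sum.not_neutral_contains_not_neutral)
  then have "vanishes_from (length ks) kap" by (intro Cons.IH) (auto simp: parts_of_def)
  moreover have "lam (Suc i) \<le> kap i" for i
    using strip_wt_nonzeroD(2)[OF kap(3)] kap(1) Cons.prems(1) by (auto simp: parts_of_def parts_def)
  ultimately have "lam (Suc i) = 0" if "length ks \<le> i" for i
    using that parts_nonneg[OF Cons.prems(1), of "Suc i"] by (metis vanishes_from_def order_antisym)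
  then show ?case
    unfolding vanishes_from_def by (metis Suc_le_D Suc_le_mono length_Cons)
qed (auto simp: vanishes_from_def split: if_splits)

text \<open>
  Removing a horizontal strip from \<open>lam\<close> leaves at least \<open>lam (Suc i)\<close> boxes in row \<open>i\<close>, so \<open>m\<close> strips remove at
  most the boxes of the first \<open>m\<close> rows.
\<close>

lemma branch_coeff_dominance:
  "lam \<in> parts \<Longrightarrow> branch_coeff q ks lam \<noteq> 0 \<Longrightarrow> (\<Sum>k\<leftarrow>take m ks. int k) \<le> (\<Sum>i<m. lam i)"
proof (induction ks arbitrary: lam m)
  case Nil
  then show ?case by (auto split: if_splits)
next
  case (Cons k ks)
  then obtain kap where kap: "kap \<in> parts_of (weight lam - int k)" "branch_coeff q ks kap \<noteq> 0" "strip_wt q kap lam \<noteq> 0"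
    by (auto elim: sum.not_neutral_contains_not_neutral)
  then have kp: "kap \<in> parts" and wt: "weight kap = weight lam - int k" by (auto simp: parts_of_def)
  have le: "lam (Suc i) \<le> kap i" for i
    using strip_wt_nonzeroD(2)[OF kap(3)] kp Cons.prems(1) by (auto simp: parts_def)
  show ?case
  proof (cases m)
    case (Suc j)
    obtain n0 where n0: "vanishes_from n0 lam" "vanishes_from n0 kap"
      using common_cutoff Cons.prems(1) kp by blast
    define n where "n = n0 + j"
    have n: "vanishes_from (Suc n) lam" "vanishes_from n kap"
      using n0 by (auto simp: n_def elim: vanishes_from_mono)
    have split: "(\<Sum>i<n. f i) = (\<Sum>i<j. f i) + (\<Sum>i\<in>{j..<n}. f i)" for f :: "nat \<Rightarrow> int"
    proof -
      have "{..<n} = {..<j} \<union> {j..<n}" by (auto simp: n_def)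
      show ?thesis unfolding \<open>{..<n} = {..<j} \<union> {j..<n}\<close> by (rule sum.union_disjoint) auto
    qed
    have "int k = weight lam - weight kap" using wt by simp
    also have "\<dots> = lam 0 + (\<Sum>i<n. lam (Suc i)) - (\<Sum>i<n. kap i)"
      unfolding weight_eq[OF n(1)] weight_eq[OF n(2)] sum.lessThan_Suc_shift ..
    also have "\<dots> = lam 0 + (\<Sum>i<j. lam (Suc i)) - (\<Sum>i<j. kap i) + (\<Sum>i\<in>{j..<n}. lam (Suc i) - kap i)"
      by (simp add: split sum_subtractf)
    also have "\<dots> \<le> lam 0 + (\<Sum>i<j. lam (Suc i)) - (\<Sum>i<j. kap i)"
      using sum_nonpos[of "{j..<n}" "\<lambda>i. lam (Suc i) - kap i"] le by simp
    also have "lam 0 + (\<Sum>i<j. lam (Suc i)) = (\<Sum>i<m. lam i)"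
      unfolding Suc by (rule sum.lessThan_Suc_shift[symmetric])
    finally have "int k + (\<Sum>i<j. kap i) \<le> (\<Sum>i<m. lam i)" by simp
    moreover have "(\<Sum>k\<leftarrow>take j ks. int k) \<le> (\<Sum>i<j. kap i)"
      using Cons.IH kp kap(2) by blast
    ultimately show ?thesis by (simp add: Suc)
  qed simp
qed

text \<open>
  The only chain of strips that removes \<open>lam 0\<close>, then \<open>lam 1\<close> boxes, and so on, deletes the first row each time;
  all its \<open>q\<close>-binomial coefficients are 1.
\<close>

lemma branch_coeff_leading:
  "lam \<in> parts \<Longrightarrow> vanishes_from n lam \<Longrightarrow> branch_coeff q (map (\<lambda>i. nat (lam i)) [0..<n]) lam = 1"
proof (induction n arbitrary: lam)
  case 0
  then have "lam = (\<lambda>_. 0)" by (auto simp: vanishes_from_def)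
  then show ?case by simp
next
  case (Suc n)
  note lam = Suc.prems(1)
  let ?t = "row_tail lam"
  have tp: "?t \<in> parts" using row_tail_parts[OF lam] .
  have tv: "vanishes_from n ?t" using Suc.prems(2) by (auto simp: vanishes_from_def row_tail_def)
  have list: "map (\<lambda>i. nat (lam i)) [0..<Suc n] = nat (lam 0) # map (\<lambda>i. nat (?t i)) [0..<n]"
    by (simp add: upt_conv_Cons map_Suc_upt[symmetric] o_def row_tail_def del: upt_Suc)
  have w: "weight lam - int (nat (lam 0)) = weight ?t"
    using weight_row_tail[OF lam] parts_nonneg[OF lam, of 0] by simp
  have only: "strip_wt q kap lam = 0" if kap: "kap \<in> parts_of (weight ?t)" "kap \<noteq> ?t" for kap
  proof (rule ccontr)
    assume nz: "strip_wt q kap lam \<noteq> 0"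
    have kp: "kap \<in> parts" using kap(1) by (auto simp: parts_of_def)
    have "?t i \<le> kap i" for i
      using strip_wt_nonzeroD(2)[OF nz, of i] kp lam by (auto simp: parts_def row_tail_def)
    from weight_mono(2)[OF tp kp this] show False using kap by (simp add: parts_of_def)
  qed
  have "branch_coeff q (map (\<lambda>i. nat (lam i)) [0..<Suc n]) lam =
      (\<Sum>kap\<in>parts_of (weight ?t). norm_wt q lam * strip_wt q kap lam * branch_coeff q (map (\<lambda>i. nat (?t i)) [0..<n]) kap)"
    by (simp only: list branch_coeff.simps w)
  also have "\<dots> = (\<Sum>kap\<in>{?t}. norm_wt q lam * strip_wt q kap lam * branch_coeff q (map (\<lambda>i. nat (?t i)) [0..<n]) kap)"
    by (rule sum.mono_neutral_right) (auto simp: finite_parts_of only parts_of_weight tp)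
  also have "\<dots> = norm_wt q lam * strip_wt q ?t lam"
    using Suc.IH[OF tp tv] by simp
  also have "\<dots> = 1"
  proof -
    have v: "vanishes_from (Suc n) ?t" using tv by (rule vanishes_from_mono) simp
    have "qfac q (lam i - lam (Suc i)) * iqf q (lam i - lam (Suc i)) = 1" for i
      using antimono_parts[OF lam, of i "Suc i"] by (intro qfac_iqf) simp
    then show ?thesis
      unfolding norm_wt_eq[OF Suc.prems(2)] strip_wt_eq[OF v Suc.prems(2)]
      by (simp add: row_tail_def prod.distrib[symmetric] del: prod.lessThan_Suc)
  qed
  finally show ?case .
qed

end

section \<open>Identification with the Macdonald polynomials\<close>

definition sym_invariant :: "complex mfps \<Rightarrow> bool" where
  "sym_invariant f \<longleftrightarrow> (\<forall>\<sigma> M. bij \<sigma> \<longrightarrow> mcoeff f (image_mset \<sigma> M) = mcoeff f M)"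

lemma sym_invariantD: "sym_invariant f \<Longrightarrow> bij \<sigma> \<Longrightarrow> mcoeff f (image_mset \<sigma> M) = mcoeff f M"
  by (simp add: sym_invariant_def)

lemma image_mset_inv:
  assumes "bij \<sigma>" shows "image_mset (inv \<sigma>) (image_mset \<sigma> M) = M" "image_mset \<sigma> (image_mset (inv \<sigma>) M) = M"
  using assms by (simp_all add: image_mset.compositionality o_def bij_is_inj bij_is_surj surj_f_inv_f)

lemma sym_invariant_mult:
  assumes f: "sym_invariant f" and g: "sym_invariant g" shows "sym_invariant (f * g)"
  unfolding sym_invariant_def
proof (intro allI impI)
  fix \<sigma> :: "nat \<Rightarrow> nat" and M assume \<sigma>: "bij \<sigma>"
  have "(\<Sum>(A, B) | A + B = M. mcoeff f A * mcoeff g B) =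
      (\<Sum>(A, B) | A + B = image_mset \<sigma> M. mcoeff f A * mcoeff g B)"
    by (rule sum.reindex_bij_witness[where
          i = "\<lambda>(A, B). (image_mset (inv \<sigma>) A, image_mset (inv \<sigma>) B)" and
          j = "\<lambda>(A, B). (image_mset \<sigma> A, image_mset \<sigma> B)"])
       (auto simp: image_mset_inv[OF \<sigma>] sym_invariantD[OF f \<sigma>] sym_invariantD[OF g \<sigma>]
             simp flip: image_mset_union)
  then show "mcoeff (f * g) (image_mset \<sigma> M) = mcoeff (f * g) M"
    by (simp add: mcoeff_mult)
qed

lemma sym_invariant_1: "sym_invariant 1"
  by (simp add: sym_invariant_def mcoeff_1)

lemma sym_invariant_power_sum: "sym_invariant (power_sum n)"
  unfolding sym_invariant_def
proof (intro allI impI)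
  fix \<sigma> :: "nat \<Rightarrow> nat" and M assume \<sigma>: "bij \<sigma>"
  have "(\<exists>i. image_mset \<sigma> M = replicate_mset n i) \<longleftrightarrow> (\<exists>i. M = replicate_mset n i)"
  proof
    assume "\<exists>i. image_mset \<sigma> M = replicate_mset n i"
    then obtain i where "image_mset \<sigma> M = replicate_mset n i" by blast
    from arg_cong[OF this, of "image_mset (inv \<sigma>)"] show "\<exists>i. M = replicate_mset n i"
      by (auto simp: image_mset_inv[OF \<sigma>])
  qed auto
  then show "mcoeff (power_sum n) (image_mset \<sigma> M) = mcoeff (power_sum n) M"
    by (simp add: power_sum_def)
qed

lemma sym_invariant_symspan: "f \<in> symspan \<Longrightarrow> sym_invariant f"
proof (induction f rule: symspan_induct)
  case (step A f c)
  have "sym_invariant (psum_mset A)"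
    by (induction A) (auto intro: sym_invariant_1 sym_invariant_mult sym_invariant_power_sum)
  then show ?case using step by (simp add: sym_invariant_def)
qed (simp add: sym_invariant_def)

lemma count_image_mset_bij: "bij \<pi> \<Longrightarrow> count (image_mset \<pi> M) (\<pi> i) = count M i"
  by (induction M) (auto simp: bij_def inj_eq)

definition mset_of_part :: "(nat \<Rightarrow> nat) \<Rightarrow> nat multiset" where
  "mset_of_part mu = Abs_multiset mu"

lemma count_mset_of_part: "is_partition mu \<Longrightarrow> count (mset_of_part mu) = mu"
  unfolding mset_of_part_def by (rule count_Abs_multiset) (simp add: is_partition_def)

text \<open>
  A symmetric series is determined by its coefficients at sorted exponents.
\<close>

lemma ex_sorted_exponents:
  fixes M :: "nat multiset"
  obtains mu \<pi> where "is_partition mu" "bij \<pi>" "count M = mu \<circ> \<pi>"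
proof -
  obtain mu where mu: "is_partition mu" "nonzero_values mu = nonzero_values (count M)"
    using ex_partition_nonzero_values[OF zero_notin_nonzero_values] by blast
  have "finite {i. count M i \<noteq> 0}" by (simp add: count_eq_zero_iff)
  then obtain \<pi> where "bij \<pi>" "count M = mu \<circ> \<pi>"
    using rearrangement_bij[of "count M" mu] mu(2) partition_finite[OF mu(1)] by metis
  with mu(1) show ?thesis by (rule that)
qed

lemma mcoeff_monomial_sym:
  assumes "is_partition mu" "is_partition nu" "bij \<pi>" "count M = mu \<circ> \<pi>"
  shows "mcoeff (monomial_sym nu) M = (if nu = mu then 1 else 0)"
proof -
  have "nu = mu" if "bij \<sigma>" "count M = nu \<circ> \<sigma>" for \<sigma>
    using nonzero_values_comp_bij[OF that(1), of nu] nonzero_values_comp_bij[OF assms(3), of mu]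
      that(2) assms(4) by (intro partition_eqI assms(1,2)) simp
  then show ?thesis using assms(3,4) by (auto simp: monomial_sym_def)
qed

lemma sym_invariant_mcoeff:
  assumes "sym_invariant f" "is_partition mu" "bij \<pi>" "count M = mu \<circ> \<pi>"
  shows "mcoeff f M = mcoeff f (mset_of_part mu)"
proof -
  have "image_mset \<pi> M = mset_of_part mu"
  proof (rule multiset_eqI)
    fix j
    obtain i where "j = \<pi> i" using assms(3) by (metis bij_pointE)
    then show "count (image_mset \<pi> M) j = count (mset_of_part mu) j"
      using assms by (simp add: count_image_mset_bij count_mset_of_part)
  qed
  then show ?thesis using sym_invariantD[OF assms(1,3), of M] by simp
qed

definition int_part :: "(nat \<Rightarrow> nat) \<Rightarrow> nat \<Rightarrow> int" where
  "int_part lam = (\<lambda>i. int (lam i))"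

lemma int_part_parts: "is_partition lam \<Longrightarrow> int_part lam \<in> parts"
  by (auto simp: parts_def int_part_def is_partition_def antimono_def)

lemma weight_int_part: "weight (int_part lam) = int (psize lam)"
  by (simp add: weight_def int_part_def psize_def)

lemma int_part_eq_iff: "int_part lam = int_part mu \<longleftrightarrow> lam = mu"
  by (auto simp: int_part_def fun_eq_iff)

lemma finite_dominated: "finite {mu. dominated mu lam}"
proof (rule finite_imageD)
  show "finite (int_part ` {mu. dominated mu lam})"
    by (rule finite_subset[OF _ finite_parts_of[of "int (psize lam)"]])
       (auto simp: dominated_def parts_of_def int_part_parts weight_int_part)
qed (auto simp: inj_on_def int_part_eq_iff)

lemma dominated_refl: "is_partition lam \<Longrightarrow> dominated lam lam"
  by (simp add: dominated_def)

lemma dominated_trans: "dominated lam mu \<Longrightarrow> dominated mu nu \<Longrightarrow> dominated lam nu"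
  unfolding dominated_def by (auto intro: order_trans)

lemma dominated_antisym:
  assumes "dominated lam mu" "dominated mu lam" shows "lam = mu"
proof
  fix i
  have "(\<Sum>i<k. lam i) = (\<Sum>i<k. mu i)" for k
    using assms by (intro order_antisym) (auto simp: dominated_def)
  from this[of "Suc i"] this[of i] show "lam i = mu i" by simp
qed

lemma dominance_induct [case_names less]:
  assumes "\<And>lam. (\<And>mu. dominated mu lam \<Longrightarrow> mu \<noteq> lam \<Longrightarrow> Q mu) \<Longrightarrow> Q lam"
  shows "Q lam"
proof (induction "card {mu. dominated mu lam}" arbitrary: lam rule: less_induct)
  case less
  show ?case
  proof (rule assms)
    fix mu assume mu: "dominated mu lam" "mu \<noteq> lam"
    have "{nu. dominated nu mu} \<subset> {nu. dominated nu lam}"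
    proof
      show "{nu. dominated nu mu} \<subseteq> {nu. dominated nu lam}" using dominated_trans mu(1) by blast
      have "dominated lam lam" using mu(1) by (auto simp: dominated_def)
      moreover have "\<not> dominated lam mu" using dominated_antisym mu by blast
      ultimately show "{nu. dominated nu mu} \<noteq> {nu. dominated nu lam}" by blast
    qed
    then show "Q mu" by (intro less psubset_card_mono finite_dominated)
  qed
qed

lemma lspan_mono: "f \<in> lspan G \<Longrightarrow> G \<subseteq> H \<Longrightarrow> f \<in> lspan H"
  by (induction f rule: lspan.induct) (auto intro: lspan.intros)

lemma lspan_image:
  assumes "f \<in> lspan (P ` B)" "finite B"
  obtains w where "f = (\<Sum>mu\<in>B. mconst (w mu) * P mu)"
  using assms
proof (induction f arbitrary: thesis rule: lspan.induct)
  case lspan_0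
  show ?case by (rule lspan_0(1)[of "\<lambda>_. 0"]) simp
next
  case (lspan_step g f c)
  obtain w where w: "f = (\<Sum>mu\<in>B. mconst (w mu) * P mu)" using lspan_step.IH lspan_step.prems by blast
  obtain nu where nu: "nu \<in> B" "g = P nu" using lspan_step by blast
  have "mconst c * g + f = (\<Sum>mu\<in>B. (if mu = nu then mconst c * P mu else 0) + mconst (w mu) * P mu)"
    using nu lspan_step.prems by (simp add: sum.distrib w)
  also have "\<dots> = (\<Sum>mu\<in>B. mconst (w mu + (if mu = nu then c else 0)) * P mu)"
    by (intro sum.cong refl) (auto simp: mconst_add algebra_simps)
  finally show ?case by (rule lspan_step.prems)
qed

context nome
begin

definition qWhit_family :: "(nat \<Rightarrow> nat) \<Rightarrow> complex mfps" where
  "qWhit_family lam = (if is_partition lam then qWhit q (int_part lam) else 0)"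

lemma qWhit_family_symspan: "qWhit_family lam \<in> symspan"
  by (simp add: qWhit_family_def qWhit_symspan int_part_parts lspan_0)

lemma qWhit_family_form:
  "is_partition lam \<Longrightarrow> is_partition mu \<Longrightarrow>
    form (qWhit_family lam) (qWhit_family mu) = (if lam = mu then norm_wt q (int_part mu) else 0)"
  by (simp add: qWhit_family_def qWhit_orthogonal int_part_parts int_part_eq_iff)

lemma mcoeff_qWhit_partition:
  assumes lam: "is_partition lam" and mu: "is_partition mu"
  shows "mcoeff (qWhit q (int_part lam)) (mset_of_part lam) = 1"
    and "mcoeff (qWhit q (int_part lam)) (mset_of_part mu) \<noteq> 0 \<Longrightarrow> dominated mu lam"
proof -
  have supp: "\<exists>n. set_mset (mset_of_part nu) \<subseteq> {..<n} \<and> m \<le> n \<and> vanishes_from n (int_part nu)"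
    if "is_partition nu" for nu m
  proof -
    have "finite {i. nu i \<noteq> 0}" using partition_finite[OF that] .
    then obtain k where k: "\<forall>i\<in>{i. nu i \<noteq> 0}. i < k" unfolding finite_nat_set_iff_bounded by blast
    have "set_mset (mset_of_part nu) = {i. nu i \<noteq> 0}"
      using count_mset_of_part[OF that] by (simp add: set_mset_def)
    moreover have "nu i = 0" if "k \<le> i" for i
    proof (rule ccontr)
      assume "nu i \<noteq> 0"
      then have "i < k" using k by blast
      then show False using that by simp
    qed
    ultimately show ?thesis using k
      by (intro exI[of _ "max k m"]) (auto simp: vanishes_from_def int_part_def less_max_iff_disj)
  qed
  have coeff: "mcoeff (qWhit q (int_part lam)) (mset_of_part nu) = branch_coeff q (map nu [0..<n]) (int_part lam)"
    if "is_partition nu" "set_mset (mset_of_part nu) \<subseteq> {..<n}" for nu n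
    using mcoeff_qWhit[OF int_part_parts[OF lam] that(2)] by (simp add: count_mset_of_part[OF that(1)])
  obtain n where n: "set_mset (mset_of_part lam) \<subseteq> {..<n}" "vanishes_from n (int_part lam)"
    using supp[OF lam] by blast
  show "mcoeff (qWhit q (int_part lam)) (mset_of_part lam) = 1"
    using branch_coeff_leading[OF int_part_parts[OF lam] n(2)] coeff[OF lam n(1)]
    by (simp add: int_part_def)
  assume nz: "mcoeff (qWhit q (int_part lam)) (mset_of_part mu) \<noteq> 0"
  have bnz: "branch_coeff q (map mu [0..<n]) (int_part lam) \<noteq> 0" if "set_mset (mset_of_part mu) \<subseteq> {..<n}" for n
    using nz coeff[OF mu that] by simp
  show "dominated mu lam"
    unfolding dominated_def
  proof (intro conjI allI lam mu)
    obtain n where n: "set_mset (mset_of_part mu) \<subseteq> {..<n}" "vanishes_from n (int_part mu)"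
      using supp[OF mu] by blast
    have "int (psize lam) = (\<Sum>k\<leftarrow>map mu [0..<n]. int k)"
      using branch_coeff_weight[OF int_part_parts[OF lam] bnz[OF n(1)]] by (simp add: weight_int_part)
    also have "\<dots> = (\<Sum>i<n. int_part mu i)"
      by (simp add: int_part_def o_def interv_sum_list_conv_sum_set_nat atLeast0LessThan)
    also have "\<dots> = int (psize mu)" by (simp add: weight_eq[OF n(2), symmetric] weight_int_part)
    finally show "psize mu = psize lam" by simp
  next
    fix k
    obtain n where n: "set_mset (mset_of_part mu) \<subseteq> {..<n}" "k \<le> n"
      using supp[OF mu] by blast
    have "(\<Sum>j\<leftarrow>take k (map mu [0..<n]). int j) \<le> (\<Sum>i<k. int_part lam i)"
      by (rule branch_coeff_dominance[OF int_part_parts[OF lam] bnz[OF n(1)]])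
    also have "take k (map mu [0..<n]) = map mu [0..<k]" using n(2) by (simp add: take_map)
    also have "(\<Sum>j\<leftarrow>map mu [0..<k]. int j) = int (\<Sum>i<k. mu i)"
      by (simp add: o_def interv_sum_list_conv_sum_set_nat atLeast0LessThan)
    finally show "(\<Sum>i<k. mu i) \<le> (\<Sum>i<k. lam i)"
      by (simp add: int_part_def flip: of_nat_sum)
  qed
qed

lemma qWhit_family_triangular:
  assumes lam: "is_partition lam"
  shows "qWhit_family lam = monomial_sym lam + (\<Sum>mu | dominated mu lam \<and> mu \<noteq> lam.
    mscale (mcoeff (qWhit_family lam) (mset_of_part mu)) (monomial_sym mu))"
proof (rule mfps_eqI)
  fix M :: "nat multiset"
  let ?f = "qWhit q (int_part lam)"
  obtain nu \<pi> where nu: "is_partition nu" "bij \<pi>" "count M = nu \<circ> \<pi>" by (rule ex_sorted_exponents[of M])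
  have "mcoeff (\<Sum>mu | dominated mu lam \<and> mu \<noteq> lam. mscale (mcoeff ?f (mset_of_part mu)) (monomial_sym mu)) M =
      (\<Sum>mu | dominated mu lam \<and> mu \<noteq> lam. if mu = nu then mcoeff ?f (mset_of_part nu) else 0)"
    unfolding mcoeff_sum
    by (intro sum.cong refl) (auto simp: dominated_def mcoeff_monomial_sym[OF nu(1) _ nu(2,3)])
  also have "\<dots> = (if dominated nu lam \<and> nu \<noteq> lam then mcoeff ?f (mset_of_part nu) else 0)"
    using finite_subset[OF _ finite_dominated, of "{mu. dominated mu lam \<and> mu \<noteq> lam}" lam]
    by (simp add: sum.delta Collect_mono)
  finally have "mcoeff (\<Sum>mu | dominated mu lam \<and> mu \<noteq> lam.
      mscale (mcoeff ?f (mset_of_part mu)) (monomial_sym mu)) M =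
      (if dominated nu lam \<and> nu \<noteq> lam then mcoeff ?f (mset_of_part nu) else 0)" .
  moreover have "mcoeff ?f M = mcoeff ?f (mset_of_part nu)"
    by (intro sym_invariant_mcoeff[OF _ nu] sym_invariant_symspan qWhit_symspan int_part_parts lam)
  ultimately show "mcoeff (qWhit_family lam) M = mcoeff (monomial_sym lam + (\<Sum>mu | dominated mu lam \<and> mu \<noteq> lam.
    mscale (mcoeff (qWhit_family lam) (mset_of_part mu)) (monomial_sym mu))) M"
    using mcoeff_qWhit_partition[OF lam nu(1)]
    by (auto simp: qWhit_family_def lam mcoeff_monomial_sym[OF nu(1) lam nu(2,3)])
qed

lemma qWhit_family_is_macdonald: "is_macdonald_family q 0 qWhit_family"
  unfolding is_macdonald_family_def
proof (intro conjI allI impI)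
  fix lam assume "is_partition lam"
  then show "\<exists>u. qWhit_family lam = monomial_sym lam +
      (\<Sum>mu | dominated mu lam \<and> mu \<noteq> lam. mscale (u mu) (monomial_sym mu))"
    by (intro exI[of _ "\<lambda>mu. mcoeff (qWhit_family lam) (mset_of_part mu)"] qWhit_family_triangular)
qed (simp_all add: qWhit_family_form, simp add: qWhit_family_def)

lemma monomial_sym_lspan:
  "is_partition lam \<Longrightarrow> monomial_sym lam \<in> lspan (qWhit_family ` {mu. dominated mu lam})"
proof (induction lam rule: dominance_induct)
  case (less lam)
  let ?G = "qWhit_family ` {mu. dominated mu lam}"
  have "monomial_sym lam = qWhit_family lam - (\<Sum>mu | dominated mu lam \<and> mu \<noteq> lam.
      mscale (mcoeff (qWhit_family lam) (mset_of_part mu)) (monomial_sym mu))"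
    unfolding eq_diff_eq by (rule qWhit_family_triangular[OF less.prems, symmetric])
  also have "\<dots> \<in> lspan ?G"
  proof (intro lspan_diff lspan_sum)
    show "qWhit_family lam \<in> lspan ?G" by (intro lspan_base imageI) (simp add: dominated_refl less.prems)
    fix mu assume mu: "mu \<in> {mu. dominated mu lam \<and> mu \<noteq> lam}"
    then have "monomial_sym mu \<in> lspan (qWhit_family ` {nu. dominated nu mu})"
      by (intro less.IH) (auto simp: dominated_def)
    then have "monomial_sym mu \<in> lspan ?G"
      by (rule lspan_mono) (use mu dominated_trans in blast)
    then show "mscale (mcoeff (qWhit_family lam) (mset_of_part mu)) (monomial_sym mu) \<in> lspan ?G"
      unfolding mscale_eq by (rule lspan_mconst_mult)
  qed
  finally show ?case .
qed

text \<open>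
  The difference of two candidates for \<open>lam\<close> is a combination of the \<open>W_nu\<close> with \<open>nu < lam\<close>, where the candidates
  agree by induction. It is orthogonal to each of these \<open>W_nu\<close>, and their norms do not vanish.
\<close>

lemma macdonald_family_unique:
  assumes F: "is_macdonald_family q 0 F" shows "F lam = qWhit_family lam"
proof (induction lam rule: dominance_induct)
  case (less lam)
  show ?case
  proof (cases "is_partition lam")
    case False
    then show ?thesis using F by (simp add: is_macdonald_family_def qWhit_family_def)
  next
    case lam: True
    define D where "D = {mu. dominated mu lam \<and> mu \<noteq> lam}"
    have finD: "finite D" by (rule finite_subset[OF _ finite_dominated[of lam]]) (auto simp: D_def)
    obtain u where u: "F lam = monomial_sym lam + (\<Sum>mu\<in>D. mscale (u mu) (monomial_sym mu))"
      using F lam unfolding is_macdonald_family_def D_def by blast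
    have mono: "mscale c (monomial_sym mu) \<in> lspan (qWhit_family ` D)" if mu: "mu \<in> D" for mu c
    proof -
      have "monomial_sym mu \<in> lspan (qWhit_family ` {nu. dominated nu mu})"
        using mu by (intro monomial_sym_lspan) (auto simp: D_def dominated_def)
      moreover have "{nu. dominated nu mu} \<subseteq> D"
        using mu dominated_trans dominated_antisym by (auto simp: D_def)
      ultimately have "monomial_sym mu \<in> lspan (qWhit_family ` D)"
        by (rule lspan_mono[OF _ image_mono])
      then show ?thesis unfolding mscale_eq by (rule lspan_mconst_mult)
    qed
    have "F lam - qWhit_family lam = (\<Sum>mu\<in>D. mscale (u mu) (monomial_sym mu)) -
        (\<Sum>mu\<in>D. mscale (mcoeff (qWhit_family lam) (mset_of_part mu)) (monomial_sym mu))"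
      by (subst u, subst qWhit_family_triangular[OF lam]) (simp add: D_def)
    also have "\<dots> \<in> lspan (qWhit_family ` D)"
      by (intro lspan_diff lspan_sum mono)
    finally obtain w where w: "F lam - qWhit_family lam = (\<Sum>mu\<in>D. mconst (w mu) * qWhit_family mu)"
      using lspan_image finD by blast
    have "w nu = 0" if nu: "nu \<in> D" for nu
    proof -
      have nup: "is_partition nu" and ne: "lam \<noteq> nu" using nu by (auto simp: D_def dominated_def)
      have "F nu = qWhit_family nu" using nu by (intro less.IH) (auto simp: D_def)
      then have 0: "form (F lam) (qWhit_family nu) = 0"
        using F lam nup ne unfolding is_macdonald_family_def by metis
      let ?s = "\<Sum>mu\<in>D. mconst (w mu) * qWhit_family mu"
      have s: "?s \<in> symspan" by (intro lspan_sum lspan_mconst_mult qWhit_family_symspan)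
      have "form (qWhit_family lam + ?s) (qWhit_family nu) = form (qWhit_family lam) (qWhit_family nu) + form ?s (qWhit_family nu)"
        by (intro form_add_left s qWhit_family_symspan)
      also have "qWhit_family lam + ?s = F lam" by (simp flip: w)
      also have "form (qWhit_family lam) (qWhit_family nu) = 0"
        using qWhit_family_form[OF lam nup] ne by simp
      also have "form ?s (qWhit_family nu) = (\<Sum>mu\<in>D. w mu * form (qWhit_family mu) (qWhit_family nu))"
        by (subst form_sum_left)
           (auto simp: form_mconst_left qWhit_family_symspan intro!: lspan_mconst_mult qWhit_family_symspan)
      also have "\<dots> = (\<Sum>mu\<in>D. if mu = nu then w nu * norm_wt q (int_part nu) else 0)"
        using nup by (intro sum.cong refl) (auto simp: D_def dominated_def qWhit_family_form)
      also have "\<dots> = w nu * norm_wt q (int_part nu)" using nu finD by simp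
      finally show ?thesis using 0 norm_wt_nonzero by simp
    qed
    then have "F lam - qWhit_family lam = 0" unfolding w by (intro sum.neutral) simp
    then show ?thesis by simp
  qed
qed

theorem macdonald_P_eq:
  assumes "is_partition lam" shows "macdonald_P q 0 lam = qWhit q (int_part lam)"
proof -
  have "macdonald_P q 0 = qWhit_family"
    unfolding macdonald_P_def
    using qWhit_family_is_macdonald macdonald_family_unique by (intro the_equality) auto
  then show ?thesis using assms by (simp add: qWhit_family_def)
qed

end

section \<open>Baxter operator and \<open>q\<close>-Toda Hamiltonians\<close>

text \<open>
  In the adic topology of formal power series a sum converges as soon as only finitely many terms contribute to
  each coefficient.
\<close>

lemma infsum_fps_eq:
  fixes g :: "'b \<Rightarrow> complex fps"
  assumes "\<And>n. finite (U n)" "\<And>n. U n \<subseteq> A" "\<And>n mu. mu \<in> A - U n \<Longrightarrow> fps_nth (g mu) n = 0"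
  shows "infsum g A = Abs_fps (\<lambda>n. \<Sum>mu\<in>U n. fps_nth (g mu) n)"
proof (rule infsumI, unfold has_sum_def, rule tendsto_fpsI)
  fix n
  have "fps_nth (sum g Y) n = (\<Sum>mu\<in>U n. fps_nth (g mu) n)" if "finite Y" "U n \<subseteq> Y" "Y \<subseteq> A" for Y
    using that assms(3) by (simp add: fps_sum_nth) (rule sum.mono_neutral_right, auto)
  then show "\<forall>\<^sub>F Y in finite_subsets_at_top A. fps_nth (sum g Y) n = fps_nth (Abs_fps (\<lambda>n. \<Sum>mu\<in>U n. fps_nth (g mu) n)) n"
    unfolding eventually_finite_subsets_at_top using assms(1,2) by (intro exI[of _ "U n"]) auto
qed

definition kern :: "complex \<Rightarrow> nat \<Rightarrow> (nat \<Rightarrow> int) \<Rightarrow> (nat \<Rightarrow> int) \<Rightarrow> complex" where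
  "kern q l lam mu = iqf q (mu 0 - lam 0) * (\<Prod>i<l. iqf q (lam i - mu (Suc i)) * iqf q (mu (Suc i) - lam (Suc i)))"

lemma Q_kernel_eq:
  "Q_kernel q l z mu lam = z ^ nat (tsize l mu - tsize l lam) * fps_const (kern q l lam mu)"
  by (simp add: Q_kernel_def kern_def iqf_def)

lemma partition_tuples_iff: "mu \<in> partition_tuples l \<longleftrightarrow> mu \<in> parts \<and> vanishes_from (Suc l) mu"
proof
  assume mu: "mu \<in> partition_tuples l"
  then have van: "vanishes_from (Suc l) mu"
    by (auto simp: partition_tuples_def tuples_def vanishes_from_def Suc_le_eq)
  moreover have "antimono mu"
  proof (unfold antimono_iff_le_Suc, intro allI)
    fix i
    consider "i < l" | "i = l" | "l < i" by linarith
    then show "mu (Suc i) \<le> mu i"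
      using mu van by cases (auto simp: partition_tuples_def weakly_decreasing_def vanishes_from_def)
  qed
  ultimately show "mu \<in> parts \<and> vanishes_from (Suc l) mu" by (simp add: partsI)
next
  assume mu: "mu \<in> parts \<and> vanishes_from (Suc l) mu"
  then show "mu \<in> partition_tuples l"
    using parts_nonneg[of mu l] antimono_parts[of mu]
    by (auto simp: partition_tuples_def tuples_def weakly_decreasing_def vanishes_from_def Suc_le_eq)
qed

lemma tsize_eq_weight: "mu \<in> partition_tuples l \<Longrightarrow> tsize l mu = weight mu"
  using weight_eq[of "Suc l" mu] by (simp add: partition_tuples_iff tsize_def lessThan_Suc_atMost del: sum.lessThan_Suc)

lemma finite_bounded_partition_tuples: "finite {mu \<in> partition_tuples l. tsize l mu \<le> m}"
proof (rule finite_subset)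
  show "{mu \<in> partition_tuples l. tsize l mu \<le> m} \<subseteq> (\<Union>n\<in>{0..m}. parts_of n)"
    using tsize_eq_weight by (auto simp: parts_of_def partition_tuples_iff weight_nonneg)
qed (simp add: finite_parts_of)

context nome
begin

lemma kern_nonzeroD:
  assumes "kern q l lam mu \<noteq> 0"
  shows "lam 0 \<le> mu 0" "i < l \<Longrightarrow> mu (Suc i) \<le> lam i" "i < l \<Longrightarrow> lam (Suc i) \<le> mu (Suc i)"
  using assms by (auto simp: kern_def iqf_eq_0_iff not_less Ball_def)

lemma kern_nonzero_le:
  assumes "kern q l lam mu \<noteq> 0" "i \<le> l" shows "lam i \<le> mu i"
  using kern_nonzeroD[OF assms(1)] assms(2) by (cases i) auto

lemma kern_nonzero_tsize: "kern q l lam mu \<noteq> 0 \<Longrightarrow> tsize l lam \<le> tsize l mu"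
  unfolding tsize_def by (intro sum_mono) (auto simp: kern_nonzero_le)

lemma kern_nonzero_partition:
  assumes "kern q l lam mu \<noteq> 0" "lam \<in> partition_tuples l" "mu \<in> tuples l"
  shows "mu \<in> partition_tuples l"
proof -
  have "mu (Suc i) \<le> mu i" if "i < l" for i
    using kern_nonzeroD(2)[OF assms(1) that] kern_nonzero_le[OF assms(1), of i] that by simp
  moreover have "0 \<le> mu l"
    using kern_nonzero_le[OF assms(1), of l] assms(2) by (auto simp: partition_tuples_def)
  ultimately show ?thesis using assms(3) by (simp add: partition_tuples_def weakly_decreasing_def)
qed

lemma kern_nonzero_weakly_decreasing:
  assumes "kern q l lam mu \<noteq> 0" shows "weakly_decreasing l lam"
  using kern_nonzeroD(2,3)[OF assms] unfolding weakly_decreasing_def by (meson order_trans)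

text \<open>
  In the sorted list of \<open>I\<close>, closed by \<open>Suc l\<close>, the successor of \<open>i\<close> is \<open>i + 1\<close> precisely if \<open>i + 1 \<in> I\<close> or
  \<open>i = l\<close>. So the Hamiltonian has a factor for each row \<open>i < l\<close> in \<open>I\<close> with \<open>i + 1\<close> not in \<open>I\<close>.
\<close>

lemma Toda_coeff_eq:
  assumes I: "I \<subseteq> {..l}"
  shows "Toda_coeff q l I lam =
    (\<Prod>i<l. if i \<in> I \<and> Suc i \<notin> I then 1 - q powi (lam i - lam (Suc i) + 1) else 1)"
proof -
  define xs where "xs = sorted_list_of_set I"
  define h where "h i = 1 - q powi (lam i - lam (Suc i) + 1)" for i
  define g where "g i = (if i = l \<or> Suc i \<in> I then 1 else h i)" for i
  have fin: "finite I" using I finite_subset by blast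
  have set: "set xs = I" and dist: "distinct xs" and len: "length xs = card I"
    using fin by (auto simp: xs_def)
  have strict: "xs ! i < xs ! j" if "i < j" "j < length xs" for i j
    using that strict_sorted_list_of_set[of I] by (simp add: xs_def sorted_wrt_iff_nth_less)
  have succ: "(xs @ [Suc l]) ! Suc k - (xs @ [Suc l]) ! k = 1 \<longleftrightarrow> xs ! k = l \<or> Suc (xs ! k) \<in> I"
    if k: "k < length xs" for k
  proof -
    have kI: "xs ! k \<in> I" using k set by auto
    then have kl: "xs ! k \<le> l" using I by auto
    show ?thesis
    proof (cases "Suc k < length xs")
      case True
      have less: "xs ! k < xs ! Suc k" using strict True by simp
      have inI: "xs ! Suc k \<in> I" using True set by auto
      have "xs ! k \<noteq> l" using less inI I by auto
      moreover have "Suc (xs ! k) \<in> I \<longleftrightarrow> xs ! Suc k = Suc (xs ! k)"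
      proof
        assume "Suc (xs ! k) \<in> I"
        then obtain j where j: "j < length xs" "xs ! j = Suc (xs ! k)" using set by (metis in_set_conv_nth)
        have "k < j"
        proof (rule ccontr)
          assume "\<not> k < j"
          then have "xs ! j \<le> xs ! k" using strict[of j k] k by (cases "j = k") auto
          then show False using j by simp
        qed
        then have "xs ! Suc k \<le> xs ! j" using strict[of "Suc k" j] j by (cases "j = Suc k") auto
        then show "xs ! Suc k = Suc (xs ! k)" using less j by simp
      qed (use inI in simp)
      ultimately show ?thesis using True less by (auto simp: nth_append)
    next
      case False
      then have last: "Suc k = length xs" using k by simp
      have "Suc (xs ! k) \<notin> I"
      proof
        assume "Suc (xs ! k) \<in> I"
        then obtain j where j: "j < length xs" "xs ! j = Suc (xs ! k)" using set by (metis in_set_conv_nth)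
        then have "xs ! j \<le> xs ! k" using strict[of j k] k last by (cases "j = k") auto
        then show False using j by simp
      qed
      then show ?thesis using kl k last by (auto simp: nth_append)
    qed
  qed
  have "Toda_coeff q l I lam = (\<Prod>k<length xs. g (xs ! k))"
    unfolding Toda_coeff_def Let_def xs_def[symmetric] len[symmetric]
  proof (intro prod.cong refl)
    fix k assume "k \<in> {..<length xs}"
    then have k: "k < length xs" by simp
    show "(1 - q powi (lam ((xs @ [Suc l]) ! k) - lam (Suc ((xs @ [Suc l]) ! k)) + 1)) ^
        (if (xs @ [Suc l]) ! Suc k - (xs @ [Suc l]) ! k = 1 then 0 else 1) = g (xs ! k)"
      unfolding succ[OF k] using k by (simp add: g_def h_def nth_append)
  qed
  also have "\<dots> = (\<Prod>i\<in>I. g i)"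
    using prod.distinct_set_conv_list[OF dist, of g] by (simp add: set prod.list_conv_set_nth atLeast0LessThan)
  also have "\<dots> = (\<Prod>i<l. if i \<in> I \<and> Suc i \<notin> I then h i else 1)"
  proof -
    have "(\<Prod>i\<in>I. g i) = (\<Prod>i<Suc l. if i \<in> I then g i else 1)"
    proof -
      have "{..<Suc l} \<inter> I = I" using I by auto
      then show ?thesis using prod.inter_restrict[of "{..<Suc l}" g I] by simp
    qed
    then show ?thesis by (auto simp: g_def intro!: prod.cong)
  qed
  finally show ?thesis by (simp add: h_def cong: if_cong)
qed

text \<open>
  The last row has no lower neighbour, hence no factor with \<open>a l\<close>; this is encoded by \<open>A l = 0\<close>, and \<open>B = 1\<close> beyond
  it. The identity holds for arbitrary integer sequences because \<open>iqf\<close> handles the interlacing conditions.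
\<close>

lemma Toda_kern_sum:
  "(\<Sum>I\<in>Pow {..l}. (-1) ^ card I * Toda_coeff q l I lam * kern q l (add_ind lam I) mu) =
    q powi (tsize l mu - tsize l lam) * kern q l lam mu"
proof -
  define a where "a i = lam i - mu (Suc i)" for i
  define b where "b i = mu i - lam i" for i
  define A where "A i = (if i < l then q powi (a i + 1) else 0)" for i
  define B where "B i = (if i \<le> l then q powi b i else 1)" for i
  define C where "C = (\<Prod>i<l. iqf q (b i) * iqf q (a i + 1)) * iqf q (b l)"
  have kern: "kern q l lam' mu = (\<Prod>i<l. iqf q (mu i - lam' i) * iqf q (lam' i - mu (Suc i))) * iqf q (mu l - lam' l)" for lam'
  proof -
    have "iqf q (mu 0 - lam' 0) * (\<Prod>i<l. iqf q (mu (Suc i) - lam' (Suc i))) = (\<Prod>i<Suc l. iqf q (mu i - lam' i))"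
      by (rule prod.lessThan_Suc_shift[symmetric])
    then show ?thesis by (simp add: kern_def prod.distrib ac_simps)
  qed
  have summand: "(-1) ^ card I * Toda_coeff q l I lam * kern q l (add_ind lam I) mu =
      C * (\<Prod>i<Suc l. toda_local A B i (i \<in> I) (Suc i \<in> I))" if I: "I \<in> Pow {..l}" for I
  proof -
    have sl: "Suc l \<notin> I" and I': "I \<subseteq> {..<Suc l}" using I by (auto simp: lessThan_Suc_atMost)
    have "(\<Prod>i<l. (if i \<in> I \<and> \<not> Suc i \<in> I then 1 - q powi (a i + b (Suc i) + 1) else 1) *
        (iqf q (b i - of_bool (i \<in> I)) * iqf q (a i + of_bool (i \<in> I))) * (if i \<in> I then -1 else 1)) =
        (\<Prod>i<l. (iqf q (b i) * iqf q (a i + 1)) * toda_local A B i (i \<in> I) (Suc i \<in> I))"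
      by (intro prod.cong refl local_toda) (auto simp: A_def B_def)
    moreover have "iqf q (b l - of_bool (l \<in> I)) * (if l \<in> I then -1 else 1) =
        iqf q (b l) * toda_local A B l (l \<in> I) (Suc l \<in> I)"
      using sl iqf_diff_one[of "b l"] by (auto simp: toda_local_def A_def B_def of_bool_def algebra_simps)
    ultimately have e: "(\<Prod>i<l. (if i \<in> I \<and> \<not> Suc i \<in> I then 1 - q powi (a i + b (Suc i) + 1) else 1) *
        (iqf q (b i - of_bool (i \<in> I)) * iqf q (a i + of_bool (i \<in> I))) * (if i \<in> I then -1 else 1)) *
        (iqf q (b l - of_bool (l \<in> I)) * (if l \<in> I then -1 else 1)) =
        C * (\<Prod>i<Suc l. toda_local A B i (i \<in> I) (Suc i \<in> I))"
      by (simp add: C_def prod.distrib)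
    have sign: "(-1 :: complex) ^ card I = (\<Prod>i<l. if i \<in> I then -1 else 1) * (if l \<in> I then -1 else 1)"
      using prod_if_power_card[OF I', of "-1 :: complex"] by simp
    have toda: "Toda_coeff q l I lam =
        (\<Prod>i<l. if i \<in> I \<and> \<not> Suc i \<in> I then 1 - q powi (a i + b (Suc i) + 1) else 1)"
      using I by (subst Toda_coeff_eq) (auto simp: a_def b_def intro!: prod.cong)
    have kern_add: "kern q l (add_ind lam I) mu =
        (\<Prod>i<l. iqf q (b i - of_bool (i \<in> I)) * iqf q (a i + of_bool (i \<in> I))) * iqf q (b l - of_bool (l \<in> I))"
      unfolding kern by (simp add: add_ind_def a_def b_def of_bool_def algebra_simps cong: if_cong)
    show ?thesis
      unfolding sign toda kern_add e[symmetric] by (simp only: prod.distrib) (simp only: ac_simps)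
  qed
  have "(\<Sum>I\<in>Pow {..l}. (-1) ^ card I * Toda_coeff q l I lam * kern q l (add_ind lam I) mu) =
      (\<Sum>I\<in>Pow {..l}. C * (\<Prod>i<Suc l. toda_local A B i (i \<in> I) (Suc i \<in> I)))"
    by (intro sum.cong refl summand)
  also have "\<dots> = C * (\<Prod>i<Suc l. (1 - A i) * B i)"
    unfolding sum_distrib_left[symmetric] lessThan_Suc_atMost[symmetric]
    by (subst sum_toda_local) (simp_all add: B_def)
  also have "\<dots> = (\<Prod>i<Suc l. B i) * ((\<Prod>i<l. iqf q (b i) * ((1 - A i) * iqf q (a i + 1))) * iqf q (b l))"
    by (simp add: C_def A_def prod.distrib ac_simps)
  also have "(\<Prod>i<Suc l. B i) = q powi (\<Sum>i<Suc l. b i)"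
    by (simp only: power_int_sum[OF finite_lessThan]) (auto simp: B_def intro!: prod.cong)
  also have "(\<Sum>i<Suc l. b i) = tsize l mu - tsize l lam"
    by (simp add: b_def tsize_def sum_subtractf lessThan_Suc_atMost del: sum.lessThan_Suc)
  also have "(\<Prod>i<l. iqf q (b i) * ((1 - A i) * iqf q (a i + 1))) * iqf q (b l) = kern q l lam mu"
  proof -
    have "(\<Prod>i<l. iqf q (b i) * ((1 - A i) * iqf q (a i + 1))) = (\<Prod>i<l. iqf q (b i) * iqf q (a i))"
      by (intro prod.cong refl) (simp add: A_def flip: iqf_add_one)
    then show ?thesis unfolding kern by (simp add: a_def b_def)
  qed
  finally show ?thesis .
qed

definition Baxter_term :: "nat \<Rightarrow> complex \<Rightarrow> (nat \<Rightarrow> int) \<Rightarrow>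
    ((nat \<Rightarrow> int) \<Rightarrow> complex fps) \<Rightarrow> nat \<Rightarrow> (nat \<Rightarrow> int) \<Rightarrow> complex" where
  "Baxter_term l c lam f n mu = (let k = nat (tsize l mu - tsize l lam) in
     if k \<le> n then Delta_q q l mu * c ^ k * kern q l lam mu * fps_nth (f mu) (n - k) else 0)"

lemma fps_nth_Baxter_summand:
  "fps_nth (fps_const (Delta_q q l mu) * Q_kernel q l (fps_const c * fps_X) mu lam * f mu) n =
    Baxter_term l c lam f n mu"
proof -
  define k where "k = nat (tsize l mu - tsize l lam)"
  have e: "fps_const (Delta_q q l mu) * Q_kernel q l (fps_const c * fps_X) mu lam * f mu =
      fps_const (Delta_q q l mu * c ^ k * kern q l lam mu) * (fps_X ^ k * f mu)"
    by (simp add: Q_kernel_eq k_def power_mult_distrib fps_const_power algebra_simps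
        flip: fps_const_mult)
  show ?thesis unfolding e Baxter_term_def k_def[symmetric] Let_def by (simp add: fps_X_power_mult_nth)
qed

text \<open>
  The bound \<open>m\<close> on the size is left free so that the coefficients of \<open>Baxter_Q\<close> at \<open>lam\<close> and at all
  \<open>lam + e_I\<close> can be written as sums over the same finite set.
\<close>

lemma fps_nth_Baxter_Q:
  assumes lam: "lam \<in> partition_tuples l" and m: "tsize l lam + int n \<le> m"
  shows "fps_nth (Baxter_Q q l (fps_const c * fps_X) f lam) n =
    (\<Sum>mu\<in>{mu \<in> partition_tuples l. tsize l mu \<le> m}. Baxter_term l c lam f n mu)"
proof -
  let ?g = "\<lambda>mu. fps_const (Delta_q q l mu) * Q_kernel q l (fps_const c * fps_X) mu lam * f mu"
  define U where "U k = {mu \<in> partition_tuples l. tsize l mu \<le> max m (tsize l lam + int k)}" for k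
  have zero: "fps_nth (?g mu) k = 0" if "mu \<in> tuples l - U k" for mu k
  proof (cases "kern q l lam mu = 0")
    case False
    then have "mu \<in> partition_tuples l" using kern_nonzero_partition lam that by blast
    then have "\<not> nat (tsize l mu - tsize l lam) \<le> k" using that by (auto simp: U_def)
    then show ?thesis by (simp add: fps_nth_Baxter_summand Baxter_term_def)
  qed (simp add: fps_nth_Baxter_summand Baxter_term_def Let_def)
  have "Baxter_Q q l (fps_const c * fps_X) f lam = Abs_fps (\<lambda>n. \<Sum>mu\<in>U n. fps_nth (?g mu) n)"
    unfolding Baxter_Q_def
  proof (rule infsum_fps_eq)
    show "finite (U k)" for k by (simp add: U_def finite_bounded_partition_tuples)
    show "U k \<subseteq> tuples l" for k by (auto simp: U_def partition_tuples_def)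
  qed (rule zero)
  moreover have "U n = {mu \<in> partition_tuples l. tsize l mu \<le> m}" using m by (auto simp: U_def)
  ultimately show ?thesis by (simp add: fps_nth_Baxter_summand)
qed

text \<open>
  The power of \<open>z\<close> in front of a Hamiltonian compensates the smaller power of \<open>z\<close> in the kernel at \<open>lam + e_I\<close>,
  so that for each \<open>mu\<close> only the numerical identity \<open>Toda_kern_sum\<close> remains; the power of \<open>q\<close> in it is the
  substitution of \<open>q z\<close> for \<open>z\<close>. Where \<open>lam + e_I\<close> is not weakly decreasing the kernel vanishes anyway.
\<close>

theorem Toda_D_Baxter_Q:
  assumes lam: "lam \<in> partition_tuples l"
  shows "Toda_D q l (- fps_X) (Baxter_Q q l fps_X f) lam = Baxter_Q q l (fps_const q * fps_X) f lam"
proof (rule fps_ext)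
  fix n
  define V where "V = {mu \<in> partition_tuples l. tsize l mu \<le> tsize l lam + int n}"
  define k where "k mu = nat (tsize l mu - tsize l lam)" for mu
  \<comment> \<open>Everything in the \<open>n\<close>-th coefficient that depends on \<open>mu\<close> only, and not on \<open>I\<close>.\<close>
  define w where "w mu = (if k mu \<le> n then Delta_q q l mu * fps_nth (f mu) (n - k mu) else 0)" for mu
  define F where "F I = (if weakly_decreasing l (add_ind lam I) then Baxter_Q q l fps_X f (add_ind lam I) else 0)" for I
  have H: "Toda_H q l r (Baxter_Q q l fps_X f) lam = (\<Sum>I | I \<subseteq> {..l} \<and> card I = r. fps_const (Toda_coeff q l I lam) * F I)" for r
  proof (cases "r = 0")
    case True
    have "{I. I \<subseteq> {..l} \<and> card I = 0} = {{}}"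
      using finite_subset[OF _ finite_atMost[of l]] by auto
    moreover have "add_ind lam {} = lam" by (simp add: add_ind_def)
    moreover have "weakly_decreasing l lam" using lam by (simp add: partition_tuples_def)
    ultimately show ?thesis using True by (simp add: Toda_H_def F_def Toda_coeff_eq)
  qed (simp add: Toda_H_def F_def)
  have coeff: "fps_nth ((- fps_X) ^ card I * (fps_const (Toda_coeff q l I lam) * F I)) n =
      (\<Sum>mu\<in>V. w mu * ((-1) ^ card I * Toda_coeff q l I lam * kern q l (add_ind lam I) mu))"
    if I: "I \<subseteq> {..l}" for I
  proof -
    define r where "r = card I"
    have ts: "tsize l (add_ind lam I) = tsize l lam + int r"
    proof -
      have "{..l} \<inter> I = I" using I by auto
      then have "(\<Sum>i\<le>l. if i \<in> I then 1 else (0::int)) = int r"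
        by (simp add: sum.If_cases r_def)
      then show ?thesis by (simp add: tsize_def add_ind_def sum.distrib)
    qed
    have X: "(- fps_X :: complex fps) ^ r = fps_const ((-1) ^ r) * fps_X ^ r"
      by (cases "even r") simp_all
    have nthF: "(if n < r then 0 else fps_nth (F I) (n - r)) = (\<Sum>mu\<in>V. w mu * kern q l (add_ind lam I) mu)"
    proof (cases "weakly_decreasing l (add_ind lam I)")
      case False
      then have "kern q l (add_ind lam I) mu = 0" for mu using kern_nonzero_weakly_decreasing by blast
      then show ?thesis using False by (simp add: F_def)
    next
      case True
      have lam': "add_ind lam I \<in> partition_tuples l"
        using True lam I by (auto simp: partition_tuples_def tuples_def add_ind_def)
      have large: "int r \<le> tsize l mu - tsize l lam" if "kern q l (add_ind lam I) mu \<noteq> 0" for mu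
        using kern_nonzero_tsize[OF that] ts by simp
      show ?thesis
      proof (cases "n < r")
        case less: True
        have "kern q l (add_ind lam I) mu = 0" if "mu \<in> V" for mu
          using large[of mu] less that by (force simp: V_def)
        then show ?thesis using less by simp
      next
        case False
        have "fps_nth (F I) (n - r) = fps_nth (Baxter_Q q l (fps_const 1 * fps_X) f (add_ind lam I)) (n - r)"
          using True by (simp add: F_def)
        also have "\<dots> = (\<Sum>mu\<in>V. Baxter_term l 1 (add_ind lam I) f (n - r) mu)"
          unfolding V_def using False ts by (intro fps_nth_Baxter_Q lam') (simp add: of_nat_diff)
        also have "\<dots> = (\<Sum>mu\<in>V. w mu * kern q l (add_ind lam I) mu)"
        proof (intro sum.cong refl)
          fix mu assume mu: "mu \<in> V"
          show "Baxter_term l 1 (add_ind lam I) f (n - r) mu =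
            w mu * kern q l (add_ind lam I) mu"
          proof (cases "kern q l (add_ind lam I) mu = 0")
            case nz: False
            have "nat (tsize l mu - tsize l (add_ind lam I)) = k mu - r" "r \<le> k mu"
              using large[OF nz] by (auto simp: k_def ts)
            moreover have "k mu \<le> n" using mu by (auto simp: k_def V_def)
            ultimately show ?thesis by (simp add: w_def Baxter_term_def Let_def)
          qed (simp add: Baxter_term_def Let_def)
        qed
        finally show ?thesis using False by simp
      qed
    qed
    have "fps_nth ((- fps_X) ^ card I * (fps_const (Toda_coeff q l I lam) * F I)) n =
        fps_nth (fps_const ((-1) ^ r * Toda_coeff q l I lam) * (fps_X ^ r * F I)) n"
      unfolding r_def[symmetric] X by (simp add: algebra_simps flip: fps_const_mult)
    also have "\<dots> = (-1) ^ r * Toda_coeff q l I lam * (if n < r then 0 else fps_nth (F I) (n - r))"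
      by (simp add: fps_X_power_mult_nth)
    finally show ?thesis
      unfolding nthF by (simp add: r_def sum_distrib_left algebra_simps)
  qed
  have "Toda_D q l (- fps_X) (Baxter_Q q l fps_X f) lam =
      (\<Sum>r\<le>Suc l. \<Sum>I | I \<in> Pow {..l} \<and> card I = r. (- fps_X) ^ card I * (fps_const (Toda_coeff q l I lam) * F I))"
    unfolding Toda_D_def H sum_distrib_left by (intro sum.cong) auto
  also have "\<dots> = (\<Sum>I\<in>Pow {..l}. (- fps_X) ^ card I * (fps_const (Toda_coeff q l I lam) * F I))"
  proof (rule sum.group)
    show "card ` Pow {..l} \<subseteq> {..Suc l}"
      using card_mono[OF finite_atMost[of l]] by (auto simp: image_subset_iff)
  qed auto
  finally have "fps_nth (Toda_D q l (- fps_X) (Baxter_Q q l fps_X f) lam) n =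
      (\<Sum>I\<in>Pow {..l}. \<Sum>mu\<in>V. w mu * ((-1) ^ card I * Toda_coeff q l I lam * kern q l (add_ind lam I) mu))"
    by (simp add: fps_sum_nth coeff)
  also have "\<dots> = (\<Sum>mu\<in>V. w mu * (\<Sum>I\<in>Pow {..l}. (-1) ^ card I * Toda_coeff q l I lam * kern q l (add_ind lam I) mu))"
    unfolding sum_distrib_left by (rule sum.swap)
  also have "\<dots> = (\<Sum>mu\<in>V. Baxter_term l q lam f n mu)"
  proof (intro sum.cong refl)
    fix mu assume "mu \<in> V"
    have "q powi (tsize l mu - tsize l lam) * kern q l lam mu = q ^ k mu * kern q l lam mu"
    proof (cases "kern q l lam mu = 0")
      case False
      then have "tsize l mu - tsize l lam = int (k mu)" using kern_nonzero_tsize by (simp add: k_def)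
      then show ?thesis by simp
    qed simp
    then show "w mu * (\<Sum>I\<in>Pow {..l}. (-1) ^ card I * Toda_coeff q l I lam * kern q l (add_ind lam I) mu) =
      Baxter_term l q lam f n mu"
      unfolding Toda_kern_sum by (simp add: w_def k_def Baxter_term_def Let_def)
  qed
  also have "\<dots> = fps_nth (Baxter_Q q l (fps_const q * fps_X) f lam) n"
    unfolding V_def by (rule fps_nth_Baxter_Q[OF lam order_refl, symmetric])
  finally show "fps_nth (Toda_D q l (- fps_X) (Baxter_Q q l fps_X f) lam) n =
      fps_nth (Baxter_Q q l (fps_const q * fps_X) f lam) n" .
qed

end

section \<open>Evaluation in finitely many variables\<close>

text \<open>
  On series of bounded degree \<open>meval\<close> is a finite sum over an index set that does not depend on the series, and
  so it is linear and multiplicative there.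
\<close>

definition degree_le :: "nat \<Rightarrow> complex mfps \<Rightarrow> bool" where
  "degree_le d f \<longleftrightarrow> (\<forall>M. mcoeff f M \<noteq> 0 \<longrightarrow> size M \<le> d)"

definition monomials_le :: "nat \<Rightarrow> nat \<Rightarrow> nat multiset set" where
  "monomials_le l d = {M. set_mset M \<subseteq> {..l} \<and> size M \<le> d}"

lemma finite_monomials_le: "finite (monomials_le l d)"
proof -
  let ?K = "\<Sum>i\<in>{..l}. replicate_mset d i"
  have "M \<subseteq># ?K" if M: "M \<in> monomials_le l d" for M
  proof (rule mset_subset_eqI)
    fix i
    have cnt: "count ?K i = (if i \<le> l then d else 0)"
      by (simp add: count_sum if_distrib[of "\<lambda>x. _ x"] cong: if_cong)
    show "count M i \<le> count ?K i"
    proof (cases "i \<in># M")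
      case True
      then have "i \<le> l" using M by (auto simp: monomials_le_def)
      moreover have "count M i \<le> size M" by (rule count_le_size)
      ultimately show ?thesis using M cnt by (simp add: monomials_le_def)
    qed (simp add: not_in_iff)
  qed
  then have "monomials_le l d \<subseteq> fst ` {(A, B). A + B = ?K}"
    by (force simp: image_iff intro: subset_mset.add_diff_inverse)
  then show ?thesis using finite_mset_splits[of ?K] by (meson finite_imageI finite_subset)
qed

lemma meval_eq:
  assumes "degree_le d f"
  shows "meval l f x = (\<Sum>M\<in>monomials_le l d. mcoeff f M * (\<Prod>i\<in>#M. x i))"
  unfolding meval_def
  by (rule sum.mono_neutral_left[OF finite_monomials_le])
     (use assms in \<open>auto simp: monomials_le_def degree_le_def\<close>)

lemma meval_sum:
  assumes "\<And>i. i \<in> S \<Longrightarrow> degree_le d (f i)"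
  shows "meval l (\<Sum>i\<in>S. mconst (c i) * f i) x = (\<Sum>i\<in>S. c i * meval l (f i) x)"
proof -
  have "mcoeff (\<Sum>i\<in>S. mconst (c i) * f i) M = 0" if "\<not> size M \<le> d" for M
    using assms that by (auto simp: degree_le_def intro!: sum.neutral)
  then have d: "degree_le d (\<Sum>i\<in>S. mconst (c i) * f i)" by (auto simp: degree_le_def)
  have "meval l (\<Sum>i\<in>S. mconst (c i) * f i) x =
      (\<Sum>M\<in>monomials_le l d. \<Sum>i\<in>S. c i * (mcoeff (f i) M * (\<Prod>i\<in>#M. x i)))"
    by (simp add: meval_eq[OF d] sum_distrib_right mult.assoc)
  also have "\<dots> = (\<Sum>i\<in>S. \<Sum>M\<in>monomials_le l d. c i * (mcoeff (f i) M * (\<Prod>i\<in>#M. x i)))"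
    by (rule sum.swap)
  also have "\<dots> = (\<Sum>i\<in>S. c i * meval l (f i) x)"
    by (intro sum.cong refl) (simp add: meval_eq[OF assms] sum_distrib_left)
  finally show ?thesis .
qed

lemma meval_mult:
  assumes f: "degree_le d f" and g: "degree_le e g"
  shows "meval l (f * g) x = meval l f x * meval l g x"
proof -
  let ?v = "\<lambda>M. \<Prod>i\<in>#M. x i"
  define h where "h = (\<lambda>(A, B). (mcoeff f A * ?v A) * (mcoeff g B * ?v B))"
  let ?P = "monomials_le l d \<times> monomials_le l e"
  have conv: "mcoeff (f * g) M * ?v M = (\<Sum>p\<in>{(A, B). A + B = M}. h p)" for M
    by (auto simp: mcoeff_mult sum_distrib_right h_def intro!: sum.cong)
  have "mcoeff (f * g) M = 0" if "\<not> size M \<le> d + e" for M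
    unfolding mcoeff_mult
  proof (intro sum.neutral ballI)
    fix p assume "p \<in> {(A, B). A + B = M}"
    then obtain A B where p: "p = (A, B)" "A + B = M" by auto
    then have "\<not> size A \<le> d \<or> \<not> size B \<le> e" using that by auto
    then show "(case p of (A, B) \<Rightarrow> mcoeff f A * mcoeff g B) = 0"
      using f g p by (auto simp: degree_le_def)
  qed
  then have "degree_le (d + e) (f * g)" by (auto simp: degree_le_def)
  then have "meval l (f * g) x = (\<Sum>M\<in>monomials_le l (d + e). \<Sum>p\<in>{(A, B). A + B = M}. h p)"
    by (simp add: meval_eq conv)
  also have "\<dots> = (\<Sum>M\<in>monomials_le l (d + e). \<Sum>p | p \<in> ?P \<and> fst p + snd p = M. h p)"
  proof (rule sum.cong[OF refl])
    fix M assume M: "M \<in> monomials_le l (d + e)"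
    have "h p = 0" if p: "p \<in> {(A, B). A + B = M} - {p \<in> ?P. fst p + snd p = M}" for p
    proof -
      obtain A B where AB: "p = (A, B)" "A + B = M" using p by auto
      then have "set_mset A \<subseteq> {..l}" "set_mset B \<subseteq> {..l}" using M by (auto simp: monomials_le_def)
      then have "\<not> size A \<le> d \<or> \<not> size B \<le> e" using p AB by (auto simp: monomials_le_def)
      then show "h p = 0" using f g AB by (auto simp: degree_le_def h_def)
    qed
    then show "(\<Sum>p\<in>{(A, B). A + B = M}. h p) = (\<Sum>p | p \<in> ?P \<and> fst p + snd p = M. h p)"
      by (intro sum.mono_neutral_right finite_mset_splits) auto
  qed
  also have "\<dots> = (\<Sum>p\<in>?P. h p)"
  proof (rule sum.group)
    show "(\<lambda>p. fst p + snd p) ` ?P \<subseteq> monomials_le l (d + e)"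
      by (auto simp: monomials_le_def)
  qed (auto simp: finite_monomials_le)
  also have "\<dots> = meval l f x * meval l g x"
    by (simp add: meval_eq[OF f] meval_eq[OF g] h_def sum_product sum.cartesian_product)
  finally show ?thesis .
qed

lemma nat_part_of_int_part:
  assumes "lam \<in> parts"
  shows "is_partition (\<lambda>i. nat (lam i))" "int_part (\<lambda>i. nat (lam i)) = lam"
proof -
  show "is_partition (\<lambda>i. nat (lam i))"
  proof -
    have "antimono (\<lambda>i. nat (lam i))"
      using antimono_parts[OF assms] by (auto intro!: antimonoI nat_mono)
    moreover have "finite {i. nat (lam i) \<noteq> 0}"
      by (rule finite_subset[of _ "{i. lam i \<noteq> 0}"]) (use assms in \<open>auto simp: parts_def\<close>)
    ultimately show ?thesis by (simp add: is_partition_def)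
  qed
  show "int_part (\<lambda>i. nat (lam i)) = lam"
    using parts_nonneg[OF assms] by (simp add: int_part_def fun_eq_iff)
qed

context nome
begin

lemma degree_le_qWhit:
  assumes "lam \<in> parts" shows "degree_le (nat (weight lam)) (qWhit q lam)"
  unfolding degree_le_def
proof (intro allI impI)
  fix M assume nz: "mcoeff (qWhit q lam) M \<noteq> 0"
  obtain n where n: "set_mset M \<subseteq> {..<n}"
    using finite_nat_set_iff_bounded[of "set_mset M"] by auto
  have "branch_coeff q (map (count M) [0..<n]) lam \<noteq> 0" using nz mcoeff_qWhit[OF assms n] by simp
  then have "weight lam = (\<Sum>k\<leftarrow>map (count M) [0..<n]. int k)" by (rule branch_coeff_weight[OF assms])
  also have "\<dots> = int (\<Sum>i<n. count M i)"
    by (simp add: o_def interv_sum_list_conv_sum_set_nat atLeast0LessThan)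
  also have "(\<Sum>i<n. count M i) = size M"
    unfolding size_multiset_overloaded_eq by (rule sum.mono_neutral_right) (use n in \<open>auto simp: not_in_iff\<close>)
  finally show "size M \<le> nat (weight lam)" by simp
qed

lemma degree_le_cplt: "degree_le n (cplt q (int n))"
  by (simp add: degree_le_def cplt_def)

text \<open>
  Each peeled variable removes a horizontal strip and shortens the partition by at most one row.
\<close>

lemma meval_qWhit_too_long:
  assumes "lam \<in> parts" "\<not> vanishes_from (Suc l) lam" shows "meval l (qWhit q lam) x = 0"
  unfolding meval_eq[OF degree_le_qWhit[OF assms(1)]]
proof (intro sum.neutral ballI)
  fix M assume "M \<in> monomials_le l (nat (weight lam))"
  then have M: "set_mset M \<subseteq> {..<Suc l}" by (auto simp: monomials_le_def less_Suc_eq_le)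
  have "mcoeff (qWhit q lam) M = 0"
    using branch_coeff_vanishes[OF assms(1), of "map (count M) [0..<Suc l]"] assms(2)
      mcoeff_qWhit[OF assms(1) M] by auto
  then show "mcoeff (qWhit q lam) M * (\<Prod>i\<in>#M. x i) = 0" by simp
qed

lemma sum_multisets_prod:
  fixes a :: "nat \<Rightarrow> nat \<Rightarrow> complex"
  assumes "\<And>i. a i 0 = 1"
  shows "(\<Sum>M | set_mset M \<subseteq> {..<m} \<and> size M = n. \<Prod>i<m. a i (count M i)) =
    fps_nth (\<Prod>i<m. Abs_fps (a i)) n"
proof (induction m arbitrary: n)
  case 0
  have "{M. set_mset M \<subseteq> {..<0::nat} \<and> size M = n} = (if n = 0 then {{#}} else {})" by auto
  then show ?case by simp
next
  case (Suc m)
  have fin: "finite {M. set_mset M \<subseteq> {..<m} \<and> size M = n}" for n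
  proof (cases m)
    case (Suc k)
    then have "{M. set_mset M \<subseteq> {..<m} \<and> size M = n} \<subseteq> monomials_le k n"
      by (auto simp: monomials_le_def less_Suc_eq_le)
    then show ?thesis using finite_monomials_le finite_subset by blast
  qed (simp add: conj_commute)
  have "fps_nth (\<Prod>i<Suc m. Abs_fps (a i)) n = fps_nth (Abs_fps (a m) * (\<Prod>i<m. Abs_fps (a i))) n"
    by (simp add: mult.commute)
  also have "\<dots> = (\<Sum>k\<in>{0..n}. a m k * (\<Sum>M | set_mset M \<subseteq> {..<m} \<and> size M = n - k. \<Prod>i<m. a i (count M i)))"
    by (simp add: fps_mult_nth Suc.IH)
  also have "\<dots> = (\<Sum>(k, M)\<in>Sigma {0..n} (\<lambda>k. {M. set_mset M \<subseteq> {..<m} \<and> size M = n - k}).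
      a m k * (\<Prod>i<m. a i (count M i)))"
    unfolding sum_distrib_left by (subst sum.Sigma) (use fin in auto)
  also have "\<dots> = (\<Sum>M | set_mset M \<subseteq> {..<Suc m} \<and> size M = n. \<Prod>i<Suc m. a i (count M i))"
  proof (rule sum.reindex_bij_witness[where
      j = "\<lambda>(k, M). replicate_mset k m + M" and i = "\<lambda>M. (count M m, filter_mset (\<lambda>i. i \<noteq> m) M)"])
    fix p assume "p \<in> Sigma {0..n} (\<lambda>k. {M. set_mset M \<subseteq> {..<m} \<and> size M = n - k})"
    then obtain k M where p: "p = (k, M)" "k \<le> n" "set_mset M \<subseteq> {..<m}" "size M = n - k" by auto
    have m: "m \<notin># M" using p by auto
    then have "filter_mset (\<lambda>i. i \<noteq> m) M = M" by (intro multiset_eqI) (auto simp: not_in_iff)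
    then show "(\<lambda>M. (count M m, filter_mset (\<lambda>i. i \<noteq> m) M)) ((\<lambda>(k, M). replicate_mset k m + M) p) = p"
      using p m by (simp add: not_in_iff)
    show "(\<lambda>(k, M). replicate_mset k m + M) p \<in> {M. set_mset M \<subseteq> {..<Suc m} \<and> size M = n}"
      using p by (auto simp: less_Suc_eq)
    show "(\<Prod>i<Suc m. a i (count ((\<lambda>(k, M). replicate_mset k m + M) p) i)) =
        (case p of (k, M) \<Rightarrow> a m k * (\<Prod>i<m. a i (count M i)))"
      using p m by (simp add: not_in_iff mult.commute)
  next
    fix M assume M: "M \<in> {M. set_mset M \<subseteq> {..<Suc m} \<and> size M = n}"
    have part: "replicate_mset (count M m) m + filter_mset (\<lambda>i. i \<noteq> m) M = M"
      by (rule multiset_eqI) auto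
    then show "(\<lambda>(k, M). replicate_mset k m + M) (count M m, filter_mset (\<lambda>i. i \<noteq> m) M) = M" by simp
    have "count M m + size (filter_mset (\<lambda>i. i \<noteq> m) M) = n"
      using arg_cong[OF part, of size] M by simp
    then show "(count M m, filter_mset (\<lambda>i. i \<noteq> m) M) \<in> Sigma {0..n} (\<lambda>k. {M. set_mset M \<subseteq> {..<m} \<and> size M = n - k})"
      using M by (auto simp: less_Suc_eq)
  qed
  finally show ?case by simp
qed

lemma meval_cplt:
  "meval l (cplt q (int n)) x = fps_nth (\<Prod>i\<le>l. Abs_fps (\<lambda>k. iqf q (int k) * x i ^ k)) n"
proof -
  have "meval l (cplt q (int n)) x = (\<Sum>M\<in>monomials_le l n. mcoeff (cplt q (int n)) M * (\<Prod>i\<in>#M. x i))"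
    by (rule meval_eq[OF degree_le_cplt])
  also have "\<dots> = (\<Sum>M | set_mset M \<subseteq> {..<Suc l} \<and> size M = n. \<Prod>i<Suc l. iqf q (int (count M i)) * x i ^ count M i)"
  proof (rule sum.mono_neutral_cong_right[OF finite_monomials_le])
    show "{M. set_mset M \<subseteq> {..<Suc l} \<and> size M = n} \<subseteq> monomials_le l n"
      by (auto simp: monomials_le_def less_Suc_eq_le)
    show "\<forall>M\<in>monomials_le l n - {M. set_mset M \<subseteq> {..<Suc l} \<and> size M = n}.
        mcoeff (cplt q (int n)) M * (\<Prod>i\<in>#M. x i) = 0"
      by (auto simp: monomials_le_def less_Suc_eq_le cplt_def)
    fix M assume M: "M \<in> {M. set_mset M \<subseteq> {..<Suc l} \<and> size M = n}"
    have "mcoeff (cplt q (int n)) M * (\<Prod>i\<in>#M. x i) =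
        (\<Prod>i\<in>set_mset M. iqf q (int (count M i)) * x i ^ count M i)"
      using M by (simp add: cplt_def image_prod_mset_multiplicity prod.distrib)
    also have "\<dots> = (\<Prod>i<Suc l. iqf q (int (count M i)) * x i ^ count M i)"
      by (rule prod.mono_neutral_left) (use M in \<open>auto simp: not_in_iff\<close>)
    finally show "mcoeff (cplt q (int n)) M * (\<Prod>i\<in>#M. x i) =
        (\<Prod>i<Suc l. iqf q (int (count M i)) * x i ^ count M i)" .
  qed
  also have "\<dots> = fps_nth (\<Prod>i<Suc l. Abs_fps (\<lambda>k. iqf q (int k) * x i ^ k)) n"
    by (rule sum_multisets_prod) simp
  finally show ?thesis by (simp only: lessThan_Suc_atMost)
qed

section \<open>The \<open>q\<close>-binomial theorem for the eigenvalue\<close>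

text \<open>
  Only a neighbourhood of 0 is needed. For \<open>\<bar>w\<bar> < (1 - \<bar>q\<bar>) / 2\<close> the ratio of consecutive terms is at most
  \<open>1 / 2\<close> because \<open>\<bar>1 - q\<^sup>n\<bar> \<ge> 1 - \<bar>q\<bar>\<close> for \<open>n \<ge> 1\<close>.
\<close>

lemma summable_qexp:
  assumes "norm w < (1 - norm q) / 2" shows "summable (\<lambda>n. iqf q (int n) * w ^ n)"
proof (rule summable_ratio_test[of "1 / 2" 0])
  fix n
  have e: "iqf q (int n) = (1 - q ^ Suc n) * iqf q (int (Suc n))"
    using iqf_diff_one[of "int (Suc n)", unfolded power_int_of_nat] by simp
  have "norm (q ^ Suc n) \<le> norm q"
    using norm_q power_le_one[of "norm q" n] by (simp add: norm_mult norm_power mult_left_le)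
  then have "1 - norm q \<le> norm (1 - q ^ Suc n)"
    using norm_triangle_ineq2[of 1 "q ^ Suc n"] by simp
  then have "2 * norm w \<le> norm (1 - q ^ Suc n)" using assms by simp
  then have "(2 * norm w) * norm (iqf q (int (Suc n))) \<le> norm (1 - q ^ Suc n) * norm (iqf q (int (Suc n)))"
    by (rule mult_right_mono) simp
  also have "\<dots> = norm (iqf q (int n))" by (subst e) (simp add: norm_mult)
  finally have "(2 * norm w * norm (iqf q (int (Suc n)))) * norm w ^ n \<le> norm (iqf q (int n)) * norm w ^ n"
    by (rule mult_right_mono) simp
  then show "norm (iqf q (int (Suc n)) * w ^ Suc n) \<le> 1 / 2 * norm (iqf q (int n) * w ^ n)"
    by (simp add: norm_mult norm_power algebra_simps)
qed simp

definition qexp :: "complex \<Rightarrow> complex" where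
  "qexp w = (\<Sum>n. iqf q (int n) * w ^ n)"

lemma qexp_functional:
  assumes "norm w < (1 - norm q) / 2" shows "qexp (w * q) = (1 - w) * qexp w"
proof -
  have s: "summable (\<lambda>n. iqf q (int n) * w ^ n)" by (rule summable_qexp[OF assms])
  have "(\<lambda>n. iqf q (int n) * w ^ n) sums qexp w"
    unfolding qexp_def using s by (rule summable_sums)
  then have 1: "(\<lambda>n. w * (iqf q (int n) * w ^ n)) sums (w * qexp w)" by (rule sums_mult)
  have "(\<lambda>n. iqf q (int n - 1) * w ^ n) sums (w * qexp w)"
  proof -
    have "(\<lambda>n. iqf q (int (Suc n) - 1) * w ^ Suc n) sums (w * qexp w)"
      using 1 by (simp add: algebra_simps)
    then show ?thesis using sums_Suc_iff[of "\<lambda>n. iqf q (int n - 1) * w ^ n"] by (simp add: iqf_neg)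
  qed
  from sums_diff[OF summable_sums[OF s] this]
  have "(\<lambda>n. iqf q (int n) * w ^ n - iqf q (int n - 1) * w ^ n) sums (qexp w - w * qexp w)"
    by (simp add: qexp_def)
  moreover have "iqf q (int n) * w ^ n - iqf q (int n - 1) * w ^ n = iqf q (int n) * (w * q) ^ n" for n
    unfolding iqf_diff_one power_int_of_nat by (simp add: power_mult_distrib algebra_simps)
  ultimately have "(\<lambda>n. iqf q (int n) * (w * q) ^ n) sums (qexp w - w * qexp w)" by simp
  then show ?thesis by (simp add: qexp_def sums_iff algebra_simps)
qed

lemma qexp_has_fps_expansion:
  "(\<lambda>z. qexp (z * y)) has_fps_expansion Abs_fps (\<lambda>k. iqf q (int k) * y ^ k)"
proof -
  let ?F = "Abs_fps (\<lambda>k. iqf q (int k) * y ^ k)"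
  define r where "r = (1 - norm q) / 2"
  have r: "0 < r" using norm_q by (simp add: r_def)
  \<comment> \<open>Adding 1 avoids division by zero for \<open>y = 0\<close>.\<close>
  define d where "d = r / (norm y + 1)"
  have d: "0 < d" using r by (simp add: d_def add_nonneg_pos)
  have small: "norm (z * y) < r" if "norm z \<le> d / 2" for z
  proof -
    have "norm (z * y) \<le> d / 2 * norm y" unfolding norm_mult by (rule mult_right_mono[OF that norm_ge_zero])
    also have "\<dots> < d * (norm y + 1)"
      using d by (simp add: field_simps) (smt (verit) mult_nonneg_nonneg norm_ge_zero)
    also have "\<dots> = r" by (simp add: d_def add_nonneg_eq_0_iff)
    finally show ?thesis .
  qed
  have "summable (\<lambda>n. fps_nth ?F n * of_real (d / 2) ^ n)"
  proof -
    have "norm (of_real (d / 2) * y) < (1 - norm q) / 2"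
      using small[of "of_real (d / 2)"] d by (simp add: r_def)
    moreover have "fps_nth ?F n * of_real (d / 2) ^ n = iqf q (int n) * (of_real (d / 2) * y) ^ n" for n
      by (simp only: fps_nth_Abs_fps power_mult_distrib ac_simps)
    ultimately show ?thesis using summable_qexp by presburger
  qed
  then have "norm (of_real (d / 2) :: complex) \<le> fps_conv_radius ?F"
    unfolding fps_conv_radius_def by (rule conv_radius_geI)
  moreover have "0 < ereal (norm (of_real (d / 2) :: complex))" using d by simp
  ultimately have "0 < fps_conv_radius ?F" by (rule less_le_trans[rotated])
  moreover have "eval_fps ?F z = qexp (z * y)" for z
    by (simp add: eval_fps_def qexp_def power_mult_distrib algebra_simps)
  ultimately show ?thesis by (simp add: has_fps_expansion_def)
qed

text \<open>
  Iterating \<open>qexp_functional\<close> multiplies \<open>qexp w\<close> by \<open>1 - w q\<^sup>j\<close> for \<open>j < n\<close>, and the result \<open>qexp (w q\<^sup>n)\<close> tends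
  to \<open>qexp 0 = 1\<close>.
\<close>

lemma Gamma_q_eq_qexp:
  assumes w: "norm w < (1 - norm q) / 2" shows "Gamma_q q w = qexp w"
proof -
  have small: "norm (w * q ^ n) < (1 - norm q) / 2" for n
  proof -
    have "norm (w * q ^ n) \<le> norm w"
      using norm_q power_le_one[of "norm q" n] by (simp add: norm_mult norm_power mult_left_le)
    then show ?thesis using w by simp
  qed
  have half: "(1 - norm q) / 2 \<le> 1 / 2" by simp
  have factor: "1 - w * q ^ n \<noteq> 0" for n
  proof
    assume "1 - w * q ^ n = 0"
    then have "norm (w * q ^ n) = 1" by simp
    then show False using small[of n] half by linarith
  qed
  have iter: "qexp (w * q ^ n) = (\<Prod>j<n. 1 - w * q ^ j) * qexp w" for n
  proof (induction n)
    case (Suc n)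
    then show ?case using qexp_functional[OF small[of n]] by (simp add: algebra_simps)
  qed simp
  have "isCont qexp 0"
    using has_fps_expansion_imp_continuous[OF qexp_has_fps_expansion[of 1]] by simp
  moreover have "(\<lambda>n. w * q ^ n) \<longlonglongrightarrow> 0"
    using LIMSEQ_power_zero[OF norm_q] tendsto_mult_right_zero by blast
  ultimately have "(\<lambda>n. qexp (w * q ^ n)) \<longlonglongrightarrow> qexp 0"
    by (rule isCont_tendsto_compose)
  moreover have "qexp 0 = 1"
    unfolding qexp_def by (subst powser_zero) simp
  ultimately have lim: "(\<lambda>n. (\<Prod>j<n. 1 - w * q ^ j) * qexp w) \<longlonglongrightarrow> 1"
    by (simp add: iter)
  have nz: "qexp w \<noteq> 0"
  proof
    assume "qexp w = 0"
    then have "(\<lambda>n. 0 :: complex) \<longlonglongrightarrow> 1" using lim by simp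
    then show False using LIMSEQ_unique[OF tendsto_const] by fastforce
  qed
  have "(\<lambda>n. qexp w / ((\<Prod>j<n. 1 - w * q ^ j) * qexp w)) \<longlonglongrightarrow> qexp w / 1"
    by (intro tendsto_divide lim tendsto_const) simp
  then have "(\<lambda>n. \<Prod>j<n. 1 / (1 - w * q ^ j)) \<longlonglongrightarrow> qexp w"
    using nz by (simp add: prod_dividef)
  then show ?thesis
    unfolding Gamma_q_def using nz by (rule prodinf_eq_prod_lim')
qed

lemma L_eigenvalue_eq:
  "L_eigenvalue q l x = (\<Prod>i\<le>l. Abs_fps (\<lambda>k. iqf q (int k) * x i ^ k))"
  unfolding L_eigenvalue_def
proof (intro prod.cong refl fps_expansion_eqI)
  fix i
  have "((\<lambda>z. norm (z * x i)) \<longlongrightarrow> norm (0 * x i)) (nhds 0)"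
    by (intro tendsto_intros filterlim_ident)
  then have "\<forall>\<^sub>F z in nhds 0. norm (z * x i) < (1 - norm q) / 2"
    by (rule order_tendstoD) (use norm_q in simp)
  then have "\<forall>\<^sub>F z in nhds 0. Gamma_q q (z * x i) = qexp (z * x i)"
    by eventually_elim (rule Gamma_q_eq_qexp)
  then show "(\<lambda>z. Gamma_q q (z * x i)) has_fps_expansion Abs_fps (\<lambda>k. iqf q (int k) * x i ^ k)"
    using qexp_has_fps_expansion[of "x i"] by (subst has_fps_expansion_cong[OF _ refl])
qed

section \<open>The eigenvalue equation\<close>

lemma Delta_q_nonzero: "Delta_q q l lam \<noteq> 0"
  by (simp add: Delta_q_def qfac_nonzero)

text \<open>
  For partitions with at most \<open>l + 1\<close> rows the infinite products have one more factor each than \<open>Delta_q\<close> and the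
  kernel, namely the \<open>q\<close>-factorial of the last part and its inverse, which cancel.
\<close>

lemma Pieri_coeff_eq_kern:
  assumes "lam \<in> partition_tuples l" "mu \<in> partition_tuples l"
  shows "norm_wt q lam * strip_wt q lam mu = Delta_q q l lam * kern q l lam mu"
proof -
  have v: "vanishes_from (Suc l) lam" "vanishes_from (Suc l) mu" and p: "lam \<in> parts"
    using assms by (auto simp: partition_tuples_iff)
  have 0: "lam (Suc l) = 0" "mu (Suc l) = 0" using v by (auto simp: vanishes_from_def)
  have "(\<Prod>i<Suc l. iqf q (mu i - lam i)) = iqf q (mu 0 - lam 0) * (\<Prod>i<l. iqf q (mu (Suc i) - lam (Suc i)))"
    by (rule prod.lessThan_Suc_shift)
  then have "strip_wt q lam mu = kern q l lam mu * iqf q (lam l)"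
    unfolding strip_wt_eq[OF v] kern_def prod.distrib by (simp add: 0)
  moreover have "norm_wt q lam = Delta_q q l lam * qfac q (lam l)"
    unfolding norm_wt_eq[OF v(1)] by (simp add: Delta_q_def 0)
  ultimately show ?thesis using qfac_iqf[OF parts_nonneg[OF p, of l]] by (simp add: algebra_simps)
qed

lemma qWhittaker_eq:
  assumes "lam \<in> partition_tuples l"
  shows "Delta_q q l lam * qWhittaker q l lam x = meval l (qWhit q lam) x"
proof -
  have "lam \<in> parts" using assms by (simp add: partition_tuples_iff)
  then show ?thesis
    using macdonald_P_eq[OF nat_part_of_int_part(1)] nat_part_of_int_part(2)
    by (simp add: qWhittaker_def Delta_q_nonzero)
qed

theorem Baxter_Q_qWhittaker:
  assumes lam: "lam \<in> partition_tuples l"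
  shows "Baxter_Q q l fps_X (\<lambda>mu. fps_const (qWhittaker q l mu x)) lam =
    L_eigenvalue q l x * fps_const (qWhittaker q l lam x)"
proof (rule fps_ext)
  let ?f = "\<lambda>mu. fps_const (qWhittaker q l mu x)"
  fix n
  have lp: "lam \<in> parts" using lam by (simp add: partition_tuples_iff)
  define V where "V = {mu \<in> partition_tuples l. tsize l mu \<le> tsize l lam + int n}"
  define T where "T = {mu \<in> partition_tuples l. tsize l mu = tsize l lam + int n}"
  have "fps_nth (Baxter_Q q l fps_X ?f lam) n =
      fps_nth (Baxter_Q q l (fps_const 1 * fps_X) ?f lam) n" by simp
  also have "\<dots> = (\<Sum>mu\<in>V. Baxter_term l 1 lam ?f n mu)"
    unfolding V_def by (rule fps_nth_Baxter_Q[OF lam order_refl])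
  also have "\<dots> = (\<Sum>mu\<in>T. kern q l lam mu * meval l (qWhit q mu) x)"
  proof (rule sum.mono_neutral_cong_right)
    show "finite V" unfolding V_def by (rule finite_bounded_partition_tuples)
    show "T \<subseteq> V" by (auto simp: T_def V_def)
    show "\<forall>mu\<in>V - T. Baxter_term l 1 lam ?f n mu = 0"
    proof
      fix mu assume mu: "mu \<in> V - T"
      then have "nat (tsize l mu - tsize l lam) < n \<or> n = 0 \<and> tsize l mu < tsize l lam"
        by (auto simp: V_def T_def)
      then show "Baxter_term l 1 lam ?f n mu = 0"
        using kern_nonzero_tsize[of l lam mu] by (cases "kern q l lam mu = 0") (auto simp: Baxter_term_def Let_def)
    qed
    fix mu assume "mu \<in> T"
    then have "mu \<in> partition_tuples l" "nat (tsize l mu - tsize l lam) = n" by (auto simp: T_def)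
    then show "Baxter_term l 1 lam ?f n mu =
        kern q l lam mu * meval l (qWhit q mu) x"
      by (simp add: Baxter_term_def qWhittaker_eq[symmetric])
  qed
  finally have L: "fps_nth (Baxter_Q q l fps_X ?f lam) n =
      (\<Sum>mu\<in>T. kern q l lam mu * meval l (qWhit q mu) x)" .
  have "meval l (cplt q (int n)) x * meval l (qWhit q lam) x = meval l (cplt q (int n) * qWhit q lam) x"
    by (rule meval_mult[OF degree_le_cplt degree_le_qWhit[OF lp], symmetric])
  also have "\<dots> = (\<Sum>mu\<in>parts_of (weight lam + int n). norm_wt q lam * strip_wt q lam mu * meval l (qWhit q mu) x)"
    unfolding cplt_Pieri[OF lp]
  proof (rule meval_sum)
    fix mu assume "mu \<in> parts_of (weight lam + int n)"
    then show "degree_le (nat (weight lam + int n)) (qWhit q mu)"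
      using degree_le_qWhit[of mu] by (simp add: parts_of_def)
  qed
  also have "\<dots> = (\<Sum>mu\<in>T. Delta_q q l lam * (kern q l lam mu * meval l (qWhit q mu) x))"
  proof (rule sum.mono_neutral_cong_right[OF finite_parts_of])
    show "T \<subseteq> parts_of (weight lam + int n)"
      using tsize_eq_weight lam by (auto simp: T_def parts_of_def partition_tuples_iff)
    show "\<forall>mu\<in>parts_of (weight lam + int n) - T. norm_wt q lam * strip_wt q lam mu * meval l (qWhit q mu) x = 0"
    proof
      fix mu assume mu: "mu \<in> parts_of (weight lam + int n) - T"
      then have mp: "mu \<in> parts" "weight mu = weight lam + int n" by (auto simp: parts_of_def)
      have "\<not> vanishes_from (Suc l) mu"
      proof
        assume "vanishes_from (Suc l) mu"
        then have "mu \<in> partition_tuples l" using mp by (simp add: partition_tuples_iff)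
        then show False using mu mp tsize_eq_weight lam by (simp add: T_def)
      qed
      then show "norm_wt q lam * strip_wt q lam mu * meval l (qWhit q mu) x = 0"
        by (simp add: meval_qWhit_too_long mp)
    qed
    fix mu assume "mu \<in> T"
    then have "mu \<in> partition_tuples l" by (simp add: T_def)
    then show "norm_wt q lam * strip_wt q lam mu * meval l (qWhit q mu) x =
        Delta_q q l lam * (kern q l lam mu * meval l (qWhit q mu) x)"
      by (simp add: Pieri_coeff_eq_kern[OF lam])
  qed
  also have "\<dots> = Delta_q q l lam * fps_nth (Baxter_Q q l fps_X ?f lam) n"
    by (simp add: L sum_distrib_left)
  finally have "Delta_q q l lam * fps_nth (Baxter_Q q l fps_X ?f lam) n =
      meval l (cplt q (int n)) x * meval l (qWhit q lam) x" by (rule sym)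
  then have "Delta_q q l lam * fps_nth (Baxter_Q q l fps_X ?f lam) n =
      Delta_q q l lam * (fps_nth (L_eigenvalue q l x) n * qWhittaker q l lam x)"
    by (simp only: qWhittaker_eq[OF lam, symmetric] meval_cplt L_eigenvalue_eq mult.left_commute)
  then show "fps_nth (Baxter_Q q l fps_X ?f lam) n =
      fps_nth (L_eigenvalue q l x * fps_const (qWhittaker q l lam x)) n"
    using Delta_q_nonzero by simp
qed

end

theorem theorem2p3:
  fixes l :: nat and q :: complex
  assumes "0 < norm q" and "norm q < 1"
  shows "(\<forall>x :: nat \<Rightarrow> complex. \<forall>lam \<in> partition_tuples l.
            Baxter_Q q l fps_X (\<lambda>\<mu>. fps_const (qWhittaker q l \<mu> x)) lam =
              L_eigenvalue q l x * fps_const (qWhittaker q l lam x))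
       \<and> (\<forall>f :: (nat \<Rightarrow> int) \<Rightarrow> complex fps. \<forall>lam \<in> partition_tuples l.
            (Toda_D q l (- fps_X) \<circ> Baxter_Q q l fps_X) f lam =
              Baxter_Q q l (fps_const q * fps_X) f lam)"
proof -
  interpret nome q using assms by unfold_locales auto
  show ?thesis by (simp add: Baxter_Q_qWhittaker Toda_D_Baxter_Q)
qed

end
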